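(* Let $A$ be an equicharacteristic (commutative) regular local ring with maximal ideal $m$ and residue field $K$ of characteristic $p$ (possibly $p=0$). Let $A'$ be a first order deformation of $A$, with induced bracket $\{-,-\}$ on $A$. Let $M$ be a finite length $A$-module such that there exists a first order $A'$-deformation $M'$ of $M$. Assume that the characteristic of $K$ is either zero or prime to the length of $M$. Then $m$ is involutive, i.e. $\{m,m\}\subset m$.
   Context: A first order deformation of a ring $A$ is a (not necessarily commutative) ring $A'$ containing a central element $h$ such that $A'/hA'=A$ and $\operatorname{Ann}_{A'}(h)=hA'$. No assumption is made that $A'$ is defined over the same ground field as $A$. The center $Z(A)$ (which is $A$ itself when $A$ is commutative) then carries an anti-symmetric biderivation, the induced bracket $\{-,-\}$, defined by $$\tilde a\tilde b-\tilde b\tilde a=h\{a,b\},$$ where $a,b\in Z(A)$ and $\tilde a,\tilde b\in A'$ are arbitrary liftings of $a,b$ (multiplication by $h$ induces an isomorphism $A\cong hA'$). A first order $A'$-deformation of a left $A$-module $M$ is a left $A'$-module $M'$ such that $M'/hM'=M$ and $\operatorname{Ann}_{M'}(h)=hM'$.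
   Formalization: The module M is assumed nonzero; for M = 0 and K of characteristic zero the statement fails, e.g. A = k[[x,y]] with {x,y} = 1 and M = M' = 0. *)

theory Defs
  imports "HOL-Algebra.Algebra" "HOL-Library.Extended_Nat"
begin

section \<open>Regular local rings and length\<close>

text \<open>The length of a chain is the number of its strict inclusions.\<close>

definition chain_sup :: "'a set set \<Rightarrow> enat" where
  "chain_sup F =
     (SUP Xs \<in> {Xs. Xs \<noteq> [] \<and> set Xs \<subseteq> F \<and> sorted_wrt (\<subset>) Xs}. enat (length Xs - 1))"

definition krull_dim :: "('a, 'r) ring_scheme \<Rightarrow> enat" where
  "krull_dim R = chain_sup {P. primeideal P R}"

definition module_length :: "('a, 'r) ring_scheme \<Rightarrow> ('a, 'c, 'm) module_scheme \<Rightarrow> enat" where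
  "module_length R M = chain_sup {N. submodule N R M}"

definition finite_length :: "('a, 'r) ring_scheme \<Rightarrow> ('a, 'c, 'm) module_scheme \<Rightarrow> bool" where
  "finite_length R M \<longleftrightarrow> module_length R M \<noteq> \<infinity>"

text \<open>The non-negative generator of the kernel of the map from the integers, as for \<open>CHAR\<close>.\<close>

definition ring_char :: "('a, 'r) ring_scheme \<Rightarrow> nat" where
  "ring_char R = Gcd {n::nat. [n] \<cdot>\<^bsub>R\<^esub> \<one>\<^bsub>R\<^esub> = \<zero>\<^bsub>R\<^esub>}"

locale local_ring = cring R + maximalideal m R for R (structure) and m +
  assumes maximal_unique: "maximalideal I R \<Longrightarrow> I = m"

locale regular_local_ring = local_ring R m + noetherian_ring R for R (structure) and m +
  assumes regular: "\<exists>S \<subseteq> carrier R. finite S \<and> enat (card S) = krull_dim R \<and> m = Idl S"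

locale equicharacteristic_local_ring = local_ring R m for R (structure) and m +
  assumes equichar: "ring_char R = ring_char (R Quot m)"

section \<open>First order deformations\<close>

text \<open>
  The identification of \<open>A'/hA'\<close> with \<open>A\<close> is given by the induced projection \<open>\<pi>\<close> from \<open>A'\<close>
  onto \<open>A\<close>; see \<open>quotient_iso\<close> below.
\<close>

locale first_order_deformation = ring_hom_ring A' A \<pi>
  for A' (structure) and A and \<pi> +
  fixes h
  assumes h_closed: "h \<in> carrier A'"
    and h_central: "x \<in> carrier A' \<Longrightarrow> h \<otimes> x = x \<otimes> h"
    and proj_surj: "\<pi> ` carrier A' = carrier A"
    and proj_kernel: "a_kernel A' A \<pi> = {h \<otimes> x |x. x \<in> carrier A'}"
    and Ann_h: "{x \<in> carrier A'. h \<otimes> x = \<zero>} = {h \<otimes> x |x. x \<in> carrier A'}"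

text \<open>
  The product of \<open>h\<close> with an element \<open>c\<close> of \<open>A\<close> is \<open>h \<otimes> z\<close> for any lifting \<open>z\<close> of \<open>c\<close>. The
  bracket is meaningful for central \<open>a\<close> and \<open>b\<close>; see \<open>induced_bracket_eqI\<close> and
  \<open>induced_bracket_lift\<close> below.
\<close>

definition induced_bracket ::
    "('b, 's) ring_scheme \<Rightarrow> ('a, 'r) ring_scheme \<Rightarrow> ('b \<Rightarrow> 'a) \<Rightarrow> 'b \<Rightarrow> 'a \<Rightarrow> 'a \<Rightarrow> 'a" where
  "induced_bracket A' A \<pi> h a b =
     (THE c. c \<in> carrier A \<and>
        (\<forall>x \<in> carrier A'. \<forall>y \<in> carrier A'. \<forall>z \<in> carrier A'.
           \<pi> x = a \<longrightarrow> \<pi> y = b \<longrightarrow> \<pi> z = c \<longrightarrow>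
           x \<otimes>\<^bsub>A'\<^esub> y \<ominus>\<^bsub>A'\<^esub> y \<otimes>\<^bsub>A'\<^esub> x = h \<otimes>\<^bsub>A'\<^esub> z))"

text \<open>The library's \<open>module\<close> requires a commutative ring.\<close>

locale left_module = R?: ring R + M?: abelian_group M
  for R :: "('a, 'r) ring_scheme" (structure) and M :: "('a, 'c, 'm) module_scheme" (structure) +
  assumes smult_closed:
      "\<lbrakk>a \<in> carrier R; x \<in> carrier M\<rbrakk> \<Longrightarrow> a \<odot>\<^bsub>M\<^esub> x \<in> carrier M"
    and smult_l_distr:
      "\<lbrakk>a \<in> carrier R; b \<in> carrier R; x \<in> carrier M\<rbrakk> \<Longrightarrow>
       (a \<oplus> b) \<odot>\<^bsub>M\<^esub> x = a \<odot>\<^bsub>M\<^esub> x \<oplus>\<^bsub>M\<^esub> b \<odot>\<^bsub>M\<^esub> x"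
    and smult_r_distr:
      "\<lbrakk>a \<in> carrier R; x \<in> carrier M; y \<in> carrier M\<rbrakk> \<Longrightarrow>
       a \<odot>\<^bsub>M\<^esub> (x \<oplus>\<^bsub>M\<^esub> y) = a \<odot>\<^bsub>M\<^esub> x \<oplus>\<^bsub>M\<^esub> a \<odot>\<^bsub>M\<^esub> y"
    and smult_assoc:
      "\<lbrakk>a \<in> carrier R; b \<in> carrier R; x \<in> carrier M\<rbrakk> \<Longrightarrow>
       (a \<otimes> b) \<odot>\<^bsub>M\<^esub> x = a \<odot>\<^bsub>M\<^esub> (b \<odot>\<^bsub>M\<^esub> x)"
    and smult_one: "x \<in> carrier M \<Longrightarrow> \<one> \<odot>\<^bsub>M\<^esub> x = x"

text \<open>
  As for rings, the identification of \<open>M'/hM'\<close> with \<open>M\<close> is given by an additive surjection \<open>\<psi>\<close>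
  with kernel \<open>hM'\<close> that is linear over \<open>\<pi>\<close>.
\<close>

locale first_order_module_deformation =
  first_order_deformation A' A \<pi> h + M: left_module A M + M': left_module A' M' +
  abelian_group_hom M' M \<psi>
  for A' :: "('b, 's) ring_scheme" (structure) and A :: "('a, 'r) ring_scheme" and \<pi> and h
    and M' :: "('b, 'd, 'u) module_scheme" and M :: "('a, 'c, 't) module_scheme" and \<psi> +
  assumes proj_smult:
      "\<lbrakk>x \<in> carrier A'; u \<in> carrier M'\<rbrakk> \<Longrightarrow> \<psi> (x \<odot>\<^bsub>M'\<^esub> u) = \<pi> x \<odot>\<^bsub>M\<^esub> \<psi> u"
    and proj_module_surj: "\<psi> ` carrier M' = carrier M"
    and proj_module_kernel: "a_kernel M' M \<psi> = {h \<odot>\<^bsub>M'\<^esub> u |u. u \<in> carrier M'}"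
    and Ann_module_h:
      "{u \<in> carrier M'. h \<odot>\<^bsub>M'\<^esub> u = \<zero>\<^bsub>M'\<^esub>} = {h \<odot>\<^bsub>M'\<^esub> u |u. u \<in> carrier M'}"

section \<open>Consistency of the definitions\<close>

lemma left_module_iff_module:
  assumes "cring R"
  shows "left_module R M \<longleftrightarrow> module R M"
  using assms
  by (auto simp: left_module_def module_def left_module_axioms_def module_axioms_def cring_def)

context first_order_deformation
begin

lemma quotient_iso: "(\<lambda>C. the_elem (\<pi> ` C)) \<in> ring_iso (A' Quot (PIdl h)) A"
proof -
  have "PIdl h = a_kernel A' A \<pi>"
    unfolding proj_kernel cgenideal_def by (intro Collect_cong ex_cong1) (auto dest: h_central)
  then show ?thesis
    using FactRing_iso_set[OF proj_surj] by metis
qed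

lemma proj_minus:
  assumes "x \<in> carrier A'" "y \<in> carrier A'"
  shows "\<pi> (x \<ominus> y) = \<pi> x \<ominus>\<^bsub>A\<^esub> \<pi> y"
  unfolding a_minus_def using assms by (simp only: hom_add hom_a_inv R.a_inv_closed)

lemma proj_eqE:
  assumes "x \<in> carrier A'" "y \<in> carrier A'" "\<pi> x = \<pi> y"
  obtains w where "w \<in> carrier A'" "x \<ominus> y = h \<otimes> w"
proof -
  have "\<pi> (x \<ominus> y) = \<zero>\<^bsub>A\<^esub>"
    using proj_minus[OF assms(1,2)] S.r_right_minus_eq[OF hom_closed hom_closed, OF assms(1,2)]
      assms(3) by metis
  then have "x \<ominus> y \<in> a_kernel A' A \<pi>"
    unfolding a_kernel_def' using R.minus_closed[OF assms(1,2)] by blast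
  then show ?thesis
    unfolding proj_kernel using that by blast
qed

lemma proj_eq_iff:
  assumes "x \<in> carrier A'" "y \<in> carrier A'"
  shows "\<pi> x = \<pi> y \<longleftrightarrow> h \<otimes> x = h \<otimes> y"
proof -
  have "\<pi> x = \<pi> y \<longleftrightarrow> \<pi> (x \<ominus> y) = \<zero>\<^bsub>A\<^esub>"
    using proj_minus[OF assms] S.r_right_minus_eq[OF hom_closed hom_closed, OF assms] by metis
  also have "\<dots> \<longleftrightarrow> x \<ominus> y \<in> a_kernel A' A \<pi>"
    unfolding a_kernel_def' using R.minus_closed[OF assms] by blast
  also have "\<dots> \<longleftrightarrow> h \<otimes> (x \<ominus> y) = \<zero>"
    unfolding trans[OF proj_kernel Ann_h[symmetric]] using R.minus_closed[OF assms] by blast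
  also have "h \<otimes> (x \<ominus> y) = h \<otimes> x \<ominus> h \<otimes> y"
    unfolding a_minus_def using assms h_closed
    by (simp only: R.r_distr R.r_minus R.a_inv_closed)
  also have "h \<otimes> x \<ominus> h \<otimes> y = \<zero> \<longleftrightarrow> h \<otimes> x = h \<otimes> y"
    using assms h_closed by (intro R.r_right_minus_eq) auto
  finally show ?thesis .
qed

lemma commutator_lift_indep:
  assumes "x \<in> carrier A'" "x' \<in> carrier A'" "y \<in> carrier A'" "\<pi> x = \<pi> x'"
    and central: "\<And>c. c \<in> carrier A \<Longrightarrow> \<pi> y \<otimes>\<^bsub>A\<^esub> c = c \<otimes>\<^bsub>A\<^esub> \<pi> y"
  shows "x \<otimes> y \<ominus> y \<otimes> x = x' \<otimes> y \<ominus> y \<otimes> x'"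
proof -
  obtain w where w: "w \<in> carrier A'" "x \<ominus> x' = h \<otimes> w"
    using proj_eqE[OF assms(1,2,4)] .
  define d where "d = h \<otimes> w"
  have d: "d \<in> carrier A'"
    using w(1) h_closed by (simp add: d_def)
  have x: "x = x' \<oplus> d"
    using w(2) assms(1,2) d unfolding d_def[symmetric] a_minus_def
    by (metis R.a_comm R.a_inv_closed R.a_assoc R.l_neg R.r_zero)
  have "\<pi> (w \<otimes> y) = \<pi> (y \<otimes> w)"
    using w(1) assms(3) central by simp
  then have eq: "h \<otimes> (w \<otimes> y) = h \<otimes> (y \<otimes> w)"
    using proj_eq_iff[of "w \<otimes> y" "y \<otimes> w"] w(1) assms(3) by simp
  have "d \<otimes> y = h \<otimes> (w \<otimes> y)"
    using w(1) assms(3) h_closed by (simp add: d_def R.m_assoc)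
  also have "\<dots> = (h \<otimes> y) \<otimes> w"
    unfolding eq using w(1) assms(3) h_closed by (simp add: R.m_assoc)
  also have "\<dots> = y \<otimes> d"
    unfolding h_central[OF assms(3)] using w(1) assms(3) h_closed by (simp add: d_def R.m_assoc)
  finally have comm: "d \<otimes> y = y \<otimes> d" .
  have "(p \<oplus> r) \<ominus> (q \<oplus> r) = p \<ominus> q"
    if "p \<in> carrier A'" "q \<in> carrier A'" "r \<in> carrier A'" for p q r
  proof -
    have "r \<oplus> (\<ominus> q \<oplus> \<ominus> r) = \<ominus> q"
      using that by (metis R.a_inv_closed R.a_lcomm R.r_neg R.r_zero)
    then show ?thesis
      unfolding a_minus_def using that
      by (simp only: R.minus_add R.a_assoc R.a_inv_closed R.a_closed)
  qed
  then show ?thesis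
    using x d assms(2,3) by (simp add: R.l_distr R.r_distr comm)
qed

lemma induced_bracket_eqI:
  assumes xyz: "x \<in> carrier A'" "y \<in> carrier A'" "z \<in> carrier A'"
    and cx: "\<And>c. c \<in> carrier A \<Longrightarrow> \<pi> x \<otimes>\<^bsub>A\<^esub> c = c \<otimes>\<^bsub>A\<^esub> \<pi> x"
    and cy: "\<And>c. c \<in> carrier A \<Longrightarrow> \<pi> y \<otimes>\<^bsub>A\<^esub> c = c \<otimes>\<^bsub>A\<^esub> \<pi> y"
    and eq: "x \<otimes> y \<ominus> y \<otimes> x = h \<otimes> z"
  shows "induced_bracket A' A \<pi> h (\<pi> x) (\<pi> y) = \<pi> z"
  unfolding induced_bracket_def
proof (rule the_equality, intro conjI ballI impI)
  show "\<pi> z \<in> carrier A" using xyz by simp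
next
  fix x' y' z'
  assume c: "x' \<in> carrier A'" "y' \<in> carrier A'" "z' \<in> carrier A'"
    and p: "\<pi> x' = \<pi> x" "\<pi> y' = \<pi> y" "\<pi> z' = \<pi> z"
  have 1: "x' \<otimes> y \<ominus> y \<otimes> x' = h \<otimes> z"
    using commutator_lift_indep[OF c(1) xyz(1,2) p(1) cy] eq by simp
  have "y' \<otimes> x' \<ominus> x' \<otimes> y' = y \<otimes> x' \<ominus> x' \<otimes> y"
    using commutator_lift_indep[OF c(2) xyz(2) c(1) p(2)] cx p(1) by simp
  then have "\<ominus> (y' \<otimes> x' \<ominus> x' \<otimes> y') = \<ominus> (y \<otimes> x' \<ominus> x' \<otimes> y)" by simp
  then have "x' \<otimes> y' \<ominus> y' \<otimes> x' = x' \<otimes> y \<ominus> y \<otimes> x'"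
    unfolding a_minus_def using c xyz
    by (simp only: R.minus_add R.minus_minus R.a_comm R.m_closed R.a_inv_closed)
  with 1 show "x' \<otimes> y' \<ominus> y' \<otimes> x' = h \<otimes> z'"
    using proj_eq_iff[OF c(3) xyz(3)] p(3) by simp
next
  fix c
  assume c: "c \<in> carrier A \<and>
        (\<forall>x' \<in> carrier A'. \<forall>y' \<in> carrier A'. \<forall>z' \<in> carrier A'.
           \<pi> x' = \<pi> x \<longrightarrow> \<pi> y' = \<pi> y \<longrightarrow> \<pi> z' = c \<longrightarrow>
           x' \<otimes> y' \<ominus> y' \<otimes> x' = h \<otimes> z')"
  then obtain w where w: "w \<in> carrier A'" "\<pi> w = c"
    using proj_surj by (metis imageE)
  then have "h \<otimes> z = h \<otimes> w"
    using c xyz eq by metis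
  then show "c = \<pi> z"
    using proj_eq_iff[OF xyz(3) w(1)] w(2) by simp
qed

lemma induced_bracket_lift:
  assumes xy: "x \<in> carrier A'" "y \<in> carrier A'"
    and cx: "\<And>c. c \<in> carrier A \<Longrightarrow> \<pi> x \<otimes>\<^bsub>A\<^esub> c = c \<otimes>\<^bsub>A\<^esub> \<pi> x"
    and cy: "\<And>c. c \<in> carrier A \<Longrightarrow> \<pi> y \<otimes>\<^bsub>A\<^esub> c = c \<otimes>\<^bsub>A\<^esub> \<pi> y"
  obtains z where "z \<in> carrier A'" "\<pi> z = induced_bracket A' A \<pi> h (\<pi> x) (\<pi> y)"
    "x \<otimes> y \<ominus> y \<otimes> x = h \<otimes> z"
proof -
  have "\<pi> (x \<otimes> y) = \<pi> (y \<otimes> x)"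
    using xy cx[of "\<pi> y"] by simp
  then obtain z where z: "z \<in> carrier A'" "x \<otimes> y \<ominus> y \<otimes> x = h \<otimes> z"
    using proj_eqE[of "x \<otimes> y" "y \<otimes> x"] xy by blast
  with induced_bracket_eqI[OF xy z(1) cx cy z(2)] show ?thesis
    using that by simp
qed

end

end

(*
  Choose a composition series of M and lift a generator of each factor to M'. If A had a
  coefficient field that lifted to A', elements x', y' of A' over x, y in m would act on M' by
  matrices that are strictly triangular modulo h, and comparing traces of [x', y'] = h {x, y}
  would give length(M) * {x, y} = 0 in K. A' need not contain a field, but a subring S of A
  mapping onto K suffices if the lifts of the elements of m lying in S send each lifted
  generator e'_k into h M'_(k+1): commuting two entries of the matrices then only produces terms that do
  not reach the diagonal. These elements form an ideal that contains Ann(M)^2. The subring S is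
  found by refining coefficient rings modulo ideals J with J^2 in the next ideal, starting from
  J = m and S = A; in characteristic p each refinement starts from the p-th powers of the
  previous subring, which removes the inseparability.
*)
theory Submission
  imports Defs
begin

section \<open>Units of a local ring, and the ring \<open>S[k]\<close> described through values of
  polynomials\<close>

section \<open>Values of polynomials over a subring\<close>

text \<open>Why a subring: the matrix argument multiplies and subtracts entries, and a difference
  that vanishes in K must act on M as zero. Representatives of K that are not closed under these
  operations give no such control. The condition on \<open>S\<close> is therefore that its elements
  in m already lie in a small ideal J; \<open>S\<close> is then the preimage of a field inside A/J.
  Finite length stops the refinement after finitely many ideals, so no completion is taken. Squares
  are the common measure of error. A Newton step leaves the square of its correction; a p-th power
  of an element of J contains a square, as p is at least 2; and a lift of an element of Ann(M) maps
  M' into hM', so that its square acts through h twice and is zero. This is why the same refinement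
  step serves for Ann(M) and for the ideal of lifted annihilators. The matrices have entries in the
  noncommutative ring A', but commutators in A' are multiples of h, and below a factor h only
  residues in A count. The traces are therefore taken in A, after the diagonal terms have been
  divided by h.\<close>

lemma (in ideal) minus_mem: "\<lbrakk>a \<in> I; b \<in> I\<rbrakk> \<Longrightarrow> a \<ominus> b \<in> I"
  by (simp add: a_minus_def)

lemma (in ideal) mem_if_minus_mem: "\<lbrakk>a \<in> carrier R; b \<in> I; a \<ominus> b \<in> I\<rbrakk> \<Longrightarrow> a \<in> I"
  using additive_subgroup.a_closed[OF is_additive_subgroup, of "a \<ominus> b" b] Icarr[of b] by (simp add: a_minus_def a_assoc l_neg)

lemma subring_minus_closed: "\<lbrakk>subring S R; a \<in> S; b \<in> S\<rbrakk> \<Longrightarrow> a \<ominus>\<^bsub>R\<^esub> b \<in> S"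
  by (simp add: a_minus_def subringE)

lemma (in ring) subring_add_pow_closed:
  fixes n :: nat
  assumes "subring S R"
  shows "add_pow R n \<one> \<in> S"
  by (induction n) (simp_all add: subringE[OF assms])

text \<open>\<open>local_ring\<close> only says that there is one maximal ideal, so a nonunit has to
  be put inside some maximal ideal, by Zorn's lemma among the ideals that contain it and avoid
  \<open>\<one>\<close>. The Noetherian condition supplies the upper bounds: a nonempty chain of
  ideals contains its own union.\<close>

lemma (in cring) noetherian_local_ring_Units:
  assumes "local_ring R m" "noetherian_ring R" "a \<in> carrier R" "a \<notin> m"
  shows "a \<in> Units R"
proof (rule ccontr)
  assume nu: "a \<notin> Units R"
  let ?F = "{I. ideal I R \<and> a \<in> I \<and> \<one> \<notin> I}"
  have "\<one> \<notin> PIdl a"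
  proof
    assume "\<one> \<in> PIdl a"
    then obtain x where "x \<in> carrier R" "\<one> = x \<otimes> a"
      unfolding cgenideal_def by blast
    then have "x \<otimes> a = \<one> \<and> a \<otimes> x = \<one>"
      using assms(3) m_comm[of a x] by simp
    with \<open>x \<in> carrier R\<close> assms(3) have "a \<in> Units R"
      unfolding Units_def by blast
    with nu show False ..
  qed
  then have "PIdl a \<in> ?F"
    using cgenideal_ideal[OF assms(3)] cgenideal_self[OF assms(3)] by simp
  then have "?F \<noteq> {}" by blast
  moreover have "\<Union>C \<in> ?F" if "C \<noteq> {}" "subset.chain ?F C" for C
  proof -
    have "subset.chain {I. ideal I R} C"
      using that(2) unfolding subset_chain_def by (simp add: subset_eq)
    then have "\<Union>C \<in> C"
      using noetherian_ring.ideal_chain_is_trivial[OF assms(2)] that(1) by blast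
    moreover have "C \<subseteq> ?F"
      using that(2) unfolding subset_chain_def by simp
    ultimately show ?thesis by (rule rev_subsetD)
  qed
  ultimately have "\<exists>I \<in> ?F. \<forall>H \<in> ?F. I \<subseteq> H \<longrightarrow> H = I"
    by (rule subset_Zorn_nonempty)
  then obtain I where I: "I \<in> ?F" "\<forall>H \<in> ?F. I \<subseteq> H \<longrightarrow> H = I" ..
  have "maximalideal I R"
  proof (rule maximalidealI)
    show "carrier R \<noteq> I" using I(1) by auto
    show "J = I \<or> J = carrier R" if J: "ideal J R" "I \<subseteq> J" "J \<subseteq> carrier R" for J
    proof (cases "\<one> \<in> J")
      case True
      from ideal.one_imp_carrier[OF J(1) this] show ?thesis ..
    next
      case False
      then have "J \<in> ?F" using I(1) J by auto
      from I(2)[rule_format, OF this J(2)] show ?thesis ..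
    qed
  qed (use I(1) in simp)
  then have "I = m" by (rule local_ring.maximal_unique[OF assms(1)])
  then show False using I(1) assms(4) by simp
qed

text \<open>
  The values at \<open>k\<close> of the polynomials of degree at most \<open>n\<close> over \<open>S\<close> with coefficient \<open>c\<close>
  in degree \<open>n\<close>.
\<close>

primrec poly_values :: "('a, 'r) ring_scheme \<Rightarrow> 'a set \<Rightarrow> 'a \<Rightarrow> 'a \<Rightarrow> nat \<Rightarrow> 'a set" where
  "poly_values R S k c 0 = {c}"
| "poly_values R S k c (Suc n) = {s \<oplus>\<^bsub>R\<^esub> k \<otimes>\<^bsub>R\<^esub> w |s w. s \<in> S \<and> w \<in> poly_values R S k c n}"

context cring
begin

context
  fixes S k
  assumes S: "subring S R" and k: "k \<in> carrier R"
begin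

abbreviation (input) "W \<equiv> poly_values R S k"

lemmas subring_memD = subsetD[OF subringE(1)[OF S]]

lemma poly_values_closed: "\<lbrakk>c \<in> carrier R; v \<in> W c n\<rbrakk> \<Longrightarrow> v \<in> carrier R"
  by (induction n arbitrary: v) (auto simp: k subring_memD)

lemma poly_values_add:
  assumes "a \<in> carrier R" "b \<in> carrier R"
  shows "\<lbrakk>u \<in> W a n; v \<in> W b n\<rbrakk> \<Longrightarrow> u \<oplus> v \<in> W (a \<oplus> b) n"
proof (induction n arbitrary: u v)
  case (Suc n)
  obtain s w t z where *: "u = s \<oplus> k \<otimes> w" "v = t \<oplus> k \<otimes> z" "s \<in> S" "t \<in> S"
      "w \<in> W a n" "z \<in> W b n"
    using Suc.prems by auto
  have c: "s \<in> carrier R" "t \<in> carrier R" "w \<in> carrier R" "z \<in> carrier R"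
    using * subring_memD poly_values_closed assms by blast+
  have "u \<oplus> v = (s \<oplus> t) \<oplus> k \<otimes> (w \<oplus> z)"
    unfolding * using c k by algebra
  moreover have "s \<oplus> t \<in> S" "w \<oplus> z \<in> W (a \<oplus> b) n"
    using * Suc.IH subringE(7)[OF S] by auto
  ultimately show ?case by auto
qed simp

lemma poly_values_mult:
  assumes "a \<in> carrier R" "t \<in> S"
  shows "u \<in> W a n \<Longrightarrow> t \<otimes> u \<in> W (t \<otimes> a) n"
proof (induction n arbitrary: u)
  case (Suc n)
  obtain s w where *: "u = s \<oplus> k \<otimes> w" "s \<in> S" "w \<in> W a n"
    using Suc.prems by auto
  have c: "s \<in> carrier R" "t \<in> carrier R" "w \<in> carrier R"
    using * subring_memD poly_values_closed assms by blast+
  have "t \<otimes> u = (t \<otimes> s) \<oplus> k \<otimes> (t \<otimes> w)"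
    unfolding * using c k by algebra
  moreover have "t \<otimes> s \<in> S" "t \<otimes> w \<in> W (t \<otimes> a) n"
    using * Suc.IH assms subringE(6)[OF S] by auto
  ultimately show ?case by auto
qed simp

lemma poly_values_zero: "\<zero> \<in> W \<zero> n"
proof (induction n)
  case (Suc n)
  have "\<zero> = \<zero> \<oplus> k \<otimes> \<zero>" using k by simp
  then show ?case using Suc subringE(2)[OF S] by auto
qed simp

lemma poly_values_times: "\<lbrakk>c \<in> carrier R; v \<in> W c n\<rbrakk> \<Longrightarrow> k \<otimes> v \<in> W c (Suc n)"
proof -
  assume "c \<in> carrier R" "v \<in> W c n"
  then have "k \<otimes> v = \<zero> \<oplus> k \<otimes> v" using k poly_values_closed by simp
  then show ?thesis using subringE(2)[OF S] \<open>v \<in> W c n\<close> by auto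
qed

lemma poly_values_pow: "k [^] n \<in> W \<one> n"
proof (induction n)
  case (Suc n)
  then show ?case using poly_values_times[OF one_closed Suc] k m_comm by simp
qed simp

lemma poly_values_const: "s \<in> S \<Longrightarrow> s \<in> W \<zero> (Suc n)"
proof -
  assume "s \<in> S"
  moreover from this have "s = s \<oplus> k \<otimes> \<zero>" using subring_memD k by simp
  ultimately show ?thesis using poly_values_zero[of n] by auto
qed

text \<open>\<open>W \<zero> n\<close> stands for the polynomials of degree below \<open>n\<close>.
  Splitting by the top coefficient lets the later arguments on minimal polynomials divide by it or
  discard it.\<close>

lemma poly_values_Suc: "W \<zero> (Suc n) = (\<Union>c\<in>S. W c n)"
proof (induction n)
  case 0
  have "s \<oplus> k \<otimes> \<zero> = s" if "s \<in> S" for s using that k subring_memD by simp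
  then show ?case by (auto, metis)
next
  case (Suc n)
  have "W \<zero> (Suc (Suc n)) = {s \<oplus> k \<otimes> w |s w. s \<in> S \<and> w \<in> (\<Union>c\<in>S. W c n)}"
    unfolding Suc[symmetric] by simp
  also have "\<dots> = (\<Union>c\<in>S. W c (Suc n))" by auto
  finally show ?case .
qed

lemma poly_values_mono: "m \<le> n \<Longrightarrow> W \<zero> m \<subseteq> W \<zero> n"
proof (induction n rule: dec_induct)
  case (step n)
  have "W \<zero> n \<subseteq> W \<zero> (Suc n)"
    unfolding poly_values_Suc using subringE(2)[OF S] by blast
  with step show ?case by blast
qed simp

text \<open>The discarded term is the product of \<open>c\<close> with a power of \<open>k\<close>,
  hence an element of \<open>J\<close>.\<close>

lemma poly_values_drop_top:
  assumes J: "ideal J R" "c \<in> J"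
  shows "v \<in> W c n \<Longrightarrow> \<exists>w \<in> W \<zero> n. v \<ominus> w \<in> J"
proof (induction n arbitrary: v)
  case 0
  then show ?case using J ideal.Icarr[OF J] by (simp add: a_minus_def)
next
  case (Suc n)
  interpret J: ideal J R by (fact J)
  obtain s u where *: "v = s \<oplus> k \<otimes> u" "s \<in> S" "u \<in> W c n" using Suc.prems by auto
  obtain w where w: "w \<in> W \<zero> n" "u \<ominus> w \<in> J" using Suc.IH[OF *(3)] by blast
  have c: "s \<in> carrier R" "u \<in> carrier R" "w \<in> carrier R"
    using * w subring_memD poly_values_closed J.Icarr[OF J(2)] zero_closed by blast+
  have "v \<ominus> (s \<oplus> k \<otimes> w) = k \<otimes> (u \<ominus> w)"
    unfolding * a_minus_def using c k by algebra
  moreover have "\<dots> \<in> J" using w k by (simp add: J.I_l_closed)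
  moreover have "s \<oplus> k \<otimes> w \<in> W \<zero> (Suc n)" using *(2) w by auto
  ultimately show ?case by metis
qed

text \<open>This is the ring \<open>S[k]\<close>. Products are handled by Horner's scheme in the
  left factor, \<open>(s + k w) v = s v + k (w v)\<close>, so that no product of polynomials has to
  be formed.\<close>

lemma poly_values_subring: "subring (\<Union>n. W \<zero> n) R"
proof (rule subringI)
  show "(\<Union>n. W \<zero> n) \<subseteq> carrier R" using poly_values_closed by blast
  show "\<one> \<in> (\<Union>n. W \<zero> n)" using poly_values_const subringE(3)[OF S] by blast
  show "\<ominus> v \<in> (\<Union>n. W \<zero> n)" if v: "v \<in> (\<Union>n. W \<zero> n)" for v
  proof -
    obtain n where "v \<in> W \<zero> n" using v by blast
    then have "(\<ominus> \<one>) \<otimes> v \<in> W ((\<ominus> \<one>) \<otimes> \<zero>) n"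
      using poly_values_mult[OF zero_closed subringE(5)[OF S subringE(3)[OF S]]] by blast
    moreover have "(\<ominus> \<one>) \<otimes> v = \<ominus> v"
      using poly_values_closed[OF zero_closed \<open>v \<in> W \<zero> n\<close>] by (simp add: l_minus)
    ultimately show ?thesis by auto
  qed
  show add: "u \<oplus> v \<in> (\<Union>n. W \<zero> n)" if "u \<in> (\<Union>n. W \<zero> n)" "v \<in> (\<Union>n. W \<zero> n)" for u v
  proof -
    obtain n n' where "u \<in> W \<zero> n" "v \<in> W \<zero> n'" using \<open>u \<in> _\<close> \<open>v \<in> _\<close> by blast
    then have "u \<in> W \<zero> (max n n')" "v \<in> W \<zero> (max n n')"
      using subsetD[OF poly_values_mono[OF max.cobounded1]]
        subsetD[OF poly_values_mono[OF max.cobounded2]] by blast+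
    from poly_values_add[OF zero_closed zero_closed this] show ?thesis
      unfolding l_zero[OF zero_closed] by blast
  qed
  show "u \<otimes> v \<in> (\<Union>n. W \<zero> n)" if "u \<in> (\<Union>n. W \<zero> n)" and v: "v \<in> (\<Union>n. W \<zero> n)" for u v
  proof -
    obtain n where "u \<in> W \<zero> n" using \<open>u \<in> _\<close> by blast
    then show ?thesis
    proof (induction n arbitrary: u)
      case 0
      obtain l where "v \<in> W \<zero> l" using v by blast
      then have "u \<otimes> v = \<zero>" using 0 poly_values_closed[OF zero_closed] by simp
      then show ?case using poly_values_zero by auto
    next
      case (Suc n)
      then obtain s w where *: "u = s \<oplus> k \<otimes> w" "s \<in> S" "w \<in> W \<zero> n" by auto
      obtain l where l: "v \<in> W \<zero> l" using v by blast
      obtain l' where l': "w \<otimes> v \<in> W \<zero> l'" using Suc.IH *(3) by blast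
      have c: "s \<in> carrier R" "w \<in> carrier R" "v \<in> carrier R"
        using subring_memD[OF *(2)] poly_values_closed[OF zero_closed *(3)] poly_values_closed[OF zero_closed l]
        by blast+
      have eq: "u \<otimes> v = s \<otimes> v \<oplus> k \<otimes> (w \<otimes> v)"
        unfolding *(1) using c k by algebra
      have "s \<otimes> v \<in> W \<zero> l"
        using poly_values_mult[OF zero_closed *(2) l] c by simp
      moreover have "k \<otimes> (w \<otimes> v) \<in> W \<zero> (Suc l')"
        using poly_values_times[OF zero_closed l'] .
      ultimately show ?case unfolding eq by (intro add UN_I[OF UNIV_I])
    qed
  qed
qed

end

end

section \<open>Taylor expansion, reduction of coefficients, division by a monic polynomial\<close>

context cring
begin

text \<open>\<open>d\<close> is the value at \<open>k\<close> of the derivative, of degree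
  \<open>n\<close> with top coefficient \<open>Suc n\<close> times \<open>c\<close>. A polynomial is
  present only through its value, so \<open>v'\<close> is rebuilt from the coefficients of
  \<open>v\<close> along the recursion. \<open>d\<close> is quantified before \<open>e\<close>
  because Newton's method chooses the displacement after seeing the derivative.\<close>

lemma poly_values_taylor:
  assumes S: "subring S R" and k: "k \<in> carrier R" and J: "ideal J R" and c: "c \<in> carrier R"
  shows "v \<in> poly_values R S k c (Suc n) \<Longrightarrow>
    \<exists>d \<in> poly_values R S k (add_pow R (Suc n) c) n.
      \<forall>e \<in> carrier R. e \<otimes> e \<in> J \<longrightarrow>
        (\<exists>v' \<in> poly_values R S (k \<oplus> e) c (Suc n). v' \<ominus> (v \<oplus> d \<otimes> e) \<in> J)"
proof (induction n arbitrary: v)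
  case 0
  then obtain s where s: "s \<in> S" "v = s \<oplus> k \<otimes> c" by auto
  have sc: "s \<in> carrier R" using s(1) subringE(1)[OF S] by blast
  have "s \<oplus> (k \<oplus> e) \<otimes> c \<ominus> (v \<oplus> c \<otimes> e) \<in> J" if "e \<in> carrier R" for e
  proof -
    have "s \<oplus> (k \<oplus> e) \<otimes> c \<ominus> (v \<oplus> c \<otimes> e) = \<zero>"
      unfolding s(2) using k c sc that by algebra
    then show ?thesis
      using additive_subgroup.zero_closed[OF ideal.axioms(1)[OF J]] by simp
  qed
  with s(1) c show ?case by auto
next
  case (Suc n)
  interpret J: ideal J R by (fact J)
  obtain s w where *: "v = s \<oplus> k \<otimes> w" "s \<in> S" "w \<in> poly_values R S k c (Suc n)"
    using Suc.prems by (subst (asm) poly_values.simps(2)) blast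
  obtain d where d: "d \<in> poly_values R S k (add_pow R (Suc n) c) n"
    and d_deriv: "\<And>e. \<lbrakk>e \<in> carrier R; e \<otimes> e \<in> J\<rbrakk> \<Longrightarrow>
      \<exists>w' \<in> poly_values R S (k \<oplus> e) c (Suc n). w' \<ominus> (w \<oplus> d \<otimes> e) \<in> J"
    using Suc.IH[OF *(3)] by blast
  have cl: "s \<in> carrier R" "w \<in> carrier R" "d \<in> carrier R"
    using subsetD[OF subringE(1)[OF S] *(2)] poly_values_closed[OF S k c *(3)]
      poly_values_closed[OF S k add.nat_pow_closed[OF c] d] by auto
  \<comment> \<open>Product rule: the derivative of \<open>s + X g\<close> is
    \<open>X g' + g\<close>, with value \<open>k \<otimes> d \<oplus> w\<close>.\<close>
  have "\<exists>v' \<in> poly_values R S (k \<oplus> e) c (Suc (Suc n)). v' \<ominus> (v \<oplus> (k \<otimes> d \<oplus> w) \<otimes> e) \<in> J"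
    if e: "e \<in> carrier R" "e \<otimes> e \<in> J" for e
  proof -
    obtain w' where w': "w' \<in> poly_values R S (k \<oplus> e) c (Suc n)" "w' \<ominus> (w \<oplus> d \<otimes> e) \<in> J"
      using d_deriv[OF e] by blast
    have w'c: "w' \<in> carrier R" using poly_values_closed[OF S _ c w'(1)] k e(1) by auto
    define q where "q = w' \<ominus> (w \<oplus> d \<otimes> e)"
    have q: "q \<in> J" "q \<in> carrier R" using w'(2) w'c cl e(1) by (auto simp: q_def)
    have w'_eq: "w' = q \<oplus> (w \<oplus> d \<otimes> e)"
      unfolding q_def using w'c cl e(1) by (simp add: a_minus_def a_assoc l_neg)
    \<comment> \<open>The remainder consists of the error \<open>q\<close> of the inner polynomial
      and the second-order term in \<open>e\<close>.\<close>
    have "s \<oplus> (k \<oplus> e) \<otimes> w' \<ominus> (v \<oplus> (k \<otimes> d \<oplus> w) \<otimes> e) = (k \<oplus> e) \<otimes> q \<oplus> d \<otimes> (e \<otimes> e)"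
      unfolding *(1) w'_eq using cl q(2) k e(1) by algebra
    also have "\<dots> \<in> J"
      using J.a_closed[OF J.I_l_closed[OF q(1)] J.I_l_closed[OF e(2)]] k e(1) cl by auto
    finally have "s \<oplus> (k \<oplus> e) \<otimes> w' \<ominus> (v \<oplus> (k \<otimes> d \<oplus> w) \<otimes> e) \<in> J" .
    moreover have "s \<oplus> (k \<oplus> e) \<otimes> w' \<in> poly_values R S (k \<oplus> e) c (Suc (Suc n))"
      using *(2) w'(1) by (subst poly_values.simps(2)) blast
    ultimately show ?thesis by blast
  qed
  moreover have "k \<otimes> d \<oplus> w \<in> poly_values R S k (add_pow R (Suc n) c \<oplus> c) (Suc n)"
    using poly_values_times[OF S k _ d] *(3) c by (intro poly_values_add[OF S k]) auto
  then have "k \<otimes> d \<oplus> w \<in> poly_values R S k (add_pow R (Suc (Suc n)) c) (Suc n)"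
    by simp
  ultimately show ?case by blast
qed

text \<open>Needed to carry the minimality of a degree from one representative of a residue class to
  another.\<close>

lemma poly_values_cong:
  assumes S: "subring S R" and k: "k \<in> carrier R" "k' \<in> carrier R" and I: "ideal I R" "k' \<ominus> k \<in> I"
    and c: "c \<in> carrier R"
  shows "v \<in> poly_values R S k c n \<Longrightarrow> \<exists>v' \<in> poly_values R S k' c n. v' \<ominus> v \<in> I"
proof (induction n arbitrary: v)
  case 0
  then show ?case
    using c additive_subgroup.zero_closed[OF ideal.axioms(1)[OF I(1)]] by (simp add: r_neg a_minus_def)
next
  case (Suc n)
  interpret I: ideal I R by (fact I)
  obtain s w where *: "v = s \<oplus> k \<otimes> w" "s \<in> S" "w \<in> poly_values R S k c n"
    using Suc.prems by auto
  obtain w' where w': "w' \<in> poly_values R S k' c n" "w' \<ominus> w \<in> I" using Suc.IH[OF *(3)] by blast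
  have cl: "s \<in> carrier R" "w \<in> carrier R" "w' \<in> carrier R"
    using subsetD[OF subringE(1)[OF S] *(2)] poly_values_closed[OF S k(1) c *(3)]
      poly_values_closed[OF S k(2) c w'(1)] by auto
  have "s \<oplus> k' \<otimes> w' \<ominus> v = k' \<otimes> (w' \<ominus> w) \<oplus> w \<otimes> (k' \<ominus> k)"
    unfolding *(1) a_minus_def using cl k by algebra
  also have "\<dots> \<in> I"
    using w'(2) I(2) k cl by (intro I.a_closed I.I_l_closed) auto
  finally show ?case using *(2) w'(1) by auto
qed

lemma poly_values_Int_subset:
  assumes S: "subring S R" and k: "k \<in> carrier R" and J: "ideal J R" and I: "ideal I R" "J \<subseteq> I"
    and SI: "S \<inter> I \<subseteq> J" and inverse: "\<And>s. \<lbrakk>s \<in> S; s \<notin> I\<rbrakk> \<Longrightarrow> \<exists>t \<in> S. t \<otimes> s = \<one>"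
  shows "(\<And>i. i < n \<Longrightarrow> poly_values R S k \<one> i \<inter> I = {}) \<Longrightarrow> poly_values R S k \<zero> n \<inter> I \<subseteq> J"
proof (induction n)
  case 0
  then show ?case using additive_subgroup.zero_closed[OF ideal.axioms(1)[OF J]] by auto
next
  case (Suc n)
  show ?case
  proof
    fix v assume v: "v \<in> poly_values R S k \<zero> (Suc n) \<inter> I"
    then obtain c where c: "c \<in> S" "v \<in> poly_values R S k c n"
      unfolding poly_values_Suc[OF S k] by blast
    have cl: "c \<in> carrier R" "v \<in> carrier R"
      using subsetD[OF subringE(1)[OF S] c(1)] poly_values_closed[OF S k _ c(2)] by auto
    show "v \<in> J"
    proof (cases "c \<in> I")
      case True
      then have "c \<in> J" using SI c(1) by blast
      from poly_values_drop_top[OF S k J this c(2)]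
      obtain w where w: "w \<in> poly_values R S k \<zero> n" "v \<ominus> w \<in> J" by blast
      have wc: "w \<in> carrier R" using poly_values_closed[OF S k zero_closed w(1)] .
      have "w = v \<ominus> (v \<ominus> w)" using cl wc by algebra
      moreover have "v \<ominus> (v \<ominus> w) \<in> I"
        using ideal.minus_mem[OF I(1)] v w(2) I(2) by blast
      ultimately have "w \<in> I" by simp
      then have "w \<in> J" using Suc.IH Suc.prems w(1) by force
      with w(2) show ?thesis using ideal.mem_if_minus_mem[OF J cl(2)] by blast
    next
      case False
      then obtain t where t: "t \<in> S" "t \<otimes> c = \<one>" using inverse c(1) by blast
      then have "t \<otimes> v \<in> poly_values R S k \<one> n"
        using poly_values_mult[OF S k cl(1) t(1) c(2)] by simp
      moreover have "t \<otimes> v \<in> I"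
        using v t(1) subringE(1)[OF S] ideal.I_l_closed[OF I(1)] by blast
      ultimately show ?thesis using Suc.prems[of n] by blast
    qed
  qed
qed

text \<open>Division with remainder by the monic polynomial with value \<open>u\<close>. That value
  need not vanish: the multiple \<open>c \<otimes> u\<close> lies in \<open>J \<subseteq> S\<close>
  and is absorbed as a constant. The divisor has degree \<open>Suc d\<close>, not \<open>0\<close>,
  since \<open>W \<zero> 0\<close> has no room for constants.\<close>

lemma poly_values_reduce:
  assumes S: "subring S R" and k: "k \<in> carrier R" and J: "ideal J R" "J \<subseteq> S"
    and u: "u \<in> poly_values R S k \<one> (Suc d)" "u \<in> J"
  shows "poly_values R S k \<zero> n \<subseteq> poly_values R S k \<zero> (Suc d)"
proof (induction n)
  case 0
  then show ?case using poly_values_zero[OF S k, of "Suc d"] by simp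
next
  case (Suc n)
  have step: "poly_values R S k \<zero> (Suc (Suc d)) \<subseteq> poly_values R S k \<zero> (Suc d)"
  proof
    fix v assume "v \<in> poly_values R S k \<zero> (Suc (Suc d))"
    then obtain c where c: "c \<in> S" "v \<in> poly_values R S k c (Suc d)"
      unfolding poly_values_Suc[OF S k, of "Suc d"] by blast
    have cl: "c \<in> carrier R" "v \<in> carrier R" "u \<in> carrier R"
      using subsetD[OF subringE(1)[OF S] c(1)] poly_values_closed[OF S k _ c(2)]
        ideal.Icarr[OF J(1) u(2)] by auto
    have "(\<ominus> c) \<otimes> u \<in> poly_values R S k ((\<ominus> c) \<otimes> \<one>) (Suc d)"
      using poly_values_mult[OF S k one_closed subringE(5)[OF S c(1)] u(1)] .
    from poly_values_add[OF S k cl(1) _ c(2) this]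
    have 1: "v \<oplus> (\<ominus> c) \<otimes> u \<in> poly_values R S k \<zero> (Suc d)"
      using cl by (simp add: r_neg)
    have "c \<otimes> u \<in> S"
      using ideal.I_l_closed[OF J(1) u(2) cl(1)] J(2) by blast
    from poly_values_add[OF S k zero_closed zero_closed 1 poly_values_const[OF S k this]]
    have "(v \<oplus> (\<ominus> c) \<otimes> u) \<oplus> c \<otimes> u \<in> poly_values R S k \<zero> (Suc d)"
      by simp
    moreover have "(v \<oplus> (\<ominus> c) \<otimes> u) \<oplus> c \<otimes> u = v" using cl by algebra
    ultimately show "v \<in> poly_values R S k \<zero> (Suc d)" by simp
  qed
  have "poly_values R S k \<zero> (Suc n) \<subseteq> poly_values R S k \<zero> (Suc (Suc d))"
    unfolding poly_values.simps(2)[of R S k \<zero> n] poly_values.simps(2)[of R S k \<zero> "Suc d"]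
    using Suc by blast
  with step show ?case by blast
qed

text \<open>Here \<open>k\<close> is a root modulo \<open>J\<close> of a lift of its residual minimal polynomial.\<close>

lemma adjoin_Int_subset:
  assumes S: "subring S R" and k: "k \<in> carrier R" and J: "ideal J R" and I: "ideal I R" "J \<subseteq> I"
    and SI: "S \<inter> I \<subseteq> J" and inverse: "\<And>s. \<lbrakk>s \<in> S; s \<notin> I\<rbrakk> \<Longrightarrow> \<exists>t \<in> S. t \<otimes> s = \<one>"
    and JS: "J \<subseteq> S"
    and minimal: "\<And>i. i < d \<Longrightarrow> poly_values R S k \<one> i \<inter> I = {}"
    and d: "d \<noteq> 0" "poly_values R S k \<one> d \<inter> J \<noteq> {}"
  shows "(\<Union>n. poly_values R S k \<zero> n) \<inter> I \<subseteq> J"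
proof -
  obtain d' where d': "d = Suc d'" using d(1) by (cases d) auto
  obtain u where "u \<in> poly_values R S k \<one> (Suc d')" "u \<in> J" using d(2) unfolding d' by blast
  \<comment> \<open>All of \<open>S[k]\<close> is thus reached in degrees below \<open>d\<close>,
    the range in which \<open>minimal\<close> excludes monic polynomials with value in
    \<open>I\<close>.\<close>
  from poly_values_reduce[OF S k J JS this]
  have "(\<Union>n. poly_values R S k \<zero> n) \<subseteq> poly_values R S k \<zero> d" unfolding d' by blast
  with poly_values_Int_subset[OF S k J I SI inverse minimal] show ?thesis by blast
qed

end

section \<open>Lifting the residue field modulo an ideal, by Zorn's lemma\<close>

section \<open>Coefficient subrings\<close>

context cring
begin

text \<open>For ideals \<open>J \<subseteq> I\<close> this makes \<open>S\<close> the full preimage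
  of a coefficient field of \<open>R / J\<close>: the quotient \<open>S / J\<close> maps
  isomorphically onto \<open>R / I\<close>. Inverses are asked for in \<open>S\<close> itself, not
  just modulo \<open>J\<close>, so that top coefficients can be normalised to
  \<open>\<one>\<close>.\<close>

definition coefficient_subring :: "'a set \<Rightarrow> 'a set \<Rightarrow> 'a set \<Rightarrow> bool" where
  "coefficient_subring I J S \<longleftrightarrow> subring S R \<and> J \<subseteq> S \<and> S \<inter> I \<subseteq> J \<and>
     (\<forall>a \<in> carrier R. \<exists>s \<in> S. a \<ominus> s \<in> I) \<and> (\<forall>s \<in> S - I. \<exists>t \<in> S. t \<otimes> s = \<one>)"

lemma poly_values_subset:
  assumes "subring B R" "S \<subseteq> B" "k \<in> B" "c \<in> B"
  shows "poly_values R S k c n \<subseteq> B"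
  by (induction n)
    (use assms(2-4) in \<open>auto intro!: subringE(6)[OF assms(1)] subringE(7)[OF assms(1)]\<close>)

lemma Union_chain_subring:
  assumes "C \<noteq> {}" "\<And>S. S \<in> C \<Longrightarrow> subring S R" "\<And>S T. \<lbrakk>S \<in> C; T \<in> C\<rbrakk> \<Longrightarrow> S \<subseteq> T \<or> T \<subseteq> S"
  shows "subring (\<Union>C) R"
proof (rule subringI)
  have *: "\<exists>S \<in> C. u \<in> S \<and> v \<in> S" if "u \<in> \<Union>C" "v \<in> \<Union>C" for u v
    using that assms(3) by blast
  show "\<Union>C \<subseteq> carrier R" using subringE(1)[OF assms(2)] by blast
  show "\<one> \<in> \<Union>C" using subringE(3)[OF assms(2)] assms(1) by blast
  show "\<ominus> u \<in> \<Union>C" if "u \<in> \<Union>C" for u using subringE(5)[OF assms(2)] that by blast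
  show "u \<otimes> v \<in> \<Union>C" if "u \<in> \<Union>C" "v \<in> \<Union>C" for u v
    using *[OF that] subringE(6)[OF assms(2)] by blast
  show "u \<oplus> v \<in> \<Union>C" if "u \<in> \<Union>C" "v \<in> \<Union>C" for u v
    using *[OF that] subringE(7)[OF assms(2)] by blast
qed

text \<open>These are the fractions over \<open>S\<close>, with denominator outside
  \<open>I\<close>, that \<open>B\<close> already contains. Denominators are units of
  \<open>R\<close>, so a product of two of them stays outside \<open>I\<close>.\<close>

lemma fractions_subring:
  assumes B: "subring B R" and S: "subring S R" "S \<subseteq> B"
    and I: "ideal I R" "\<one> \<notin> I" "\<And>a. \<lbrakk>a \<in> carrier R; a \<notin> I\<rbrakk> \<Longrightarrow> a \<in> Units R"
  shows "subring {a \<in> B. \<exists>s \<in> S. s \<notin> I \<and> s \<otimes> a \<in> S} R"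
proof -
  interpret I: ideal I R by (fact I(1))
  have mult: "s \<otimes> t \<notin> I" if "s \<in> S" "t \<in> S" "s \<notin> I" "t \<notin> I" for s t
  proof
    assume st: "s \<otimes> t \<in> I"
    have s: "s \<in> Units R" "t \<in> carrier R" using I(3) that subringE(1)[OF S(1)] by blast+
    then have "inv s \<otimes> (s \<otimes> t) \<in> I" using I.I_l_closed[OF st Units_inv_closed] by blast
    moreover have "inv s \<otimes> (s \<otimes> t) = t" using s by (simp add: m_assoc[symmetric] Units_closed)
    ultimately show False using that(4) by simp
  qed
  have cl: "x \<in> carrier R" if "x \<in> B" for x using that subringE(1)[OF B] by blast
  show ?thesis
  proof (rule subringI)
    show "{a \<in> B. \<exists>s \<in> S. s \<notin> I \<and> s \<otimes> a \<in> S} \<subseteq> carrier R" using cl by blast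
    have "\<one> \<otimes> \<one> \<in> S" using subringE(3)[OF S(1)] by simp
    then show "\<one> \<in> {a \<in> B. \<exists>s \<in> S. s \<notin> I \<and> s \<otimes> a \<in> S}"
      using subringE(3)[OF S(1)] S(2) I(2) by blast
  next
    fix a assume a: "a \<in> {a \<in> B. \<exists>s \<in> S. s \<notin> I \<and> s \<otimes> a \<in> S}"
    then obtain s where s: "s \<in> S" "s \<notin> I" "s \<otimes> a \<in> S" "a \<in> B" by blast
    then have "s \<otimes> (\<ominus> a) \<in> S"
      using subringE(5)[OF S(1) s(3)] r_minus[of s a] cl S(2) by auto
    then show "\<ominus> a \<in> {a \<in> B. \<exists>s \<in> S. s \<notin> I \<and> s \<otimes> a \<in> S}"
      using s subringE(5)[OF B] by blast
  next
    fix a b assume ab: "a \<in> {a \<in> B. \<exists>s \<in> S. s \<notin> I \<and> s \<otimes> a \<in> S}"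
      "b \<in> {a \<in> B. \<exists>s \<in> S. s \<notin> I \<and> s \<otimes> a \<in> S}"
    obtain s where s: "s \<in> S" "s \<notin> I" "s \<otimes> a \<in> S" "a \<in> B" using ab(1) by blast
    obtain t where t: "t \<in> S" "t \<notin> I" "t \<otimes> b \<in> S" "b \<in> B" using ab(2) by blast
    have c: "s \<in> carrier R" "t \<in> carrier R" "a \<in> carrier R" "b \<in> carrier R"
      using s t cl S(2) by auto
    have "(s \<otimes> t) \<otimes> (a \<otimes> b) = (s \<otimes> a) \<otimes> (t \<otimes> b)" using c by algebra
    moreover have "\<dots> \<in> S" using s t subringE(6)[OF S(1)] by blast
    ultimately have 1: "(s \<otimes> t) \<otimes> (a \<otimes> b) \<in> S" by simp
    have "(s \<otimes> t) \<otimes> (a \<oplus> b) = t \<otimes> (s \<otimes> a) \<oplus> s \<otimes> (t \<otimes> b)" using c by algebra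
    moreover have "\<dots> \<in> S" using s t subringE(6,7)[OF S(1)] by metis
    ultimately have 2: "(s \<otimes> t) \<otimes> (a \<oplus> b) \<in> S" by simp
    have st: "s \<otimes> t \<in> S" "s \<otimes> t \<notin> I" using mult s t subringE(6)[OF S(1)] by blast+
    show "a \<otimes> b \<in> {a \<in> B. \<exists>s \<in> S. s \<notin> I \<and> s \<otimes> a \<in> S}"
      using 1 st s(4) t(4) subringE(6)[OF B] by blast
    show "a \<oplus> b \<in> {a \<in> B. \<exists>s \<in> S. s \<notin> I \<and> s \<otimes> a \<in> S}"
      using 2 st s(4) t(4) subringE(7)[OF B] by blast
  qed
qed

text \<open>
  By Zorn's lemma take \<open>S\<close> maximal. An element of \<open>B\<close> whose residue does not come from \<open>S\<close> can be
  adjoined: if the residue is separable algebraic over that of \<open>S\<close>, after a Newton step, which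
  moves a root modulo \<open>J\<close> to a root modulo \<open>J'\<close>.
\<close>

lemma coefficient_subring_extend:
  assumes I: "ideal I R" "\<one> \<notin> I" "\<And>a. \<lbrakk>a \<in> carrier R; a \<notin> I\<rbrakk> \<Longrightarrow> a \<in> Units R"
    and J: "ideal J R" "J \<subseteq> I" and J': "ideal J' R" "J' \<subseteq> J"
    and square: "\<And>a. a \<in> J \<Longrightarrow> a \<otimes> a \<in> J'"
    and B: "coefficient_subring I J B"
    and S0: "subring S0 R" "J' \<subseteq> S0" "S0 \<subseteq> B" "S0 \<inter> I \<subseteq> J'"
    and inseparable: "\<And>k. k \<in> B \<Longrightarrow> \<exists>k' \<in> B. k' \<ominus> k \<in> I \<and>
      (\<forall>d > 0. add_pow R d \<one> \<in> I \<longrightarrow> (\<exists>e. 0 < e \<and> e \<le> (d::nat) \<and> k' [^] e \<in> S0))"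
  shows "\<exists>S. coefficient_subring I J' S"
proof -
  interpret I: ideal I R by (fact I(1))
  have Bs: "subring B R" "J \<subseteq> B" "B \<inter> I \<subseteq> J" "\<And>a. a \<in> carrier R \<Longrightarrow> \<exists>s \<in> B. a \<ominus> s \<in> I"
    "\<And>s. \<lbrakk>s \<in> B; s \<notin> I\<rbrakk> \<Longrightarrow> \<exists>t \<in> B. t \<otimes> s = \<one>"
    using B unfolding coefficient_subring_def by auto
  have Bcl: "x \<in> carrier R" if "x \<in> B" for x using that subringE(1)[OF Bs(1)] by blast
  let ?F = "{S. subring S R \<and> S0 \<subseteq> S \<and> S \<subseteq> B \<and> S \<inter> I \<subseteq> J'}"
  have "?F \<noteq> {}" using S0 by blast
  moreover have "\<Union>C \<in> ?F" if C: "C \<noteq> {}" "subset.chain ?F C" for C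
  proof -
    have C': "\<And>S. S \<in> C \<Longrightarrow> S \<in> ?F" "\<And>S T. \<lbrakk>S \<in> C; T \<in> C\<rbrakk> \<Longrightarrow> S \<subseteq> T \<or> T \<subseteq> S"
      using C(2) unfolding subset_chain_def by (auto simp only: subset_iff)
    have "subring (\<Union>C) R" using C' by (intro Union_chain_subring C(1)) auto
    moreover have "S0 \<subseteq> \<Union>C" using C' C(1) by blast
    moreover have "\<Union>C \<subseteq> B" "\<Union>C \<inter> I \<subseteq> J'" using C'(1) by auto
    ultimately show ?thesis by simp
  qed
  ultimately have "\<exists>S \<in> ?F. \<forall>H \<in> ?F. S \<subseteq> H \<longrightarrow> H = S"
    by (rule subset_Zorn_nonempty)
  then obtain S where SF: "S \<in> ?F" and max: "\<forall>H \<in> ?F. S \<subseteq> H \<longrightarrow> H = S" ..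
  have S: "subring S R" "S0 \<subseteq> S" "S \<subseteq> B" "S \<inter> I \<subseteq> J'" using SF by simp_all
  have maximal: "H \<subseteq> S" if "subring H R" "S \<subseteq> H" "H \<subseteq> B" "H \<inter> I \<subseteq> J'" for H
  proof -
    have "H \<in> ?F" using that order_trans[OF S(2)] by simp
    then have "H = S" by (rule max[rule_format, OF _ that(2)])
    then show ?thesis by simp
  qed
  have Scl: "x \<in> carrier R" if "x \<in> S" for x using that S(3) Bcl by blast
  \<comment> \<open>Maximality makes \<open>S\<close> absorb every fraction that lies in
    \<open>B\<close>, and the inverse of \<open>s\<close> is such a fraction because
    \<open>B\<close> is closed under inverses outside \<open>I\<close>.\<close>
  have inverse: "\<exists>t \<in> S. t \<otimes> s = \<one>" if s: "s \<in> S" "s \<notin> I" for s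
  proof -
    let ?H = "{a \<in> B. \<exists>s \<in> S. s \<notin> I \<and> s \<otimes> a \<in> S}"
    have "?H \<subseteq> S"
    proof (rule maximal)
      show "subring ?H R" by (rule fractions_subring[OF Bs(1) S(1,3) I])
      have "\<one> \<otimes> a \<in> S" if "a \<in> S" for a using that Scl by simp
      then show "S \<subseteq> ?H" using S(3) subringE(3)[OF S(1)] I(2) by blast
      show "?H \<inter> I \<subseteq> J'"
      proof
        fix a assume a: "a \<in> ?H \<inter> I"
        then obtain s where s: "s \<in> S" "s \<notin> I" "s \<otimes> a \<in> S" by blast
        have ac: "a \<in> carrier R" using a Bcl by blast
        have "s \<otimes> a \<in> I" using a s Scl by (intro I.I_l_closed) auto
        then have sa: "s \<otimes> a \<in> J'" using s(3) S(4) by blast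
        have su: "s \<in> Units R" using I(3) s(1,2) Scl by blast
        then have "inv s \<otimes> (s \<otimes> a) \<in> J'" by (intro ideal.I_l_closed[OF J'(1) sa]) simp
        moreover have "inv s \<otimes> (s \<otimes> a) = a"
          using su ac by (simp add: m_assoc[symmetric] Units_closed)
        ultimately show "a \<in> J'" by simp
      qed
    qed blast
    moreover obtain t where t: "t \<in> B" "t \<otimes> s = \<one>" using Bs(5)[OF _ s(2)] s(1) S(3) by blast
    moreover have "s \<otimes> t \<in> S" using t m_comm[of s t] Scl[OF s(1)] Bcl subringE(3)[OF S(1)] by simp
    ultimately show ?thesis using s by blast
  qed
  have J'S: "J' \<subseteq> S" "J' \<subseteq> I" using S0(2) S(2) J(2) J'(2) by auto
  \<comment> \<open>Maximality again: it is enough that \<open>S[k]\<close> acquires no element of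
    \<open>I\<close> outside \<open>J'\<close>.\<close>
  have adjoin: "k \<in> S" if k: "k \<in> B" "(\<Union>n. poly_values R S k \<zero> n) \<inter> I \<subseteq> J'" for k
  proof -
    have kc: "k \<in> carrier R" using k(1) Bcl by blast
    have "poly_values R S k \<zero> n \<subseteq> B" for n
      by (rule poly_values_subset[OF Bs(1) S(3) k(1) subringE(2)[OF Bs(1)]])
    then have *: "(\<Union>n. poly_values R S k \<zero> n) \<subseteq> S"
      using poly_values_const[OF S(1) kc]
      by (intro maximal poly_values_subring[OF S(1) kc] k(2)) blast+
    have "k \<otimes> \<one> \<in> poly_values R S k \<zero> (Suc (Suc 0))"
      using poly_values_times[OF S(1) kc zero_closed]
        poly_values_const[OF S(1) kc subringE(3)[OF S(1)]] by blast
    then have "k \<in> poly_values R S k \<zero> (Suc (Suc 0))" using kc by (simp only: r_one)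
    with * show ?thesis by blast
  qed
  have "\<exists>s \<in> S. k \<ominus> s \<in> I" if k: "k \<in> B" for k
  proof -
    obtain l where l: "l \<in> B" "l \<ominus> k \<in> I" and insep:
      "\<And>d. \<lbrakk>d > 0; add_pow R d \<one> \<in> I\<rbrakk> \<Longrightarrow> \<exists>e. 0 < e \<and> e \<le> (d::nat) \<and> l [^] e \<in> S0"
      using inseparable[OF k] by blast
    have lc: "l \<in> carrier R" "k \<in> carrier R" using l(1) k Bcl by auto
    let ?P = "\<lambda>d. poly_values R S l \<one> d \<inter> I \<noteq> {}"
    have "\<exists>l' \<in> S. l' \<ominus> l \<in> I"
    proof (cases "\<exists>d. ?P d")
      \<comment> \<open>The residue of \<open>l\<close> is transcendental over the residue field of
        \<open>S\<close>.\<close>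
      case False
      then have "(\<Union>n. poly_values R S l \<zero> n) \<inter> I \<subseteq> J'"
        using poly_values_Int_subset[OF S(1) lc(1) J'(1) I(1) J'S(2) S(4) inverse] by blast
      with adjoin l(1) have "l \<in> S" by blast
      then show ?thesis using I.zero_closed lc(1) by (intro bexI[of _ l]) (auto simp: a_minus_def r_neg)
    next
      case True
      \<comment> \<open>\<open>d\<close> is the degree of the minimal polynomial of the residue of
        \<open>l\<close> over the residue field of \<open>S\<close>.\<close>
      define d where "d = (LEAST d. ?P d)"
      have Pd: "?P d" unfolding d_def using True by (rule LeastI_ex)
      have minimal: "poly_values R S l \<one> i \<inter> I = {}" if "i < d" for i
        using not_less_Least[of i ?P] that unfolding d_def by blast
      have "d \<noteq> 0" using Pd I(2) by (metis Int_insert_left_if0 inf_bot_left poly_values.simps(1))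
      then obtain d' where d': "d = Suc d'" by (cases d) auto
      show ?thesis
      proof (cases "add_pow R d \<one> \<in> I")
        \<comment> \<open>The derivative of a monic polynomial of degree \<open>d\<close> loses its
          top term in the residue field. Here the hypothesis \<open>inseparable\<close> gives some
          \<open>e \<le> d\<close> such that \<open>X^e - l^e\<close> is a monic polynomial over
          \<open>S\<close> with the exact root \<open>l\<close>. Minimality forces
          \<open>e = d\<close>, and no Newton step is needed.\<close>
        case True
        then obtain e where e: "0 < e" "e \<le> d" "l [^] e \<in> S0"
          using insep[of d] \<open>d \<noteq> 0\<close> by blast
        obtain e' where e': "e = Suc e'" using e(1) by (cases e) auto
        have "l [^] e \<oplus> \<ominus> (l [^] e) \<in> poly_values R S l (\<one> \<oplus> \<zero>) e"
        proof (rule poly_values_add[OF S(1) lc(1) one_closed zero_closed])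
          show "l [^] e \<in> poly_values R S l \<one> e" by (rule poly_values_pow[OF S(1) lc(1)])
          have "\<ominus> (l [^] e) \<in> S" using e(3) S(2) subringE(5)[OF S(1)] by blast
          then show "\<ominus> (l [^] e) \<in> poly_values R S l \<zero> e"
            unfolding e' by (rule poly_values_const[OF S(1) lc(1)])
        qed
        then have z: "\<zero> \<in> poly_values R S l \<one> e" using lc(1) by (simp add: r_neg)
        moreover have z': "\<zero> \<in> J'" "\<zero> \<in> I"
          using additive_subgroup.zero_closed[OF ideal.axioms(1)] I(1) J'(1) by blast+
        ultimately have "\<not> e < d" using minimal[of e] by blast
        with e(2) z z' have "poly_values R S l \<one> d \<inter> J' \<noteq> {}" by auto
        from adjoin_Int_subset[OF S(1) lc(1) J'(1) I(1) J'S(2) S(4) inverse J'S(1) minimal \<open>d \<noteq> 0\<close> this]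
        have "l \<in> S" using adjoin l(1) by blast
        then show ?thesis using I.zero_closed lc(1) by (intro bexI[of _ l]) (auto simp: a_minus_def r_neg)
      next
        case False
        \<comment> \<open>\<open>v\<close> is the value of a lift of the minimal polynomial; being
          in \<open>B\<close> and in \<open>I\<close>, it is in \<open>J\<close>.\<close>
        obtain v where v: "v \<in> poly_values R S l \<one> (Suc d')" "v \<in> I" using Pd d' by blast
        note PB = poly_values_subset[OF Bs(1) S(3) l(1)]
        have vJ: "v \<in> J" using subsetD[OF PB[OF subringE(3)[OF Bs(1)]] v(1)] v(2) Bs(3) by blast
        have vc: "v \<in> carrier R" using v(2) I.Icarr by blast
        let ?n = "add_pow R (Suc d') \<one>"
        have n: "?n \<in> S" "?n \<notin> I" "?n \<in> carrier R"
          using subring_add_pow_closed[OF S(1), of "Suc d'"] False Scl unfolding d' by blast+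
        \<comment> \<open>The root is simple: the derivative has degree \<open>d'\<close> and a top
          coefficient invertible in \<open>S\<close>, so a value in \<open>I\<close> would yield a
          monic polynomial of degree below \<open>d\<close> with value in \<open>I\<close>.\<close>
        have notI: "q \<notin> I" if q: "q \<in> poly_values R S l ?n d'" for q
        proof
          assume "q \<in> I"
          obtain t where t: "t \<in> S" "t \<otimes> ?n = \<one>" using inverse[OF n(1,2)] by blast
          have "t \<otimes> q \<in> I" using \<open>q \<in> I\<close> t(1) Scl by (intro I.I_l_closed) auto
          moreover have "t \<otimes> q \<in> poly_values R S l \<one> d'"
            using poly_values_mult[OF S(1) lc(1) n(3) t(1) q] t(2) by simp
          ultimately show False using minimal[of d'] d' by blast
        qed
        obtain q where q: "q \<in> poly_values R S l ?n d'"
          and q_deriv: "\<And>e. \<lbrakk>e \<in> carrier R; e \<otimes> e \<in> J'\<rbrakk> \<Longrightarrow>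
            \<exists>v' \<in> poly_values R S (l \<oplus> e) \<one> (Suc d'). v' \<ominus> (v \<oplus> q \<otimes> e) \<in> J'"
          using poly_values_taylor[OF S(1) lc(1) J'(1) one_closed v(1)] by blast
        have "q \<in> B" by (rule subsetD[OF PB[OF subsetD[OF S(3) n(1)]] q])
        then obtain t where t: "t \<in> B" "t \<otimes> q = \<one>" using Bs(5) notI[OF q] by blast
        have tq: "t \<in> carrier R" "q \<in> carrier R" using t(1) \<open>q \<in> B\<close> Bcl by auto
        \<comment> \<open>Newton's correction, minus the value divided by the derivative. It lies in
          \<open>J\<close> because \<open>v\<close> does, so its square lies in
          \<open>J'\<close>.\<close>
        define e where "e = \<ominus> (t \<otimes> v)"
        have eJ: "e \<in> J"
          unfolding e_def using ideal.I_l_closed[OF J(1) vJ tq(1)]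
          by (rule additive_subgroup.a_inv_closed[OF ideal.axioms(1)[OF J(1)]])
        have ec: "e \<in> carrier R" "e \<in> I" "e \<in> B" using eJ ideal.Icarr[OF J(1)] J(2) Bs(2) by auto
        obtain v' where v': "v' \<in> poly_values R S (l \<oplus> e) \<one> (Suc d')" "v' \<ominus> (v \<oplus> q \<otimes> e) \<in> J'"
          using q_deriv[OF ec(1) square[OF eJ]] by blast
        have lec: "l \<oplus> e \<in> carrier R" "l \<oplus> e \<in> B"
          using lc(1) ec l(1) subringE(7)[OF Bs(1)] by auto
        have v'c: "v' \<in> carrier R" using poly_values_closed[OF S(1) lec(1) one_closed v'(1)] .
        have "v \<oplus> q \<otimes> e = (\<one> \<ominus> t \<otimes> q) \<otimes> v" unfolding e_def using tq vc by algebra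
        also have "\<dots> = \<zero>" unfolding t(2) using vc by (simp add: a_minus_def r_neg)
        finally have v'J: "v' \<in> J'" using v'(2) v'c by (simp add: a_minus_def)
        have diff: "l \<ominus> (l \<oplus> e) = \<ominus> e" using lc(1) ec(1) by algebra
        \<comment> \<open>A shift by an element of \<open>I\<close> changes no residue, hence not
          the minimal degree either.\<close>
        have minimal': "poly_values R S (l \<oplus> e) \<one> i \<inter> I = {}" if "i < d" for i
        proof -
          have "w \<notin> I" if w: "w \<in> poly_values R S (l \<oplus> e) \<one> i" for w
          proof
            assume "w \<in> I"
            have "l \<ominus> (l \<oplus> e) \<in> I" unfolding diff using ec(2) by (rule I.a_inv_closed)
            from poly_values_cong[OF S(1) lec(1) lc(1) I(1) this one_closed w]
            obtain w' where w': "w' \<in> poly_values R S l \<one> i" "w' \<ominus> w \<in> I" by blast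
            have "w' \<in> I"
              using I.mem_if_minus_mem[OF poly_values_closed[OF S(1) lc(1) one_closed w'(1)] \<open>w \<in> I\<close> w'(2)] .
            with w'(1) minimal[OF \<open>i < d\<close>] show False by blast
          qed
          then show ?thesis by blast
        qed
        have "poly_values R S (l \<oplus> e) \<one> d \<inter> J' \<noteq> {}" using v'(1) v'J d' by blast
        from adjoin_Int_subset[OF S(1) lec(1) J'(1) I(1) J'S(2) S(4) inverse J'S(1) minimal' \<open>d \<noteq> 0\<close> this]
        have "l \<oplus> e \<in> S" using adjoin lec(2) by blast
        moreover have "l \<oplus> e \<ominus> l = e" using lc(1) ec(1) by algebra
        ultimately show ?thesis using ec(2) by metis
      qed
    qed
    then obtain l' where l': "l' \<in> S" "l' \<ominus> l \<in> I" by blast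
    have c: "l' \<in> carrier R" using l'(1) Scl by blast
    have eq: "k \<ominus> l' = \<ominus> ((l' \<ominus> l) \<oplus> (l \<ominus> k))" using c lc by algebra
    have "k \<ominus> l' \<in> I" unfolding eq using l'(2) l(2) by (intro I.a_inv_closed I.a_closed)
    with l'(1) show ?thesis by (rule bexI[rotated])
  qed
  note residues = this
  have "\<exists>s \<in> S. a \<ominus> s \<in> I" if a: "a \<in> carrier R" for a
  proof -
    obtain b where b: "b \<in> B" "a \<ominus> b \<in> I" using Bs(4)[OF a] by blast
    obtain s where s: "s \<in> S" "b \<ominus> s \<in> I" using residues[OF b(1)] by blast
    have eq: "a \<ominus> s = (a \<ominus> b) \<oplus> (b \<ominus> s)" using a Bcl[OF b(1)] Scl[OF s(1)] by algebra
    have "a \<ominus> s \<in> I" unfolding eq using b(2) s(2) by (rule I.a_closed)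
    with s(1) show ?thesis by (rule bexI[rotated])
  qed
  with S J'S inverse show ?thesis unfolding coefficient_subring_def by blast
qed

end

section \<open>The characteristic of a ring and of its residue ring\<close>

lemma (in ring) add_pow_one_eq_zero_iff: "add_pow R n \<one> = \<zero> \<longleftrightarrow> ring_char R dvd n"
proof -
  let ?T = "{n::nat. add_pow R n \<one> = \<zero>}"
  have add: "add_pow R (a + b) \<one> = add_pow R a \<one> \<oplus> add_pow R b \<one>" for a b :: nat
    by (simp add: add.nat_pow_mult)
  have mult: "a * b \<in> ?T" if "a \<in> ?T" for a b
    using that by (simp add: add.nat_pow_pow[symmetric])
  have mod: "a mod b \<in> ?T" if "a \<in> ?T" "b \<in> ?T" for a b
  proof -
    have "add_pow R (b * (a div b)) \<one> = \<zero>" using mult[OF that(2)] by simp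
    then show ?thesis using that(1) add[of "b * (a div b)" "a mod b"] by simp
  qed
  \<comment> \<open>\<open>ring_char\<close> is a greatest common divisor, and the point is that it
    is attained: \<open>?T\<close> is closed under remainders, so its least positive element divides
    all others. Without a positive element the \<open>Gcd\<close> is \<open>0\<close>.\<close>
  have "Gcd ?T \<in> ?T"
  proof (cases "\<exists>d > 0. d \<in> ?T")
    case True
    define d where "d = (LEAST d. d > 0 \<and> d \<in> ?T)"
    have d: "d > 0" "d \<in> ?T"
      using LeastI_ex[of "\<lambda>d. d > 0 \<and> d \<in> ?T"] True unfolding d_def by blast+
    have "d dvd n" if "n \<in> ?T" for n
    proof -
      have "n mod d < d" using d(1) by simp
      from not_less_Least[OF this[unfolded d_def], folded d_def] mod[OF that d(2)]
      show ?thesis by (simp add: dvd_eq_mod_eq_0)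
    qed
    then have "d dvd Gcd ?T" by (rule Gcd_greatest)
    moreover have "Gcd ?T dvd d" by (rule Gcd_dvd[OF d(2)])
    ultimately show ?thesis using d(2) dvd_antisym by metis
  next
    case False
    then have "?T \<subseteq> {0}" by auto
    then have "Gcd ?T = 0" unfolding Gcd_0_iff .
    then show ?thesis by (simp only: mem_Collect_eq add.nat_pow_0)
  qed
  then show ?thesis
    unfolding ring_char_def using mult[of "Gcd ?T"] Gcd_dvd[of n ?T] by auto
qed

context ideal
begin

lemma add_pow_quotient_one: "add_pow (R Quot I) (n::nat) \<one>\<^bsub>R Quot I\<^esub> = I +> add_pow R n \<one>"
proof (induction n)
  case 0
  show ?case using a_coset_add_zero[OF a_subset] by (simp add: FactRing_def add_pow_def nat_pow_def)
next
  case (Suc n)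
  have "add_pow (R Quot I) (Suc n) \<one>\<^bsub>R Quot I\<^esub> =
      add_pow (R Quot I) n \<one>\<^bsub>R Quot I\<^esub> \<oplus>\<^bsub>R Quot I\<^esub> \<one>\<^bsub>R Quot I\<^esub>"
    by (simp add: add_pow_def nat_pow_def)
  also have "\<dots> = I +> add_pow R (Suc n) \<one>"
    unfolding Suc by (simp add: FactRing_def a_rcos_sum)
  finally show ?case .
qed

lemma add_pow_one_mem_iff: "add_pow R n \<one> \<in> I \<longleftrightarrow> ring_char (R Quot I) dvd n"
proof -
  interpret Q: ring "R Quot I" by (rule quotient_is_ring)
  have "I +> add_pow R n \<one> = I \<longleftrightarrow> add_pow R n \<one> \<in> I"
    using a_coset_join1[OF _ _ a_subgroup] a_coset_join2[OF _ a_subgroup] by auto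
  then show ?thesis
    unfolding Q.add_pow_one_eq_zero_iff[symmetric] add_pow_quotient_one
    by (simp add: FactRing_def)
qed

end

text \<open>Primality is inherited from \<open>I\<close>, because the multiples of
  \<open>\<one>\<close> multiply as the integers do.\<close>

lemma (in primeideal) prime_ring_char_quotient:
  assumes "ring_char (R Quot I) \<noteq> 0"
  shows "Factorial_Ring.prime (ring_char (R Quot I))"
proof (rule prime_natI)
  let ?p = "ring_char (R Quot I)"
  show "?p \<ge> 2"
    using assms add_pow_one_mem_iff[of 1] I_notcarr one_imp_carrier by (cases ?p) fastforce+
  show "?p dvd a \<or> ?p dvd b" if "?p dvd a * b" for a b
  proof -
    have "add_pow R a \<one> \<otimes> add_pow R b \<one> = add_pow R (a * b) \<one>"
      by (simp add: add_pow_ldistr add.nat_pow_pow mult.commute)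
    then show ?thesis
      using I_prime[of "add_pow R a \<one>" "add_pow R b \<one>"] that
      by (simp add: add_pow_one_mem_iff[symmetric])
  qed
qed

section \<open>Additivity of Frobenius, and one refinement of a coefficient subring\<close>

context cring
begin

lemma binomial:
  assumes a: "a \<in> carrier R" and b: "b \<in> carrier R"
  shows "(a \<oplus> b) [^] n = (\<Oplus>k \<in> {..n::nat}. add_pow R (n choose k) (a [^] k \<otimes> b [^] (n - k)))"
proof (induction n)
  case (Suc n)
  let ?t = "\<lambda>i k. add_pow R (n choose i) (a [^] k \<otimes> b [^] (Suc n - k))"
  have "(a \<oplus> b) [^] Suc n = a \<otimes> (a \<oplus> b) [^] n \<oplus> b \<otimes> (a \<oplus> b) [^] n"
    using a b by (subst nat_pow_Suc2) (auto simp: l_distr)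
  also have "a \<otimes> (a \<oplus> b) [^] n = (\<Oplus>k \<in> {..n}. ?t k (Suc k))"
    unfolding Suc using a b
    by (auto simp: finsum_rdistr add_pow_rdistr m_ac intro!: finsum_cong')
  also have "b \<otimes> (a \<oplus> b) [^] n = (\<Oplus>k \<in> {..n}. ?t k k)"
    unfolding Suc using a b
    by (auto simp: finsum_rdistr add_pow_rdistr Suc_diff_le m_ac intro!: finsum_cong')
  \<comment> \<open>The added summand is zero, as \<open>n choose Suc n = 0\<close>. After the
    summand for \<open>k = 0\<close> is split off, the two sums line up for Pascal's rule.\<close>
  also have "(\<Oplus>k \<in> {..n}. ?t k k) = (\<Oplus>k \<in> {..Suc n}. ?t k k)"
    using a b by (subst finsum_Suc) (auto simp: Pi_def binomial_eq_0)
  also have "\<dots> = (\<Oplus>k \<in> {..n}. ?t (Suc k) (Suc k)) \<oplus> ?t 0 0"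
    using a b by (subst finsum_Suc2) auto
  finally have "(a \<oplus> b) [^] Suc n =
      ((\<Oplus>k \<in> {..n}. ?t k (Suc k)) \<oplus> (\<Oplus>k \<in> {..n}. ?t (Suc k) (Suc k))) \<oplus> ?t 0 0"
    using a b by (simp add: a_assoc)
  also have "(\<Oplus>k \<in> {..n}. ?t k (Suc k)) \<oplus> (\<Oplus>k \<in> {..n}. ?t (Suc k) (Suc k)) =
      (\<Oplus>k \<in> {..n}. add_pow R (Suc n choose Suc k) (a [^] Suc k \<otimes> b [^] (Suc n - Suc k)))"
    using a b by (subst finsum_addf[symmetric]) (auto simp: add.nat_pow_mult intro!: finsum_cong')
  also have "\<dots> \<oplus> ?t 0 0 = (\<Oplus>k \<in> {..Suc n}. add_pow R (Suc n choose k) (a [^] k \<otimes> b [^] (Suc n - k)))"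
    using a b by (subst finsum_Suc2) auto
  finally show ?case .
qed (use assms in simp)

text \<open>The prime \<open>p\<close> divides every inner binomial coefficient. Writing
  \<open>p = q + 2\<close> lets both outer summands be split off.\<close>

lemma freshmans_dream:
  fixes p :: nat
  assumes p: "Factorial_Ring.prime p" "add_pow R p \<one> = \<zero>" and ab: "a \<in> carrier R" "b \<in> carrier R"
  shows "(a \<oplus> b) [^] p = a [^] p \<oplus> b [^] p"
proof -
  obtain q where q: "p = Suc (Suc q)" using prime_ge_2_nat[OF p(1)] by (metis add_2_eq_Suc le_Suc_ex)
  have "add_pow R (p choose k) (a [^] k \<otimes> b [^] (p - k)) = \<zero>" if k: "0 < k" "k < p" for k
  proof -
    have "p dvd (p choose k)" using k p(1) by (intro dvd_choose_prime) auto
    then obtain l where "p choose k = p * l" by blast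
    moreover have "add_pow R p x = \<zero>" if "x \<in> carrier R" for x
      using add_pow_ldistr[of \<one> x p] p(2) that by simp
    ultimately show ?thesis using ab by (simp add: add.nat_pow_pow[symmetric])
  qed
  then have "(\<Oplus>k \<in> {..q}. add_pow R (p choose Suc k) (a [^] Suc k \<otimes> b [^] (p - Suc k))) = \<zero>"
    by (intro add.finprod_one_eqI) (simp only: atMost_iff q zero_less_Suc Suc_mono le_imp_less_Suc)
  moreover have "(a \<oplus> b) [^] p =
      ((\<Oplus>k \<in> {..q}. add_pow R (p choose Suc k) (a [^] Suc k \<otimes> b [^] (p - Suc k))) \<oplus> b [^] p) \<oplus> a [^] p"
    unfolding binomial[OF ab] q using ab
    by (subst finsum_Suc, force, subst finsum_Suc2) (auto simp: a_comm)
  ultimately show ?thesis using ab by (simp add: a_comm)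
qed

text \<open>Its content is the starting subring \<open>S0\<close> for
  \<open>coefficient_subring_extend\<close>. In characteristic \<open>p\<close> these are the
  \<open>p\<close>-th powers of \<open>B\<close> modulo \<open>J'\<close>: a positive degree that
  vanishes in the residue field is at least \<open>p\<close>, and \<open>k [^] p\<close> is already
  in \<open>S0\<close>. In characteristic zero no positive degree vanishes there, and the integer
  multiples of \<open>\<one>\<close> modulo \<open>J'\<close> suffice. Equal characteristic makes
  \<open>p\<close> vanish in \<open>R\<close> itself, as Frobenius requires.\<close>

lemma coefficient_subring_refine:
  assumes I: "ideal I R" "\<one> \<notin> I" "\<And>a. \<lbrakk>a \<in> carrier R; a \<notin> I\<rbrakk> \<Longrightarrow> a \<in> Units R"
    and prime: "\<And>a b. \<lbrakk>a \<in> carrier R; b \<in> carrier R; a \<otimes> b \<in> I\<rbrakk> \<Longrightarrow> a \<in> I \<or> b \<in> I"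
    and equichar: "ring_char R = ring_char (R Quot I)"
    and J: "ideal J R" "J \<subseteq> I" and J': "ideal J' R" "J' \<subseteq> J"
    and square: "\<And>a. a \<in> J \<Longrightarrow> a \<otimes> a \<in> J'"
    and B: "coefficient_subring I J B"
  shows "\<exists>S. coefficient_subring I J' S"
proof -
  interpret I: ideal I R by (fact I(1))
  interpret P: primeideal I R
    using I(2) prime by unfold_locales auto
  interpret J': ideal J' R by (fact J'(1))
  have Bs: "subring B R" "J \<subseteq> B" "B \<inter> I \<subseteq> J"
    using B unfolding coefficient_subring_def by auto
  have Bcl: "x \<in> carrier R" if "x \<in> B" for x using that subringE(1)[OF Bs(1)] by blast
  define p where "p = ring_char (R Quot I)"
  have zero_iff: "add_pow R n \<one> = \<zero> \<longleftrightarrow> p dvd n" and mem_iff: "add_pow R n \<one> \<in> I \<longleftrightarrow> p dvd n" for n :: nat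
    using add_pow_one_eq_zero_iff I.add_pow_one_mem_iff equichar by (simp_all add: p_def)
  have J'I: "j \<in> I" "j \<in> B" "j \<in> carrier R" if "j \<in> J'" for j
    using that J J' Bs(2) by auto
  show ?thesis
  proof (cases "p = 0")
    case False
    then have p: "Factorial_Ring.prime p" unfolding p_def by (rule P.prime_ring_char_quotient)
    have frobenius: "(a \<oplus> b) [^] p = a [^] p \<oplus> b [^] p" if "a \<in> carrier R" "b \<in> carrier R" for a b
      using freshmans_dream[OF p _ that] zero_iff by simp
    obtain q where q: "p = Suc (Suc q)" using prime_ge_2_nat[OF p] by (metis add_2_eq_Suc le_Suc_ex)
    have pow_B: "b [^] n \<in> B" if "b \<in> B" for b and n :: nat
      by (induction n) (simp_all add: subringE(3,6)[OF Bs(1)] that)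
    let ?S0 = "{b [^] p \<oplus> j |b j. b \<in> B \<and> j \<in> J'}"
    have S0I: "b [^] p \<oplus> j \<in> ?S0" if "b \<in> B" "j \<in> J'" for b j using that by blast
    have pow_S0: "b [^] p \<in> ?S0" if "b \<in> B" for b
      using S0I[OF that J'.zero_closed] that Bcl by simp
    show ?thesis
    proof (rule coefficient_subring_extend[OF I J J' square B])
      show "subring ?S0 R"
      proof (rule subringI)
        show "?S0 \<subseteq> carrier R" using Bcl J'I by auto
        show "\<one> \<in> ?S0" using pow_S0[OF subringE(3)[OF Bs(1)]] by simp
      next
        fix u assume "u \<in> ?S0"
        then obtain b j where u: "u = b [^] p \<oplus> j" "b \<in> B" "j \<in> J'" by blast
        have c: "b \<in> carrier R" "j \<in> carrier R" using u Bcl J'I by auto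
        \<comment> \<open>Additivity of Frobenius gives the sign uniformly, \<open>p = 2\<close>
          included.\<close>
        have "(\<ominus> b) [^] p \<oplus> b [^] p = \<zero> [^] p" using frobenius[of "\<ominus> b" b] c by (simp add: l_neg)
        also have "\<dots> = \<zero>" using q by (simp add: nat_pow_zero)
        finally have "(\<ominus> b) [^] p = \<ominus> (b [^] p)" using c by (simp add: minus_equality)
        then have "\<ominus> u = (\<ominus> b) [^] p \<oplus> \<ominus> j" unfolding u using c by (simp add: minus_add)
        then show "\<ominus> u \<in> ?S0"
          using S0I[OF subringE(5)[OF Bs(1) u(2)] J'.a_inv_closed[OF u(3)]] by simp
      next
        fix u v assume "u \<in> ?S0" "v \<in> ?S0"
        then obtain b j c k where u: "u = b [^] p \<oplus> j" "b \<in> B" "j \<in> J'"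
          and v: "v = c [^] p \<oplus> k" "c \<in> B" "k \<in> J'" by blast
        have cl: "b \<in> carrier R" "j \<in> carrier R" "c \<in> carrier R" "k \<in> carrier R"
          "b [^] p \<in> carrier R" "c [^] p \<in> carrier R"
          using u v Bcl J'I by auto
        have "u \<oplus> v = (b \<oplus> c) [^] p \<oplus> (j \<oplus> k)"
          unfolding u v frobenius[OF cl(1,3)] using cl(2,4-6) by (simp add: a_ac)
        then show "u \<oplus> v \<in> ?S0"
          using S0I[OF subringE(7)[OF Bs(1) u(2) v(2)] J'.a_closed[OF u(3) v(3)]] by simp
        have "b [^] p \<otimes> k \<oplus> (c [^] p \<otimes> j \<oplus> k \<otimes> j) \<in> J'"
          by (intro J'.a_closed J'.I_l_closed u v cl)
        moreover have "u \<otimes> v = (b \<otimes> c) [^] p \<oplus> (b [^] p \<otimes> k \<oplus> (c [^] p \<otimes> j \<oplus> k \<otimes> j))"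
          unfolding u v nat_pow_distrib[OF cl(1,3)] using cl(2,4-6) by algebra
        ultimately show "u \<otimes> v \<in> ?S0"
          using S0I[OF subringE(6)[OF Bs(1) u(2) v(2)]] by simp
      qed
      show "J' \<subseteq> ?S0"
      proof
        fix j assume j: "j \<in> J'"
        have "\<zero> [^] p \<oplus> j = j" using J'I[OF j] q by (simp add: nat_pow_zero)
        then show "j \<in> ?S0" using S0I[OF subringE(2)[OF Bs(1)] j] by simp
      qed
      show "?S0 \<subseteq> B" using pow_B J'I subringE(7)[OF Bs(1)] by auto
      show "?S0 \<inter> I \<subseteq> J'"
      proof
        fix u assume "u \<in> ?S0 \<inter> I"
        then obtain b j where u: "u = b [^] p \<oplus> j" "b \<in> B" "j \<in> J'" "u \<in> I" by blast
        have c: "b \<in> carrier R" "j \<in> carrier R" using u Bcl J'I by auto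
        have "u \<ominus> j = b [^] p" unfolding u(1) using c by (simp add: a_minus_def a_assoc r_neg)
        then have pow_I: "b [^] p \<in> I" using I.minus_mem[OF u(4) J'I(1)[OF u(3)]] by simp
        have "b \<in> I" if "b [^] n \<in> I" for n :: nat
          using that
        proof (induction n)
          case (Suc n)
          then show ?case using prime[of "b [^] n" b] c(1) by auto
        qed (use I(2) in simp)
        \<comment> \<open>Elements of \<open>B\<close> in \<open>I\<close> belong to
          \<open>J\<close>, so their squares belong to \<open>J'\<close>; the remaining factor
          \<open>b [^] q\<close> exists because \<open>p \<ge> 2\<close>.\<close>
        then have "b \<otimes> b \<in> J'" using pow_I u(2) Bs(3) square by blast
        then have "b [^] q \<otimes> (b \<otimes> b) \<in> J'" using J'.I_l_closed c by simp
        then have "b [^] p \<in> J'" unfolding q using c by (simp add: m_assoc)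
        then show "u \<in> J'" unfolding u(1) using u(3) by (rule J'.a_closed)
      qed
      show "\<exists>k' \<in> B. k' \<ominus> k \<in> I \<and>
          (\<forall>d > 0. add_pow R d \<one> \<in> I \<longrightarrow> (\<exists>e. 0 < e \<and> e \<le> (d::nat) \<and> k' [^] e \<in> ?S0))" if k: "k \<in> B" for k
      proof (intro bexI[OF _ k] conjI allI impI)
        show "k \<ominus> k \<in> I" using Bcl[OF k] I.zero_closed by (simp add: a_minus_def r_neg)
        show "\<exists>e. 0 < e \<and> e \<le> d \<and> k [^] e \<in> ?S0" if "d > 0" "add_pow R d \<one> \<in> I" for d :: nat
          using that mem_iff dvd_imp_le pow_S0[OF k] False by (intro exI[of _ p]) auto
      qed
    qed
  next
    case True
    let ?S0 = "{add_pow R z \<one> \<oplus> j |z j. j \<in> J' \<and> (z::int) \<in> UNIV}"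
    have S0I: "add_pow R z \<one> \<oplus> j \<in> ?S0" if "j \<in> J'" for z :: int and j using that by blast
    have z_closed: "add_pow R z \<one> \<in> carrier R" for z :: int by simp
    have z_mult: "add_pow R z \<one> \<otimes> add_pow R w \<one> = add_pow R (z * w) \<one>" for z w :: int
      by (simp add: add_pow_ldistr_int add.int_pow_pow mult.commute)
    show ?thesis
    proof (rule coefficient_subring_extend[OF I J J' square B])
      show "subring ?S0 R"
      proof (rule subringI)
        show "?S0 \<subseteq> carrier R" using J'I by auto
        show "\<one> \<in> ?S0" using S0I[OF J'.zero_closed, of 1] by simp
      next
        fix u assume "u \<in> ?S0"
        then obtain z j where u: "u = add_pow R (z::int) \<one> \<oplus> j" "j \<in> J'" by blast
        have "\<ominus> u = add_pow R (- z) \<one> \<oplus> \<ominus> j"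
          unfolding u using J'I[OF u(2)] by (simp add: minus_add add.int_pow_neg)
        then show "\<ominus> u \<in> ?S0" using S0I[OF J'.a_inv_closed[OF u(2)]] by simp
      next
        fix u v assume "u \<in> ?S0" "v \<in> ?S0"
        then obtain z j w k where u: "u = add_pow R (z::int) \<one> \<oplus> j" "j \<in> J'"
          and v: "v = add_pow R (w::int) \<one> \<oplus> k" "k \<in> J'" by blast
        have cl: "j \<in> carrier R" "k \<in> carrier R" using u v J'I by auto
        have "u \<oplus> v = add_pow R (z + w) \<one> \<oplus> (j \<oplus> k)"
          unfolding u v using cl by (simp add: add.int_pow_mult a_ac)
        then show "u \<oplus> v \<in> ?S0" using S0I[OF J'.a_closed[OF u(2) v(2)]] by simp
        have "add_pow R z \<one> \<otimes> k \<oplus> (add_pow R w \<one> \<otimes> j \<oplus> k \<otimes> j) \<in> J'"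
          by (intro J'.a_closed J'.I_l_closed u v cl z_closed)
        moreover have "u \<otimes> v = add_pow R (z * w) \<one> \<oplus>
            (add_pow R z \<one> \<otimes> k \<oplus> (add_pow R w \<one> \<otimes> j \<oplus> k \<otimes> j))"
          unfolding u v z_mult[symmetric] using cl z_closed[of z] z_closed[of w] by algebra
        ultimately show "u \<otimes> v \<in> ?S0" using S0I by simp
      qed
      show "J' \<subseteq> ?S0"
      proof
        fix j assume j: "j \<in> J'"
        have "add_pow R (0::int) \<one> \<oplus> j = j" using J'I[OF j] by (simp add: add_pow_int_ge)
        then show "j \<in> ?S0" using S0I[OF j, of 0] by simp
      qed
      have z_B: "add_pow R z \<one> \<in> B" for z :: int
        using subring_add_pow_closed[OF Bs(1)] subringE(5)[OF Bs(1)]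
        by (cases "z < 0") (simp_all add: add_pow_int_lt add_pow_int_ge)
      show "?S0 \<subseteq> B" using z_B J'I subringE(7)[OF Bs(1)] by auto
      show "?S0 \<inter> I \<subseteq> J'"
      proof
        fix u assume "u \<in> ?S0 \<inter> I"
        then obtain z j where u: "u = add_pow R (z::int) \<one> \<oplus> j" "j \<in> J'" "u \<in> I" by blast
        have "u \<ominus> j = add_pow R z \<one>"
          unfolding u(1) using J'I[OF u(2)] by (simp add: a_minus_def a_assoc r_neg)
        then have z: "add_pow R z \<one> \<in> I" using I.minus_mem[OF u(3) J'I(1)[OF u(2)]] by simp
        have "add_pow R (nat \<bar>z\<bar>) \<one> \<in> I"
        proof (cases "z < 0")
          case True
          then have "\<ominus> (add_pow R z \<one>) = add_pow R (nat \<bar>z\<bar>) \<one>"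
            by (simp add: add_pow_int_lt)
          then show ?thesis using I.a_inv_closed[OF z] by simp
        qed (use z in \<open>simp add: add_pow_int_ge\<close>)
        then have "z = 0" using mem_iff True by simp
        then show "u \<in> J'" using u(1,2) J'I[OF u(2)] by (simp add: add_pow_int_ge)
      qed
      show "\<exists>k' \<in> B. k' \<ominus> k \<in> I \<and>
          (\<forall>d > 0. add_pow R d \<one> \<in> I \<longrightarrow> (\<exists>e. 0 < e \<and> e \<le> (d::nat) \<and> k' [^] e \<in> ?S0))" if k: "k \<in> B" for k
      proof (intro bexI[OF _ k] conjI allI impI)
        show "k \<ominus> k \<in> I" using Bcl[OF k] I.zero_closed by (simp add: a_minus_def r_neg)
        show "\<exists>e. 0 < e \<and> e \<le> d \<and> k [^] e \<in> ?S0" if "d > 0" "add_pow R d \<one> \<in> I" for d :: nat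
          using that mem_iff True by simp
      qed
    qed
  qed
qed

end

section \<open>Chains of maximal length, their simple factors, and coordinates along them\<close>

section \<open>Composition series\<close>

text \<open>The supremum of an infinite set in \<open>enat\<close> is \<open>\<infinity>\<close>, so
  a finite supremum is a maximum.\<close>

lemma chain_sup_attained:
  assumes "chain_sup F = enat n" "F \<noteq> {}"
  obtains Xs where "length Xs = Suc n" "set Xs \<subseteq> F" "sorted_wrt (\<subset>) Xs"
proof -
  let ?C = "{Xs. Xs \<noteq> [] \<and> set Xs \<subseteq> F \<and> sorted_wrt (\<subset>) Xs}"
  let ?E = "(\<lambda>Xs. enat (length Xs - 1)) ` ?C"
  obtain Y where "Y \<in> F" using assms(2) by blast
  then have "[Y] \<in> ?C" by simp
  then have ne: "?E \<noteq> {}" by blast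
  have sup: "Sup ?E = enat n" using assms(1) unfolding chain_sup_def .
  have fin: "finite ?E"
  proof (rule ccontr)
    assume "infinite ?E"
    then have "Sup ?E = \<infinity>" using ne unfolding Sup_enat_def by (simp only: if_False)
    with sup show False by simp
  qed
  then have "Sup ?E = Max ?E" using ne unfolding Sup_enat_def by (simp only: if_True if_False)
  with Max_in[OF fin ne] sup have "enat n \<in> ?E" by simp
  then obtain Xs where "Xs \<in> ?C" "n = length Xs - 1" by auto
  then show ?thesis using that[of Xs] by (cases Xs) auto
qed

lemma chain_sup_ge:
  assumes "set Xs \<subseteq> F" "sorted_wrt (\<subset>) Xs" "length Xs = Suc k"
  shows "enat k \<le> chain_sup F"
  unfolding chain_sup_def by (rule SUP_upper2[of Xs]) (use assms in auto)

lemma maximal_chain_insert: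
  assumes "chain_sup F = enat n" "length (us @ vs) = Suc n" "set (us @ vs) \<subseteq> F"
    and "sorted_wrt (\<subset>) (us @ vs)" "Y \<in> F"
    and "\<And>U. U \<in> set us \<Longrightarrow> U \<subset> Y" "\<And>V. V \<in> set vs \<Longrightarrow> Y \<subset> V"
  shows False
proof -
  have "sorted_wrt (\<subset>) (us @ Y # vs)" using assms(4,6,7) by (auto simp: sorted_wrt_append)
  then have "enat (Suc n) \<le> chain_sup F"
    using assms(2,3,5) by (intro chain_sup_ge[of "us @ Y # vs"]) auto
  then show False using assms(1) by simp
qed

lemma (in module) submodule_add_generated:
  assumes "submodule H R M" "v \<in> carrier M"
  shows "submodule {a \<odot>\<^bsub>M\<^esub> v \<oplus>\<^bsub>M\<^esub> w |a w. a \<in> carrier R \<and> w \<in> H} R M"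
proof (rule submoduleI)
  have Hc: "w \<in> carrier M" if "w \<in> H" for w using submoduleE(1)[OF assms(1)] that by blast
  let ?K = "{a \<odot>\<^bsub>M\<^esub> v \<oplus>\<^bsub>M\<^esub> w |a w. a \<in> carrier R \<and> w \<in> H}"
  have KI: "a \<odot>\<^bsub>M\<^esub> v \<oplus>\<^bsub>M\<^esub> w \<in> ?K" if "a \<in> carrier R" "w \<in> H" for a w using that by blast
  have zero: "\<zero>\<^bsub>M\<^esub> \<in> H" using subgroup.one_closed[OF submodule.axioms(1)[OF assms(1)]] by simp
  show "?K \<subseteq> carrier M" using assms(2) Hc by auto
  show "\<zero>\<^bsub>M\<^esub> \<in> ?K" using KI[OF R.zero_closed zero] assms(2) by simp
  fix b assume "b \<in> ?K"
  then obtain a w where b: "b = a \<odot>\<^bsub>M\<^esub> v \<oplus>\<^bsub>M\<^esub> w" "a \<in> carrier R" "w \<in> H" by blast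
  have "\<ominus>\<^bsub>M\<^esub> b = (\<ominus> a) \<odot>\<^bsub>M\<^esub> v \<oplus>\<^bsub>M\<^esub> (\<ominus>\<^bsub>M\<^esub> w)"
    unfolding b(1) using b(2,3) assms(2) Hc by (simp add: M.minus_add smult_l_minus)
  then show "\<ominus>\<^bsub>M\<^esub> b \<in> ?K"
    using KI[OF R.a_inv_closed[OF b(2)] submoduleE(3)[OF assms(1) b(3)]] by simp
  show "x \<odot>\<^bsub>M\<^esub> b \<in> ?K" if x: "x \<in> carrier R" for x
  proof -
    have "x \<odot>\<^bsub>M\<^esub> b = (x \<otimes> a) \<odot>\<^bsub>M\<^esub> v \<oplus>\<^bsub>M\<^esub> x \<odot>\<^bsub>M\<^esub> w"
      unfolding b(1) using b(2,3) x assms(2) Hc by (simp add: smult_r_distr smult_assoc1)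
    then show ?thesis using KI[of "x \<otimes> a" "x \<odot>\<^bsub>M\<^esub> w"] submoduleE(4)[OF assms(1) x b(3)] x b(2) by simp
  qed
  fix c assume "c \<in> ?K"
  then obtain a' w' where c: "c = a' \<odot>\<^bsub>M\<^esub> v \<oplus>\<^bsub>M\<^esub> w'" "a' \<in> carrier R" "w' \<in> H" by blast
  have "b \<oplus>\<^bsub>M\<^esub> c = (a \<oplus> a') \<odot>\<^bsub>M\<^esub> v \<oplus>\<^bsub>M\<^esub> (w \<oplus>\<^bsub>M\<^esub> w')"
    unfolding b(1) c(1) using b(2,3) c(2,3) assms(2) Hc by (simp add: smult_l_distr M.a_ac)
  then show "b \<oplus>\<^bsub>M\<^esub> c \<in> ?K"
    using KI[of "a \<oplus> a'" "w \<oplus>\<^bsub>M\<^esub> w'"] b(2) c(2) submoduleE(5)[OF assms(1) b(3) c(3)] by simp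
qed

text \<open>The last two conditions say that the class of \<open>e i\<close> generates
  \<open>N (Suc i) / N i\<close> and has annihilator \<open>I\<close>: each factor is a copy of
  \<open>R / I\<close> with a chosen generator. Simplicity of the factors is used in this
  form.\<close>

locale composition_series = module R M for R (structure) and M (structure) +
  fixes I :: "'a set" and N :: "nat \<Rightarrow> 'c set" and e :: "nat \<Rightarrow> 'c" and n :: nat
  assumes N_0: "N 0 = {\<zero>\<^bsub>M\<^esub>}"
    and N_n: "N n = carrier M"
    and N_submodule: "i \<le> n \<Longrightarrow> submodule (N i) R M"
    and N_Suc: "i < n \<Longrightarrow> N i \<subseteq> N (Suc i)"
    and e_mem: "i < n \<Longrightarrow> e i \<in> N (Suc i)"
    and N_gen: "\<lbrakk>i < n; v \<in> N (Suc i)\<rbrakk> \<Longrightarrow>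
      \<exists>a \<in> carrier R. \<exists>w \<in> N i. v = a \<odot>\<^bsub>M\<^esub> e i \<oplus>\<^bsub>M\<^esub> w"
    and smult_e_mem_iff: "\<lbrakk>i < n; a \<in> carrier R\<rbrakk> \<Longrightarrow> a \<odot>\<^bsub>M\<^esub> e i \<in> N i \<longleftrightarrow> a \<in> I"

lemma (in module) composition_series_exists:
  assumes n: "module_length R M = enat n"
    and I: "ideal I R" "\<one> \<notin> I" "\<And>a. \<lbrakk>a \<in> carrier R; a \<notin> I\<rbrakk> \<Longrightarrow> a \<in> Units R"
  shows "\<exists>N e. composition_series R M I N e n"
proof -
  interpret I: ideal I R by (fact I(1))
  let ?F = "{N. submodule N R M}"
  have "?F \<noteq> {}" using carrier_is_submodule by blast
  with n obtain Xs where Xs: "length Xs = Suc n" "set Xs \<subseteq> ?F" "sorted_wrt (\<subset>) Xs"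
    unfolding module_length_def by (rule chain_sup_attained)
  define N where "N i = Xs ! i" for i
  have sub: "submodule (N i) R M" if "i \<le> n" for i
    using Xs(1,2) that unfolding N_def by (metis le_imp_less_Suc mem_Collect_eq nth_mem subsetD)
  have mono: "N i \<subset> N j" if "i < j" "j \<le> n" for i j
    using Xs(1,3) that unfolding N_def by (simp add: sorted_wrt_iff_nth_less)
  \<comment> \<open>The index \<open>i\<close> counts the members of the chain below
    \<open>Y\<close>; the values \<open>0\<close> and \<open>Suc n\<close> cover insertion at the
    two ends.\<close>
  have no_insert: False if Y: "submodule Y R M" and i: "i \<le> Suc n"
    and below: "\<And>j. j < i \<Longrightarrow> N j \<subset> Y" and above: "\<And>j. \<lbrakk>i \<le> j; j \<le> n\<rbrakk> \<Longrightarrow> Y \<subset> N j" for Y i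
  proof (rule maximal_chain_insert)
    show "chain_sup ?F = enat n" using n unfolding module_length_def .
    show "length (take i Xs @ drop i Xs) = Suc n" "set (take i Xs @ drop i Xs) \<subseteq> ?F"
      "sorted_wrt (\<subset>) (take i Xs @ drop i Xs)" using Xs by simp_all
    show "Y \<in> ?F" using Y by simp
    show "U \<subset> Y" if "U \<in> set (take i Xs)" for U
    proof -
      obtain j where "j < length (take i Xs)" "U = take i Xs ! j"
        using \<open>U \<in> _\<close> unfolding in_set_conv_nth by auto
      then show ?thesis using below[of j] unfolding N_def by simp
    qed
    show "Y \<subset> V" if "V \<in> set (drop i Xs)" for V
    proof -
      obtain j where "j < length (drop i Xs)" "V = drop i Xs ! j"
        using \<open>V \<in> _\<close> unfolding in_set_conv_nth by auto
      then show ?thesis using above[of "i + j"] Xs(1) i unfolding N_def by simp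
    qed
  qed
  have zero_mem: "\<zero>\<^bsub>M\<^esub> \<in> H" if "submodule H R M" for H
    using subgroup.one_closed[OF submodule.axioms(1)[OF that]] by simp
  have zero: "submodule {\<zero>\<^bsub>M\<^esub>} R M" by (rule submoduleI) auto
  have N_0: "N 0 = {\<zero>\<^bsub>M\<^esub>}"
  proof (rule ccontr)
    assume "N 0 \<noteq> {\<zero>\<^bsub>M\<^esub>}"
    then have *: "{\<zero>\<^bsub>M\<^esub>} \<subset> N 0" using zero_mem[OF sub[of 0]] by blast
    have "{\<zero>\<^bsub>M\<^esub>} \<subset> N j" if "j \<le> n" for j using * mono[of 0 j] that by (cases "j = 0") auto
    then show False by (intro no_insert[OF zero, of 0]) auto
  qed
  have N_n: "N n = carrier M"
  proof (rule ccontr)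
    assume "N n \<noteq> carrier M"
    then have *: "N n \<subset> carrier M" using submoduleE(1)[OF sub[of n]] by blast
    have "N j \<subset> carrier M" if "j \<le> n" for j using * mono[of j n] that by (cases "j = n") auto
    then show False by (intro no_insert[OF carrier_is_submodule, of "Suc n"]) auto
  qed
  have "\<exists>v. v \<in> N (Suc i) \<and> v \<notin> N i" if "i < n" for i using mono[of i "Suc i"] that by auto
  then obtain e where e: "\<And>i. i < n \<Longrightarrow> e i \<in> N (Suc i)" "\<And>i. i < n \<Longrightarrow> e i \<notin> N i" by metis
  have Nc: "v \<in> carrier M" if "i \<le> n" "v \<in> N i" for i v using submoduleE(1)[OF sub[OF that(1)]] that(2) by blast
  \<comment> \<open>Otherwise \<open>R u + N i\<close> would refine the chain. The claim is made for
    every \<open>u\<close> outside \<open>N i\<close> because it is also applied below to a multiple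
    of \<open>e i\<close>.\<close>
  have gen: "\<exists>a \<in> carrier R. \<exists>w \<in> N i. v = a \<odot>\<^bsub>M\<^esub> u \<oplus>\<^bsub>M\<^esub> w"
    if i: "i < n" and u: "u \<in> N (Suc i)" "u \<notin> N i" and v: "v \<in> N (Suc i)" for i u v
  proof (rule ccontr)
    define K where "K = {a \<odot>\<^bsub>M\<^esub> u \<oplus>\<^bsub>M\<^esub> w |a w. a \<in> carrier R \<and> w \<in> N i}"
    assume "\<not> ?thesis"
    then have v': "v \<notin> K" unfolding K_def by blast
    have uc: "u \<in> carrier M" using Nc[of "Suc i"] i u(1) by simp
    have Si: "submodule (N i) R M" "submodule (N (Suc i)) R M" using sub i by auto
    have K: "submodule K R M" unfolding K_def by (rule submodule_add_generated[OF Si(1) uc])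
    have "\<one> \<odot>\<^bsub>M\<^esub> u \<oplus>\<^bsub>M\<^esub> \<zero>\<^bsub>M\<^esub> \<in> K" unfolding K_def using zero_mem[OF Si(1)] by blast
    then have uK: "u \<in> K" using uc by simp
    have NK: "N i \<subseteq> K"
    proof
      fix w assume w: "w \<in> N i"
      then have "\<zero> \<odot>\<^bsub>M\<^esub> u \<oplus>\<^bsub>M\<^esub> w \<in> K" unfolding K_def by blast
      then show "w \<in> K" using uc w Nc[of i w] i by simp
    qed
    have KN: "K \<subseteq> N (Suc i)"
    proof
      fix x assume "x \<in> K"
      then obtain a w where x: "x = a \<odot>\<^bsub>M\<^esub> u \<oplus>\<^bsub>M\<^esub> w" "a \<in> carrier R" "w \<in> N i"
        unfolding K_def by blast
      have "w \<in> N (Suc i)" using mono[of i "Suc i"] i x(3) by auto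
      then show "x \<in> N (Suc i)"
        unfolding x(1) by (rule submoduleE(5)[OF Si(2) submoduleE(4)[OF Si(2) x(2) u(1)]])
    qed
    have 1: "N i \<subset> K" "K \<subset> N (Suc i)" using NK KN uK u(2) v v' by blast+
    show False
    proof (rule no_insert[OF K, of "Suc i"])
      show "N j \<subset> K" if "j < Suc i" for j
        using 1(1) mono[of j i] that i by (cases "j = i") auto
      show "K \<subset> N j" if "Suc i \<le> j" "j \<le> n" for j
        using 1(2) mono[of "Suc i" j] that by (cases "j = Suc i") auto
    qed (use i in simp)
  qed
  have iff: "a \<odot>\<^bsub>M\<^esub> e i \<in> N i \<longleftrightarrow> a \<in> I" if i: "i < n" and a: "a \<in> carrier R" for i a
  proof
    have ec: "e i \<in> carrier M" using Nc[of "Suc i"] e(1)[OF i] i by simp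
    have Si: "submodule (N i) R M" "submodule (N (Suc i)) R M" using sub i by auto
    have unit_mem: "e i \<in> N i" if "b \<in> Units R" "b \<odot>\<^bsub>M\<^esub> e i \<in> N i" for b
    proof -
      have "inv b \<odot>\<^bsub>M\<^esub> (b \<odot>\<^bsub>M\<^esub> e i) \<in> N i" using submoduleE(4)[OF Si(1)] that by simp
      moreover have "inv b \<odot>\<^bsub>M\<^esub> (b \<odot>\<^bsub>M\<^esub> e i) = e i"
        using that(1) ec by (simp add: smult_assoc1[symmetric] R.Units_closed)
      ultimately show ?thesis by simp
    qed
    show "a \<in> I" if "a \<odot>\<^bsub>M\<^esub> e i \<in> N i" using unit_mem[OF I(3)[OF a] that] e(2)[OF i] by blast
    \<comment> \<open>Nakayama's argument for a cyclic factor: if \<open>a\<close> kept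
      \<open>e i\<close> outside \<open>N i\<close>, then some \<open>1 - b a\<close> would send
      \<open>e i\<close> into \<open>N i\<close>, hence lie in \<open>I\<close> together with
      \<open>b a\<close>.\<close>
    show "a \<odot>\<^bsub>M\<^esub> e i \<in> N i" if aI: "a \<in> I"
    proof (rule ccontr)
      assume "a \<odot>\<^bsub>M\<^esub> e i \<notin> N i"
      then obtain b w where b: "b \<in> carrier R" "w \<in> N i" "e i = b \<odot>\<^bsub>M\<^esub> (a \<odot>\<^bsub>M\<^esub> e i) \<oplus>\<^bsub>M\<^esub> w"
        using gen[OF i submoduleE(4)[OF Si(2) a e(1)[OF i]] _ e(1)[OF i]] by blast
      have wc: "w \<in> carrier M" using Nc[of i] b(2) i by simp
      have "(\<one> \<ominus> b \<otimes> a) \<odot>\<^bsub>M\<^esub> e i = e i \<ominus>\<^bsub>M\<^esub> b \<odot>\<^bsub>M\<^esub> (a \<odot>\<^bsub>M\<^esub> e i)"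
        unfolding a_minus_def using a b(1) ec by (simp add: smult_l_distr smult_l_minus smult_assoc1)
      also have "\<dots> = w"
        by (subst (1) b(3)) (use a b(1) ec wc in \<open>simp add: a_minus_def M.a_ac M.r_neg\<close>)
      finally have "(\<one> \<ominus> b \<otimes> a) \<odot>\<^bsub>M\<^esub> e i \<in> N i" using b(2) by simp
      then have "\<one> \<ominus> b \<otimes> a \<in> I"
        using unit_mem[OF I(3)[of "\<one> \<ominus> b \<otimes> a"]] a b(1) e(2)[OF i] by auto
      then have "\<one> \<in> I" by (rule I.mem_if_minus_mem[OF R.one_closed I.I_l_closed[OF aI b(1)]])
      with I(2) show False ..
    qed
  qed
  have "composition_series R M I N e n"
  proof (intro composition_series.intro composition_series_axioms.intro module_axioms)
    show "N i \<subseteq> N (Suc i)" if "i < n" for i using mono[of i "Suc i"] that by auto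
    show "\<exists>a \<in> carrier R. \<exists>w \<in> N i. v = a \<odot>\<^bsub>M\<^esub> e i \<oplus>\<^bsub>M\<^esub> w" if "i < n" "v \<in> N (Suc i)" for i v
      by (rule gen[OF that(1) e(1)[OF that(1)] e(2)[OF that(1)] that(2)])
  qed (fact N_0 N_n sub e iff)+
  then show ?thesis by blast
qed

section \<open>The filtration and the ideals that lower it\<close>

context composition_series
begin

lemma N_closed: "\<lbrakk>i \<le> n; v \<in> N i\<rbrakk> \<Longrightarrow> v \<in> carrier M"
  using submoduleE(1)[OF N_submodule] by blast

lemma e_closed: "i < n \<Longrightarrow> e i \<in> carrier M"
  using N_closed[of "Suc i"] e_mem by simp

lemma N_mono: "\<lbrakk>i \<le> j; j \<le> n\<rbrakk> \<Longrightarrow> N i \<subseteq> N j"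
proof (induction j rule: dec_induct)
  case (step j)
  then show ?case using N_Suc[of j] by auto
qed simp

lemma N_zero: "i \<le> n \<Longrightarrow> \<zero>\<^bsub>M\<^esub> \<in> N i"
  using N_mono[of 0 i] N_0 by auto

lemma N_smult: "\<lbrakk>i \<le> n; a \<in> carrier R; v \<in> N i\<rbrakk> \<Longrightarrow> a \<odot>\<^bsub>M\<^esub> v \<in> N i"
  by (rule submoduleE(4)[OF N_submodule])

lemma N_add: "\<lbrakk>i \<le> n; v \<in> N i; w \<in> N i\<rbrakk> \<Longrightarrow> v \<oplus>\<^bsub>M\<^esub> w \<in> N i"
  by (rule submoduleE(5)[OF N_submodule])

lemma N_neg: "\<lbrakk>i \<le> n; v \<in> N i\<rbrakk> \<Longrightarrow> \<ominus>\<^bsub>M\<^esub> v \<in> N i"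
  by (rule submoduleE(3)[OF N_submodule])

lemma N_minus: "\<lbrakk>i \<le> n; v \<in> N i; w \<in> N i\<rbrakk> \<Longrightarrow> v \<ominus>\<^bsub>M\<^esub> w \<in> N i"
  unfolding a_minus_def by (intro N_add N_neg)

lemma N_cancel:
  assumes "i \<le> n" "v \<in> carrier M" "w \<in> N i" "v \<oplus>\<^bsub>M\<^esub> w \<in> N i"
  shows "v \<in> N i"
proof -
  have "(v \<oplus>\<^bsub>M\<^esub> w) \<ominus>\<^bsub>M\<^esub> w = v"
    using assms(2) N_closed[OF assms(1,3)] by (simp add: a_minus_def M.a_assoc M.r_neg)
  with N_minus[OF assms(1,4,3)] show ?thesis by simp
qed

lemma I_smult:
  assumes "ideal I R" "a \<in> I" "j \<le> n" "v \<in> N j"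
  shows "a \<odot>\<^bsub>M\<^esub> v \<in> N (j - 1)"
proof (cases j)
  case 0
  then show ?thesis using N_smult[of 0 a v] assms ideal.Icarr[OF assms(1,2)] by simp
next
  case (Suc i)
  have a: "a \<in> carrier R" using ideal.Icarr[OF assms(1,2)] .
  have i: "i < n" "i \<le> n" using assms(3) Suc by auto
  obtain b w where b: "b \<in> carrier R" "w \<in> N i" "v = b \<odot>\<^bsub>M\<^esub> e i \<oplus>\<^bsub>M\<^esub> w"
    using N_gen[OF i(1)] assms(4) Suc by blast
  have "a \<odot>\<^bsub>M\<^esub> v = (a \<otimes> b) \<odot>\<^bsub>M\<^esub> e i \<oplus>\<^bsub>M\<^esub> a \<odot>\<^bsub>M\<^esub> w"
    unfolding b(3) using a b(1) e_closed[OF i(1)] N_closed[OF i(2) b(2)]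
    by (simp add: smult_r_distr smult_assoc1)
  moreover have "(a \<otimes> b) \<odot>\<^bsub>M\<^esub> e i \<in> N i"
    using smult_e_mem_iff[OF i(1), of "a \<otimes> b"] ideal.I_r_closed[OF assms(1,2) b(1)] a b(1) by simp
  ultimately show ?thesis using N_add[OF i(2) _ N_smult[OF i(2) a b(2)]] Suc by simp
qed

text \<open>These ideals take the place of the powers of \<open>I\<close>. Their indices add under
  multiplication, and from index \<open>n\<close> on they annihilate \<open>M\<close>, because
  truncated subtraction ends at \<open>N 0\<close>.\<close>

definition shift_ideal :: "nat \<Rightarrow> 'a set" where
  "shift_ideal i = {a \<in> carrier R. \<forall>j \<le> n. \<forall>v \<in> N j. a \<odot>\<^bsub>M\<^esub> v \<in> N (j - i)}"

lemma shift_idealD: "\<lbrakk>a \<in> shift_ideal i; j \<le> n; v \<in> N j\<rbrakk> \<Longrightarrow> a \<odot>\<^bsub>M\<^esub> v \<in> N (j - i)"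
  unfolding shift_ideal_def by blast

lemma ideal_shift_ideal: "ideal (shift_ideal i) R"
proof (rule idealI)
  show "ring R" ..
  show "subgroup (shift_ideal i) (add_monoid R)"
  proof (rule R.add.subgroupI)
    show "shift_ideal i \<subseteq> carrier R" unfolding shift_ideal_def by blast
    have "\<zero> \<in> shift_ideal i" unfolding shift_ideal_def using N_closed N_zero by simp
    then show "shift_ideal i \<noteq> {}" by blast
    show "\<ominus> a \<in> shift_ideal i" if a: "a \<in> shift_ideal i" for a
    proof -
      have c: "a \<in> carrier R" using a unfolding shift_ideal_def by blast
      have "(\<ominus> a) \<odot>\<^bsub>M\<^esub> v \<in> N (j - i)" if "j \<le> n" "v \<in> N j" for j v
        using N_neg[OF _ shift_idealD[OF a that]] c N_closed[OF that] that(1)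
        by (simp add: smult_l_minus)
      with c show ?thesis unfolding shift_ideal_def by simp
    qed
    show "a \<oplus> b \<in> shift_ideal i" if ab: "a \<in> shift_ideal i" "b \<in> shift_ideal i" for a b
    proof -
      have c: "a \<in> carrier R" "b \<in> carrier R" using ab unfolding shift_ideal_def by blast+
      have "(a \<oplus> b) \<odot>\<^bsub>M\<^esub> v \<in> N (j - i)" if "j \<le> n" "v \<in> N j" for j v
        using N_add[OF _ shift_idealD[OF ab(1) that] shift_idealD[OF ab(2) that]] c
          N_closed[OF that] that(1)
        by (simp add: smult_l_distr)
      with c show ?thesis unfolding shift_ideal_def by simp
    qed
  qed
  fix a x assume a: "a \<in> shift_ideal i" and x: "x \<in> carrier R"
  have c: "a \<in> carrier R" using a unfolding shift_ideal_def by blast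
  have "(x \<otimes> a) \<odot>\<^bsub>M\<^esub> v \<in> N (j - i)" if "j \<le> n" "v \<in> N j" for j v
    using N_smult[OF _ x shift_idealD[OF a that]] c x N_closed[OF that] that(1)
    by (simp add: smult_assoc1)
  with c x show "x \<otimes> a \<in> shift_ideal i" unfolding shift_ideal_def by simp
  then show "a \<otimes> x \<in> shift_ideal i" using c x R.m_comm by simp
qed

lemma shift_ideal_mult:
  assumes a: "a \<in> shift_ideal i" and b: "b \<in> shift_ideal k"
  shows "a \<otimes> b \<in> shift_ideal (k + i)"
proof -
  have c: "a \<in> carrier R" "b \<in> carrier R" using a b unfolding shift_ideal_def by blast+
  have "(a \<otimes> b) \<odot>\<^bsub>M\<^esub> v \<in> N (j - (k + i))" if "j \<le> n" "v \<in> N j" for j v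
    using shift_idealD[OF a _ shift_idealD[OF b that]] c N_closed[OF that] that(1)
    by (simp add: smult_assoc1)
  with c show ?thesis unfolding shift_ideal_def by simp
qed

lemma shift_ideal_antimono: "i \<le> k \<Longrightarrow> shift_ideal k \<subseteq> shift_ideal i"
proof
  fix a assume ik: "i \<le> k" and a: "a \<in> shift_ideal k"
  have "a \<odot>\<^bsub>M\<^esub> v \<in> N (j - i)" if "j \<le> n" "v \<in> N j" for j v
    using shift_idealD[OF a that] N_mono[OF diff_le_mono2[OF ik] le_trans[OF diff_le_self that(1)]] by auto
  with a show "a \<in> shift_ideal i" unfolding shift_ideal_def by blast
qed

text \<open>The refinement runs along \<open>shift_ideal (Suc i) \<inter> I\<close>. The offset
  matters: squaring doubles the index, which gains a step only from a positive index. At index one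
  the ideal is all of \<open>I\<close>, for which the whole ring qualifies.\<close>

lemma annihilating_coefficient_subring:
  assumes I: "ideal I R" "\<one> \<notin> I" "\<And>a. \<lbrakk>a \<in> carrier R; a \<notin> I\<rbrakk> \<Longrightarrow> a \<in> Units R"
    and prime: "\<And>a b. \<lbrakk>a \<in> carrier R; b \<in> carrier R; a \<otimes> b \<in> I\<rbrakk> \<Longrightarrow> a \<in> I \<or> b \<in> I"
    and equichar: "ring_char R = ring_char (R Quot I)"
  shows "\<exists>J S. ideal J R \<and> J \<subseteq> I \<and> R.coefficient_subring I J S \<and>
    (\<forall>a \<in> J. \<forall>v \<in> carrier M. a \<odot>\<^bsub>M\<^esub> v = \<zero>\<^bsub>M\<^esub>)"
proof -
  have J: "ideal (shift_ideal i \<inter> I) R" for i using R.i_intersect[OF ideal_shift_ideal I(1)] .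
  have "\<exists>S. R.coefficient_subring I (shift_ideal (Suc i) \<inter> I) S" for i
  proof (induction i)
    case 0
    have "I \<subseteq> shift_ideal (Suc 0)"
      unfolding shift_ideal_def using I_smult[OF I(1)] ideal.Icarr[OF I(1)] by auto
    then have "shift_ideal (Suc 0) \<inter> I = I" by blast
    moreover have "R.coefficient_subring I I (carrier R)"
      unfolding R.coefficient_subring_def
    proof (intro conjI ballI)
      show "I \<subseteq> carrier R" using ideal.Icarr[OF I(1)] by blast
      show "\<exists>s \<in> carrier R. a \<ominus> s \<in> I" if "a \<in> carrier R" for a
        using that additive_subgroup.zero_closed[OF ideal.axioms(1)[OF I(1)]]
        by (intro bexI[of _ a]) (simp_all add: a_minus_def R.r_neg)
      show "\<exists>t \<in> carrier R. t \<otimes> s = \<one>" if "s \<in> carrier R - I" for s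
        using I(3)[of s] that by (intro bexI[of _ "inv s"]) auto
    qed (auto simp: R.carrier_is_subring)
    ultimately show ?case by auto
  next
    case (Suc i)
    then obtain B where B: "R.coefficient_subring I (shift_ideal (Suc i) \<inter> I) B" by blast
    show ?case
    proof (rule R.coefficient_subring_refine[OF I prime equichar J _ J _ _ B])
      show "shift_ideal (Suc (Suc i)) \<inter> I \<subseteq> shift_ideal (Suc i) \<inter> I"
        using shift_ideal_antimono[of "Suc i" "Suc (Suc i)"] by auto
      show "a \<otimes> a \<in> shift_ideal (Suc (Suc i)) \<inter> I" if a: "a \<in> shift_ideal (Suc i) \<inter> I" for a
        using shift_ideal_mult[of a "Suc i" a "Suc i"] a
          subsetD[OF shift_ideal_antimono[of "Suc (Suc i)" "Suc i + Suc i"]]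
          ideal.I_l_closed[OF I(1), of a a] ideal.Icarr[OF I(1), of a] by simp
    qed auto
  qed
  then obtain S where S: "R.coefficient_subring I (shift_ideal (Suc n) \<inter> I) S" by blast
  have "a \<odot>\<^bsub>M\<^esub> v = \<zero>\<^bsub>M\<^esub>" if "a \<in> shift_ideal (Suc n) \<inter> I" "v \<in> carrier M" for a v
    using shift_idealD[of a "Suc n" n v] that N_n N_0 by simp
  with S J show ?thesis by blast
qed

section \<open>Coordinates with respect to the generators \<open>e\<close>, with coefficients in
  \<open>S\<close>\<close>

definition lincomb :: "nat \<Rightarrow> (nat \<Rightarrow> 'a) \<Rightarrow> 'c" where
  "lincomb k c = (\<Oplus>\<^bsub>M\<^esub> i \<in> {..<k}. c i \<odot>\<^bsub>M\<^esub> e i)"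

lemma lincomb_0: "lincomb 0 c = \<zero>\<^bsub>M\<^esub>"
  unfolding lincomb_def by simp

lemma lincomb_Suc:
  assumes "k < n" "\<And>i. c i \<in> carrier R"
  shows "lincomb (Suc k) c = c k \<odot>\<^bsub>M\<^esub> e k \<oplus>\<^bsub>M\<^esub> lincomb k c"
  unfolding lincomb_def lessThan_Suc using assms e_closed
  by (subst M.finsum_insert) (auto simp: Pi_def)

lemma lincomb_mem:
  assumes "\<And>i. c i \<in> carrier R"
  shows "k \<le> n \<Longrightarrow> lincomb k c \<in> N k"
proof (induction k)
  case 0
  then show ?case using lincomb_0 N_0 by simp
next
  case (Suc k)
  have "c k \<odot>\<^bsub>M\<^esub> e k \<in> N (Suc k)" using N_smult[OF Suc.prems assms e_mem] Suc.prems by simp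
  moreover have "lincomb k c \<in> N (Suc k)" using Suc N_Suc[of k] by auto
  ultimately show ?case using lincomb_Suc[of k c] N_add[OF Suc.prems] assms Suc.prems by simp
qed

lemma lincomb_cong: "(\<And>i. i < k \<Longrightarrow> c i = d i) \<Longrightarrow> (\<And>i. d i \<in> carrier R) \<Longrightarrow> k \<le> n \<Longrightarrow> lincomb k c = lincomb k d"
  unfolding lincomb_def using e_closed by (intro M.finsum_cong') auto

lemma lincomb_extend:
  assumes "j \<le> k" "k \<le> n" "\<And>i. c i \<in> carrier R" "\<And>i. j \<le> i \<Longrightarrow> c i = \<zero>"
  shows "lincomb k c = lincomb j c"
  using assms(1,2)
proof (induction k rule: dec_induct)
  case (step k)
  then show ?case
    using lincomb_Suc[of k c] assms(3,4) e_closed N_closed[OF _ lincomb_mem[of c j]] by simp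
qed simp

text \<open>A coefficient \<open>a\<close> is replaced by some \<open>s \<in> S\<close> with the
  same residue; the difference \<open>a \<ominus> s\<close> sends \<open>e j\<close> into
  \<open>N j\<close>, and this part is left to the induction. The vanishing beyond \<open>j\<close>
  is the source of the triangular matrices.\<close>

lemma lincomb_exists:
  assumes I: "ideal I R" and S: "R.coefficient_subring I J S"
  shows "\<lbrakk>j \<le> n; v \<in> N j\<rbrakk> \<Longrightarrow> \<exists>c. (\<forall>i. c i \<in> S) \<and> (\<forall>i \<ge> j. c i = \<zero>) \<and> v = lincomb n c"
proof -
  have S': "subring S R" "\<And>a. a \<in> carrier R \<Longrightarrow> \<exists>s \<in> S. a \<ominus> s \<in> I"
    using S unfolding R.coefficient_subring_def by auto
  have Scl: "x \<in> carrier R" if "x \<in> S" for x using that subringE(1)[OF S'(1)] by blast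
  have "\<lbrakk>j \<le> n; v \<in> N j\<rbrakk> \<Longrightarrow> \<exists>c. (\<forall>i. c i \<in> S) \<and> (\<forall>i \<ge> j. c i = \<zero>) \<and> v = lincomb j c" for j v
  proof (induction j arbitrary: v)
    case 0
    then show ?case using lincomb_0 N_0 subringE(2)[OF S'(1)] by (intro exI[of _ "\<lambda>_. \<zero>"]) auto
  next
    case (Suc j)
    have j: "j < n" "j \<le> n" using Suc.prems(1) by auto
    obtain a w where a: "a \<in> carrier R" "w \<in> N j" "v = a \<odot>\<^bsub>M\<^esub> e j \<oplus>\<^bsub>M\<^esub> w"
      using N_gen[OF j(1) Suc.prems(2)] by blast
    obtain s where s: "s \<in> S" "a \<ominus> s \<in> I" using S'(2)[OF a(1)] by blast
    have cl: "s \<in> carrier R" "e j \<in> carrier M" "w \<in> carrier M" "a \<ominus> s \<in> carrier R"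
      using s(1) Scl e_closed[OF j(1)] N_closed[OF j(2) a(2)] a(1) by auto
    have "(a \<ominus> s) \<odot>\<^bsub>M\<^esub> e j \<oplus>\<^bsub>M\<^esub> w \<in> N j"
      using smult_e_mem_iff[OF j(1) cl(4)] s(2) N_add[OF j(2) _ a(2)] by simp
    then obtain c where c: "\<And>i. c i \<in> S" "\<And>i. i \<ge> j \<Longrightarrow> c i = \<zero>"
        "(a \<ominus> s) \<odot>\<^bsub>M\<^esub> e j \<oplus>\<^bsub>M\<^esub> w = lincomb j c"
      using Suc.IH[OF j(2)] by blast
    let ?d = "c(j := s)"
    have d: "?d i \<in> carrier R" for i using c(1) s(1) Scl by simp
    have "a = s \<oplus> (a \<ominus> s)" using a(1) cl(1) by (simp add: a_minus_def R.a_ac R.r_neg)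
    then have "a \<odot>\<^bsub>M\<^esub> e j = s \<odot>\<^bsub>M\<^esub> e j \<oplus>\<^bsub>M\<^esub> (a \<ominus> s) \<odot>\<^bsub>M\<^esub> e j"
      using smult_l_distr[OF cl(1,4,2)] by simp
    then have "v = s \<odot>\<^bsub>M\<^esub> e j \<oplus>\<^bsub>M\<^esub> lincomb j c"
      unfolding a(3) c(3)[symmetric] using cl by (simp add: M.a_assoc)
    also have "lincomb j c = lincomb j ?d"
      using d j(2) by (intro lincomb_cong) auto
    also have "s \<odot>\<^bsub>M\<^esub> e j \<oplus>\<^bsub>M\<^esub> lincomb j ?d = lincomb (Suc j) ?d"
      using lincomb_Suc[OF j(1), of ?d, OF d] by simp
    finally have "v = lincomb (Suc j) ?d" .
    moreover have "\<forall>i. ?d i \<in> S" "\<forall>i \<ge> Suc j. ?d i = \<zero>" using c(1,2) s(1) by auto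
    ultimately show ?case by blast
  qed
  then show ?thesis if "j \<le> n" "v \<in> N j"
    using lincomb_extend[OF that(1) order_refl] Scl that by metis
qed

text \<open>The top coefficient is forced into \<open>I\<close>, and by \<open>kill\<close> its term
  is then exactly zero, not merely lower in the filtration, where it could disturb the remaining
  coefficients. For \<open>j = 0\<close> this is independence of the \<open>e i\<close> modulo
  \<open>I\<close>.\<close>

lemma lincomb_mem_imp:
  assumes c: "\<And>i. c i \<in> carrier R" and kill: "\<And>i k. \<lbrakk>c i \<in> I; k < n\<rbrakk> \<Longrightarrow> c i \<odot>\<^bsub>M\<^esub> e k = \<zero>\<^bsub>M\<^esub>"
  shows "\<lbrakk>k \<le> n; lincomb k c \<in> N j; j \<le> i; i < k\<rbrakk> \<Longrightarrow> c i \<in> I"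
proof (induction k)
  case (Suc k)
  have k: "k < n" "k \<le> n" using Suc.prems(1) by auto
  have cl: "c k \<odot>\<^bsub>M\<^esub> e k \<in> carrier M" "lincomb k c \<in> carrier M"
    using c e_closed[OF k(1)] N_closed[OF k(2) lincomb_mem[OF c k(2)]] by auto
  have "N j \<subseteq> N k" using N_mono[of j k] Suc.prems(3,4) k by simp
  then have "c k \<odot>\<^bsub>M\<^esub> e k \<in> N k"
    using N_cancel[OF k(2) cl(1) lincomb_mem[OF c k(2)]] Suc.prems(2) lincomb_Suc[OF k(1) c] by auto
  then have "c k \<in> I" using smult_e_mem_iff[OF k(1) c] by simp
  moreover from this have "lincomb (Suc k) c = lincomb k c"
    using lincomb_Suc[OF k(1) c] kill[OF _ k(1)] cl by simp
  ultimately show ?case using Suc k by (cases "i = k") auto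
qed simp

text \<open>The terms above \<open>j\<close> are removed one by one through \<open>kill\<close>. The
  previous lemma does not cover this: \<open>a\<close> is an arbitrary ring element, so
  \<open>kill\<close> says nothing about \<open>c j \<ominus> a\<close>.\<close>

lemma lincomb_diagonal:
  assumes c: "\<And>i. c i \<in> carrier R" and kill: "\<And>i k. \<lbrakk>c i \<in> I; k < n\<rbrakk> \<Longrightarrow> c i \<odot>\<^bsub>M\<^esub> e k = \<zero>\<^bsub>M\<^esub>"
    and a: "a \<in> carrier R" and j: "j < n" and mem: "lincomb n c \<ominus>\<^bsub>M\<^esub> a \<odot>\<^bsub>M\<^esub> e j \<in> N j"
  shows "c j \<ominus> a \<in> I"
proof -
  have *: "\<lbrakk>Suc j \<le> k; k \<le> n; lincomb k c \<ominus>\<^bsub>M\<^esub> a \<odot>\<^bsub>M\<^esub> e j \<in> N j\<rbrakk> \<Longrightarrow> c j \<ominus> a \<in> I" for k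
  proof (induction k rule: dec_induct)
    case base
    have ec: "e j \<in> carrier M" "lincomb j c \<in> carrier M" "lincomb j c \<in> N j"
      using e_closed[OF j] N_closed[OF _ lincomb_mem[OF c]] lincomb_mem[OF c] j by simp_all
    have "lincomb (Suc j) c \<ominus>\<^bsub>M\<^esub> a \<odot>\<^bsub>M\<^esub> e j = (c j \<ominus> a) \<odot>\<^bsub>M\<^esub> e j \<oplus>\<^bsub>M\<^esub> lincomb j c"
      unfolding lincomb_Suc[OF j c] a_minus_def using c a ec
      by (simp add: smult_l_distr smult_l_minus M.a_ac)
    then have "(c j \<ominus> a) \<odot>\<^bsub>M\<^esub> e j \<in> N j"
      using N_cancel[OF _ _ ec(3), of "(c j \<ominus> a) \<odot>\<^bsub>M\<^esub> e j"] base c a ec j by simp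
    then show ?case using smult_e_mem_iff[OF j, of "c j \<ominus> a"] c a by simp
  next
    case (step k)
    have k: "k < n" "k \<le> n" using step by auto
    have cl: "c k \<odot>\<^bsub>M\<^esub> e k \<in> carrier M" "lincomb k c \<in> carrier M" "a \<odot>\<^bsub>M\<^esub> e j \<in> carrier M"
      using c a e_closed[OF k(1)] e_closed[OF j] N_closed[OF k(2) lincomb_mem[OF c k(2)]] by auto
    have ej: "a \<odot>\<^bsub>M\<^esub> e j \<in> N k"
      using N_smult[OF k(2) a] e_mem[OF j] N_mono[of "Suc j" k] step.hyps k by auto
    have "lincomb (Suc k) c \<ominus>\<^bsub>M\<^esub> a \<odot>\<^bsub>M\<^esub> e j = c k \<odot>\<^bsub>M\<^esub> e k \<oplus>\<^bsub>M\<^esub> (lincomb k c \<ominus>\<^bsub>M\<^esub> a \<odot>\<^bsub>M\<^esub> e j)"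
      unfolding lincomb_Suc[OF k(1) c] a_minus_def using cl by (simp add: M.a_assoc)
    moreover have "N j \<subseteq> N k" using N_mono[of j k] step.hyps k by simp
    ultimately have "c k \<odot>\<^bsub>M\<^esub> e k \<in> N k"
      using N_cancel[OF k(2) cl(1) N_minus[OF k(2) lincomb_mem[OF c k(2)] ej]] step.prems by auto
    then have "c k \<in> I" using smult_e_mem_iff[OF k(1) c] by simp
    then have "lincomb (Suc k) c = lincomb k c"
      using lincomb_Suc[OF k(1) c] kill[OF _ k(1)] cl by simp
    then show ?case using step k by simp
  qed
  show ?thesis using *[of n] j mem by simp
qed

end

section \<open>Deformed modules, lifted generators and lifted annihilators\<close>

section \<open>Lifting a composition series to a deformation\<close>

lemma (in abelian_monoid) finsum_swap:
  assumes "finite B" "finite C" "\<And>i j. \<lbrakk>i \<in> B; j \<in> C\<rbrakk> \<Longrightarrow> f i j \<in> carrier G"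
  shows "(\<Oplus>i \<in> B. \<Oplus>j \<in> C. f i j) = (\<Oplus>j \<in> C. \<Oplus>i \<in> B. f i j)"
  using assms(1,3)
proof (induction B rule: finite_induct)
  case (insert b B)
  have "(\<Oplus>j \<in> C. \<Oplus>i \<in> insert b B. f i j) = (\<Oplus>j \<in> C. f b j \<oplus> (\<Oplus>i \<in> B. f i j))"
    using insert by (intro finsum_cong' finsum_insert) (auto simp: Pi_def)
  also have "\<dots> = (\<Oplus>j \<in> C. f b j) \<oplus> (\<Oplus>j \<in> C. \<Oplus>i \<in> B. f i j)"
    using insert by (intro finsum_addf) (auto simp: Pi_def)
  also have "\<dots> = (\<Oplus>i \<in> insert b B. \<Oplus>j \<in> C. f i j)"
    using insert by (subst finsum_insert) (auto simp: Pi_def)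
  finally show ?case ..
qed simp

lemma (in abelian_group) minus_eq_zero_iff:
  assumes "x \<in> carrier G" "y \<in> carrier G"
  shows "x \<ominus> y = \<zero> \<longleftrightarrow> x = y"
proof
  assume "x \<ominus> y = \<zero>"
  then have "\<ominus> (\<ominus> y) = x" using assms by (intro minus_equality) (simp_all add: minus_eq)
  then show "x = y" using assms by simp
qed (use assms in \<open>simp add: minus_eq r_neg\<close>)

context left_module
begin

lemma smult_zero_right: "a \<in> carrier R \<Longrightarrow> a \<odot>\<^bsub>M\<^esub> \<zero>\<^bsub>M\<^esub> = \<zero>\<^bsub>M\<^esub>"
  using smult_r_distr[of a "\<zero>\<^bsub>M\<^esub>" "\<zero>\<^bsub>M\<^esub>"] smult_closed[of a "\<zero>\<^bsub>M\<^esub>"] by simp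

lemma smult_zero_left: "x \<in> carrier M \<Longrightarrow> \<zero> \<odot>\<^bsub>M\<^esub> x = \<zero>\<^bsub>M\<^esub>"
  using smult_l_distr[of \<zero> \<zero> x] smult_closed[of \<zero> x] by simp

lemma smult_neg_left:
  assumes "a \<in> carrier R" "x \<in> carrier M"
  shows "(\<ominus> a) \<odot>\<^bsub>M\<^esub> x = \<ominus>\<^bsub>M\<^esub> (a \<odot>\<^bsub>M\<^esub> x)"
  using smult_l_distr[of "\<ominus> a" a x] assms
  by (intro M.minus_equality[symmetric]) (simp_all add: smult_closed R.l_neg smult_zero_left)

lemma smult_neg_right:
  assumes "a \<in> carrier R" "x \<in> carrier M"
  shows "a \<odot>\<^bsub>M\<^esub> (\<ominus>\<^bsub>M\<^esub> x) = \<ominus>\<^bsub>M\<^esub> (a \<odot>\<^bsub>M\<^esub> x)"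
  using smult_r_distr[of a "\<ominus>\<^bsub>M\<^esub> x" x] assms
  by (intro M.minus_equality[symmetric]) (simp_all add: smult_closed M.l_neg smult_zero_right)

lemma smult_minus_left:
  assumes "a \<in> carrier R" "b \<in> carrier R" "x \<in> carrier M"
  shows "(a \<ominus> b) \<odot>\<^bsub>M\<^esub> x = a \<odot>\<^bsub>M\<^esub> x \<ominus>\<^bsub>M\<^esub> b \<odot>\<^bsub>M\<^esub> x"
  unfolding a_minus_def using assms by (simp add: smult_l_distr smult_neg_left)

lemma smult_minus_right:
  assumes "a \<in> carrier R" "x \<in> carrier M" "y \<in> carrier M"
  shows "a \<odot>\<^bsub>M\<^esub> (x \<ominus>\<^bsub>M\<^esub> y) = a \<odot>\<^bsub>M\<^esub> x \<ominus>\<^bsub>M\<^esub> a \<odot>\<^bsub>M\<^esub> y"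
  unfolding a_minus_def using assms by (simp add: smult_r_distr smult_neg_right)

lemma smult_finsum:
  assumes "a \<in> carrier R"
  shows "\<lbrakk>finite B; f \<in> B \<rightarrow> carrier M\<rbrakk> \<Longrightarrow>
    a \<odot>\<^bsub>M\<^esub> (\<Oplus>\<^bsub>M\<^esub> i \<in> B. f i) = (\<Oplus>\<^bsub>M\<^esub> i \<in> B. a \<odot>\<^bsub>M\<^esub> f i)"
  by (induction B rule: finite_induct)
    (use assms in \<open>simp_all add: Pi_def smult_zero_right smult_r_distr smult_closed\<close>)

lemma finsum_smult:
  assumes "x \<in> carrier M"
  shows "\<lbrakk>finite B; f \<in> B \<rightarrow> carrier R\<rbrakk> \<Longrightarrow>
    (\<Oplus>i \<in> B. f i) \<odot>\<^bsub>M\<^esub> x = (\<Oplus>\<^bsub>M\<^esub> i \<in> B. f i \<odot>\<^bsub>M\<^esub> x)"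
  by (induction B rule: finite_induct)
    (use assms in \<open>simp_all add: Pi_def smult_zero_left smult_l_distr smult_closed\<close>)

end

section \<open>First-order calculus with \<open>h\<close> in \<open>M'\<close>\<close>

context first_order_module_deformation
begin

lemma h_smult_commute:
  assumes "x \<in> carrier A'" "u \<in> carrier M'"
  shows "x \<odot>\<^bsub>M'\<^esub> (h \<odot>\<^bsub>M'\<^esub> u) = h \<odot>\<^bsub>M'\<^esub> (x \<odot>\<^bsub>M'\<^esub> u)"
  using assms h_closed h_central by (simp add: M'.smult_assoc[symmetric])

lemma h_h_smult: "u \<in> carrier M' \<Longrightarrow> h \<odot>\<^bsub>M'\<^esub> (h \<odot>\<^bsub>M'\<^esub> u) = \<zero>\<^bsub>M'\<^esub>"
  using Ann_module_h by blast

lemma h_smult_eq_zero_iff: "u \<in> carrier M' \<Longrightarrow> h \<odot>\<^bsub>M'\<^esub> u = \<zero>\<^bsub>M'\<^esub> \<longleftrightarrow> \<psi> u = \<zero>\<^bsub>M\<^esub>"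
  using Ann_module_h proj_module_kernel unfolding a_kernel_def' by blast

lemma psi_minus:
  assumes "u \<in> carrier M'" "v \<in> carrier M'"
  shows "\<psi> (u \<ominus>\<^bsub>M'\<^esub> v) = \<psi> u \<ominus>\<^bsub>M\<^esub> \<psi> v"
proof -
  have "\<psi> (\<ominus>\<^bsub>M'\<^esub> v) = \<ominus>\<^bsub>M\<^esub> \<psi> v"
    using assms(2) hom_add[of "\<ominus>\<^bsub>M'\<^esub> v" v]
    by (intro M.M.minus_equality[symmetric]) (simp_all add: M'.M.l_neg)
  then show ?thesis unfolding a_minus_def using assms by simp
qed

text \<open>Multiplication by \<open>h\<close> identifies \<open>M\<close> with \<open>hM'\<close>,
  so an identity of order \<open>h\<close> can be read in \<open>M\<close>.\<close>

lemma h_smult_eq_iff: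
  assumes "u \<in> carrier M'" "v \<in> carrier M'"
  shows "h \<odot>\<^bsub>M'\<^esub> u = h \<odot>\<^bsub>M'\<^esub> v \<longleftrightarrow> \<psi> u = \<psi> v"
proof -
  have "h \<odot>\<^bsub>M'\<^esub> u = h \<odot>\<^bsub>M'\<^esub> v \<longleftrightarrow> h \<odot>\<^bsub>M'\<^esub> (u \<ominus>\<^bsub>M'\<^esub> v) = \<zero>\<^bsub>M'\<^esub>"
    using assms h_closed by (simp add: M'.smult_minus_right M'.smult_closed M'.M.minus_eq_zero_iff)
  also have "\<dots> \<longleftrightarrow> \<psi> u \<ominus>\<^bsub>M\<^esub> \<psi> v = \<zero>\<^bsub>M\<^esub>"
    using h_smult_eq_zero_iff[of "u \<ominus>\<^bsub>M'\<^esub> v"] assms psi_minus[OF assms] by simp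
  also have "\<dots> \<longleftrightarrow> \<psi> u = \<psi> v"
    using assms by (simp add: M.M.minus_eq_zero_iff)
  finally show ?thesis .
qed

lemma psi_h_smult: "u \<in> carrier M' \<Longrightarrow> \<psi> (h \<odot>\<^bsub>M'\<^esub> u) = \<zero>\<^bsub>M\<^esub>"
  using h_smult_eq_zero_iff[of "h \<odot>\<^bsub>M'\<^esub> u"] h_h_smult M'.smult_closed[OF h_closed] by blast

lemma psi_eq_zeroE:
  assumes "u \<in> carrier M'" "\<psi> u = \<zero>\<^bsub>M\<^esub>"
  obtains v where "v \<in> carrier M'" "u = h \<odot>\<^bsub>M'\<^esub> v"
  using assms proj_module_kernel unfolding a_kernel_def' by blast

lemma psi_eqE:
  assumes "u \<in> carrier M'" "v \<in> carrier M'" "\<psi> u = \<psi> v"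
  obtains w where "w \<in> carrier M'" "u = v \<oplus>\<^bsub>M'\<^esub> h \<odot>\<^bsub>M'\<^esub> w"
proof -
  have "\<psi> (u \<ominus>\<^bsub>M'\<^esub> v) = \<zero>\<^bsub>M\<^esub>"
    using psi_minus[OF assms(1,2)] assms by (simp add: M.M.minus_eq_zero_iff)
  then obtain w where w: "w \<in> carrier M'" "u \<ominus>\<^bsub>M'\<^esub> v = h \<odot>\<^bsub>M'\<^esub> w"
    using psi_eq_zeroE[of "u \<ominus>\<^bsub>M'\<^esub> v"] assms by blast
  have "u = v \<oplus>\<^bsub>M'\<^esub> (u \<ominus>\<^bsub>M'\<^esub> v)"
    using assms(1,2) by (simp add: a_minus_def M'.M.a_ac M'.M.r_neg)
  then show ?thesis using that w by simp
qed

lemma pi_eqE: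
  assumes "x \<in> carrier A'" "y \<in> carrier A'" "\<pi> x = \<pi> y"
  obtains w where "w \<in> carrier A'" "x = y \<oplus> h \<otimes> w"
proof -
  obtain w where w: "w \<in> carrier A'" "x \<ominus> y = h \<otimes> w" by (rule proj_eqE[OF assms])
  have "x = y \<oplus> (x \<ominus> y)"
    using assms(1,2) by (simp add: a_minus_def R.a_ac R.r_neg)
  then show ?thesis using that w by simp
qed

end

locale deformed_composition_series =
  first_order_module_deformation A' A \<pi> h M' M \<psi> + CS: composition_series A M I N e n
  for A' :: "('b, 's) ring_scheme" (structure) and A :: "('a, 'r) ring_scheme" and \<pi> and h
    and M' :: "('b, 'd, 'u) module_scheme" and M :: "('a, 'c, 't) module_scheme" and \<psi>
    and I and N and e and n +
  fixes e' :: "nat \<Rightarrow> 'd"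
  assumes I_ideal: "ideal I A"
    and e'_closed: "i < n \<Longrightarrow> e' i \<in> carrier M'"
    and psi_e': "i < n \<Longrightarrow> \<psi> (e' i) = e i"
begin

text \<open>The copy of \<open>N j\<close> inside \<open>hM'\<close> under the identification of
  \<open>hM'\<close> with \<open>M\<close>.\<close>

definition hN :: "nat \<Rightarrow> 'd set" where
  "hN j = {h \<odot>\<^bsub>M'\<^esub> u |u. u \<in> carrier M' \<and> \<psi> u \<in> N j}"

lemma hN_I: "\<lbrakk>u \<in> carrier M'; \<psi> u \<in> N j\<rbrakk> \<Longrightarrow> h \<odot>\<^bsub>M'\<^esub> u \<in> hN j"
  unfolding hN_def by blast

lemma hN_E:
  assumes "v \<in> hN j"
  obtains u where "u \<in> carrier M'" "\<psi> u \<in> N j" "v = h \<odot>\<^bsub>M'\<^esub> u"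
  using assms unfolding hN_def by blast

lemma hN_mono: "\<lbrakk>i \<le> j; j \<le> n\<rbrakk> \<Longrightarrow> hN i \<subseteq> hN j"
  unfolding hN_def using CS.N_mono by blast

lemma hN_zero: "j \<le> n \<Longrightarrow> \<zero>\<^bsub>M'\<^esub> \<in> hN j"
  using hN_I[of "\<zero>\<^bsub>M'\<^esub>" j] CS.N_zero[of j] by (simp add: M'.smult_zero_right[OF h_closed])

lemma hN_add:
  assumes "j \<le> n" "u \<in> hN j" "v \<in> hN j"
  shows "u \<oplus>\<^bsub>M'\<^esub> v \<in> hN j"
proof -
  obtain u' v' where u: "u' \<in> carrier M'" "\<psi> u' \<in> N j" "u = h \<odot>\<^bsub>M'\<^esub> u'"
    and v: "v' \<in> carrier M'" "\<psi> v' \<in> N j" "v = h \<odot>\<^bsub>M'\<^esub> v'"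
    using assms(2,3) by (auto elim!: hN_E)
  have "h \<odot>\<^bsub>M'\<^esub> (u' \<oplus>\<^bsub>M'\<^esub> v') \<in> hN j"
    using u v CS.N_add[OF assms(1)] by (intro hN_I) simp_all
  then show ?thesis using u v h_closed by (simp add: M'.smult_r_distr)
qed

lemma hN_smult:
  assumes "j \<le> n" "x \<in> carrier A'" "v \<in> hN j"
  shows "x \<odot>\<^bsub>M'\<^esub> v \<in> hN j"
proof -
  obtain u where u: "u \<in> carrier M'" "\<psi> u \<in> N j" "v = h \<odot>\<^bsub>M'\<^esub> u"
    using assms(3) by (rule hN_E)
  have "h \<odot>\<^bsub>M'\<^esub> (x \<odot>\<^bsub>M'\<^esub> u) \<in> hN j"
    using u assms CS.N_smult[OF assms(1)] by (intro hN_I) (simp_all add: M'.smult_closed proj_smult)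
  then show ?thesis using u assms by (simp add: h_smult_commute)
qed

lemma hN_finsum:
  assumes "j \<le> n"
  shows "\<lbrakk>finite B; \<And>i. i \<in> B \<Longrightarrow> f i \<in> hN j\<rbrakk> \<Longrightarrow> (\<Oplus>\<^bsub>M'\<^esub> i \<in> B. f i) \<in> hN j"
proof (induction B rule: finite_induct)
  case (insert b B)
  have "v \<in> carrier M'" if "v \<in> hN j" for v
    using that by (auto elim!: hN_E intro: M'.smult_closed h_closed)
  then show ?case using insert hN_add[OF assms] by (subst M'.M.finsum_insert) auto
qed (use hN_zero[OF assms] in simp)

text \<open>The choice of lift does not matter: two lifts differ by a multiple of \<open>h\<close>,
  which sends \<open>e' i\<close> into \<open>hN (Suc i)\<close> anyway. The bound
  \<open>Suc i\<close> is loose enough for this and tight enough that coefficients with index below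
  \<open>j\<close> stay inside \<open>hN j\<close>. It is a set in \<open>A\<close>, so that it can
  serve as a target of the refinement.\<close>

definition lifted_annihilator :: "'a set" where
  "lifted_annihilator = {a \<in> carrier A. \<forall>i < n. \<exists>z \<in> carrier A'. \<pi> z = a \<and> z \<odot>\<^bsub>M'\<^esub> e' i \<in> hN (Suc i)}"

lemma h_smult_e'_mem: "\<lbrakk>i < n; w \<in> carrier A'\<rbrakk> \<Longrightarrow> (h \<otimes> w) \<odot>\<^bsub>M'\<^esub> e' i \<in> hN (Suc i)"
  using hN_I[of "w \<odot>\<^bsub>M'\<^esub> e' i" "Suc i"] CS.N_smult[of "Suc i" "\<pi> w" "e i"] CS.e_mem[of i]
    e'_closed psi_e' h_closed
  by (simp add: M'.smult_assoc M'.smult_closed proj_smult)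

lemma lifted_annihilatorD:
  assumes "z \<in> carrier A'" "\<pi> z \<in> lifted_annihilator" "i < n"
  shows "z \<odot>\<^bsub>M'\<^esub> e' i \<in> hN (Suc i)"
proof -
  obtain y where y: "y \<in> carrier A'" "\<pi> y = \<pi> z" "y \<odot>\<^bsub>M'\<^esub> e' i \<in> hN (Suc i)"
    using assms unfolding lifted_annihilator_def by blast
  obtain w where w: "w \<in> carrier A'" "z = y \<oplus> h \<otimes> w"
    using pi_eqE[OF assms(1) y(1)] y(2) by metis
  have "z \<odot>\<^bsub>M'\<^esub> e' i = y \<odot>\<^bsub>M'\<^esub> e' i \<oplus>\<^bsub>M'\<^esub> (h \<otimes> w) \<odot>\<^bsub>M'\<^esub> e' i"
    unfolding w(2) using w(1) y(1) h_closed e'_closed[OF assms(3)] by (simp add: M'.smult_l_distr)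
  then show ?thesis using hN_add[OF _ y(3) h_smult_e'_mem[OF assms(3) w(1)]] assms(3) by simp
qed

lemma lifted_annihilator_ideal: "ideal lifted_annihilator A"
proof (rule idealI)
  have closed: "v \<in> carrier M'" if "v \<in> hN j" for v j
    using that by (auto elim!: hN_E intro: M'.smult_closed h_closed)
  have LI: "a \<in> lifted_annihilator"
    if "z \<in> carrier A'" "\<pi> z = a" "\<And>i. i < n \<Longrightarrow> z \<odot>\<^bsub>M'\<^esub> e' i \<in> hN (Suc i)" for a z
    using that unfolding lifted_annihilator_def by auto
  have lift: "\<exists>z \<in> carrier A'. \<pi> z = a" if "a \<in> carrier A" for a
    using that unfolding proj_surj[symmetric] by auto
  have Lc: "a \<in> carrier A" if "a \<in> lifted_annihilator" for a
    using that unfolding lifted_annihilator_def by blast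
  \<comment> \<open>Only multiplication from the left works directly: a lift of \<open>x\<close>
    preserves every \<open>hN j\<close>, whereas \<open>z\<close> is controlled on the
    \<open>e' i\<close> alone. Commutativity of \<open>A\<close> gives the other side.\<close>
  have smult: "x \<otimes>\<^bsub>A\<^esub> a \<in> lifted_annihilator" if a: "a \<in> lifted_annihilator" and x: "x \<in> carrier A" for a x
  proof -
    obtain y z where y: "y \<in> carrier A'" "\<pi> y = x" and z: "z \<in> carrier A'" "\<pi> z = a"
      using lift[OF x] lift[OF Lc[OF a]] by blast
    have "(y \<otimes> z) \<odot>\<^bsub>M'\<^esub> e' i \<in> hN (Suc i)" if "i < n" for i
      using hN_smult[OF _ y(1) lifted_annihilatorD[OF z(1) _ that]] a z y e'_closed[OF that] that
      by (simp add: M'.smult_assoc)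
    then show ?thesis using y z by (intro LI[of "y \<otimes> z"]) simp_all
  qed
  show "ring A" ..
  show "subgroup lifted_annihilator (add_monoid A)"
  proof (rule S.add.subgroupI)
    show "lifted_annihilator \<subseteq> carrier A" using Lc by blast
    have "\<zero>\<^bsub>A\<^esub> \<in> lifted_annihilator"
      using hN_zero e'_closed by (intro LI[of \<zero>]) (simp_all add: M'.smult_zero_left)
    then show "lifted_annihilator \<noteq> {}" by blast
    show "\<ominus>\<^bsub>A\<^esub> a \<in> lifted_annihilator" if "a \<in> lifted_annihilator" for a
      using smult[OF that, of "\<ominus>\<^bsub>A\<^esub> \<one>\<^bsub>A\<^esub>"] Lc[OF that] by (simp add: S.l_minus)
    show "a \<oplus>\<^bsub>A\<^esub> b \<in> lifted_annihilator" if ab: "a \<in> lifted_annihilator" "b \<in> lifted_annihilator" for a b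
    proof -
      obtain y z where y: "y \<in> carrier A'" "\<pi> y = a" and z: "z \<in> carrier A'" "\<pi> z = b"
        using lift[OF Lc[OF ab(1)]] lift[OF Lc[OF ab(2)]] by blast
      have "(y \<oplus> z) \<odot>\<^bsub>M'\<^esub> e' i \<in> hN (Suc i)" if "i < n" for i
        using hN_add[OF _ lifted_annihilatorD[OF y(1) _ that] lifted_annihilatorD[OF z(1) _ that]]
          ab z y e'_closed[OF that] that
        by (simp add: M'.smult_l_distr)
      then show ?thesis using y z by (intro LI[of "y \<oplus> z"]) simp_all
    qed
  qed
  fix a x assume a: "a \<in> lifted_annihilator" and x: "x \<in> carrier A"
  show "x \<otimes>\<^bsub>A\<^esub> a \<in> lifted_annihilator" by (rule smult[OF a x])
  then show "a \<otimes>\<^bsub>A\<^esub> x \<in> lifted_annihilator" using CS.R.m_comm[OF Lc[OF a] x] by simp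
qed

text \<open>A lift \<open>z\<close> maps \<open>M'\<close> into \<open>hM'\<close> and commutes with
  \<open>h\<close>, so \<open>z \<otimes> z\<close> maps \<open>M'\<close> into
  \<open>h (hM')\<close>, which is zero.\<close>

lemma square_mem_lifted_annihilator:
  assumes a: "a \<in> carrier A" "\<And>v. v \<in> carrier M \<Longrightarrow> a \<odot>\<^bsub>M\<^esub> v = \<zero>\<^bsub>M\<^esub>"
  shows "a \<otimes>\<^bsub>A\<^esub> a \<in> lifted_annihilator"
proof -
  obtain z where z: "z \<in> carrier A'" "\<pi> z = a"
    using a(1) unfolding proj_surj[symmetric] by auto
  have z0: "\<exists>v \<in> carrier M'. z \<odot>\<^bsub>M'\<^esub> u = h \<odot>\<^bsub>M'\<^esub> v" if u: "u \<in> carrier M'" for u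
  proof -
    have "\<psi> (z \<odot>\<^bsub>M'\<^esub> u) = \<zero>\<^bsub>M\<^esub>" using proj_smult[OF z(1) u] a(2) z(2) u by simp
    then show ?thesis using psi_eq_zeroE[OF M'.smult_closed[OF z(1) u]] by metis
  qed
  have "(z \<otimes> z) \<odot>\<^bsub>M'\<^esub> u = \<zero>\<^bsub>M'\<^esub>" if u: "u \<in> carrier M'" for u
  proof -
    obtain v where v: "v \<in> carrier M'" "z \<odot>\<^bsub>M'\<^esub> u = h \<odot>\<^bsub>M'\<^esub> v" using z0[OF u] by blast
    obtain w where w: "w \<in> carrier M'" "z \<odot>\<^bsub>M'\<^esub> v = h \<odot>\<^bsub>M'\<^esub> w" using z0[OF v(1)] by blast
    have "(z \<otimes> z) \<odot>\<^bsub>M'\<^esub> u = h \<odot>\<^bsub>M'\<^esub> (z \<odot>\<^bsub>M'\<^esub> v)"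
      using M'.smult_assoc[OF z(1) z(1) u] v h_smult_commute[OF z(1) v(1)] by simp
    then show ?thesis using w h_h_smult by simp
  qed
  then show ?thesis
    unfolding lifted_annihilator_def using z a hN_zero e'_closed
    by (auto intro!: bexI[of _ "z \<otimes> z"])
qed

end

section \<open>Matrices of \<open>x\<close> and \<open>y\<close> to first order in \<open>h\<close>,
  and the trace of their commutator\<close>

section \<open>Traces of commutators\<close>

lemma (in cring) add_difference:
  "\<lbrakk>a \<in> carrier R; b \<in> carrier R; c \<in> carrier R\<rbrakk> \<Longrightarrow> b = a \<oplus> (c \<oplus> (b \<ominus> a \<ominus> c))"
  by algebra

lemma (in abelian_group) minus_sum_right:
  assumes "x \<in> carrier G" "y \<in> carrier G" "z \<in> carrier G"
  shows "z \<ominus> (x \<oplus> (y \<oplus> z)) = \<ominus> (x \<oplus> y)"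
proof -
  have "x \<oplus> (y \<oplus> z) = z \<oplus> (x \<oplus> y)" using assms by (simp add: a_ac)
  then show ?thesis
    using assms minus_add[of z "x \<oplus> y"] by (simp add: minus_eq a_assoc[symmetric] r_neg)
qed

context deformed_composition_series
begin

definition lcomb :: "(nat \<Rightarrow> 'b) \<Rightarrow> 'd" where
  "lcomb c = (\<Oplus>\<^bsub>M'\<^esub> i \<in> {..<n}. c i \<odot>\<^bsub>M'\<^esub> e' i)"

lemma lcomb_closed: "(\<And>i. c i \<in> carrier A') \<Longrightarrow> lcomb c \<in> carrier M'"
  unfolding lcomb_def using e'_closed by (intro M'.M.finsum_closed) (auto intro: M'.smult_closed)

lemma lcomb_add:
  assumes "\<And>i. c i \<in> carrier A'" "\<And>i. d i \<in> carrier A'"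
  shows "lcomb (\<lambda>i. c i \<oplus> d i) = lcomb c \<oplus>\<^bsub>M'\<^esub> lcomb d"
proof -
  have "lcomb (\<lambda>i. c i \<oplus> d i) = (\<Oplus>\<^bsub>M'\<^esub> i \<in> {..<n}. c i \<odot>\<^bsub>M'\<^esub> e' i \<oplus>\<^bsub>M'\<^esub> d i \<odot>\<^bsub>M'\<^esub> e' i)"
    unfolding lcomb_def using assms e'_closed
    by (intro M'.M.finsum_cong') (auto simp: M'.smult_l_distr intro!: M'.smult_closed)
  also have "\<dots> = lcomb c \<oplus>\<^bsub>M'\<^esub> lcomb d"
    unfolding lcomb_def using assms e'_closed
    by (intro M'.M.finsum_addf) (auto intro!: M'.smult_closed)
  finally show ?thesis .
qed

lemma smult_lcomb:
  assumes "x \<in> carrier A'" "\<And>i. c i \<in> carrier A'"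
  shows "x \<odot>\<^bsub>M'\<^esub> lcomb c = lcomb (\<lambda>i. x \<otimes> c i)"
proof -
  have "x \<odot>\<^bsub>M'\<^esub> lcomb c = (\<Oplus>\<^bsub>M'\<^esub> i \<in> {..<n}. x \<odot>\<^bsub>M'\<^esub> (c i \<odot>\<^bsub>M'\<^esub> e' i))"
    unfolding lcomb_def using assms e'_closed
    by (intro M'.smult_finsum) (auto intro!: M'.smult_closed)
  also have "\<dots> = lcomb (\<lambda>i. x \<otimes> c i)"
    unfolding lcomb_def using assms e'_closed
    by (intro M'.M.finsum_cong') (auto simp: M'.smult_assoc intro!: M'.smult_closed)
  finally show ?thesis .
qed

lemma lcomb_minus:
  assumes "\<And>i. c i \<in> carrier A'" "\<And>i. d i \<in> carrier A'"
  shows "lcomb (\<lambda>i. c i \<ominus> d i) = lcomb c \<ominus>\<^bsub>M'\<^esub> lcomb d"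
proof -
  have "lcomb (\<lambda>i. \<ominus> d i) = lcomb (\<lambda>i. (\<ominus> \<one>) \<otimes> d i)"
    using assms by (simp add: R.l_minus)
  also have "\<dots> = \<ominus>\<^bsub>M'\<^esub> lcomb d"
    using assms smult_lcomb[of "\<ominus> \<one>" d] lcomb_closed[of d]
    by (simp add: M'.smult_neg_left M'.smult_one)
  finally show ?thesis
    using assms lcomb_add[of c "\<lambda>i. \<ominus> d i"] by (simp add: a_minus_def)
qed

lemma psi_lcomb:
  assumes "\<And>i. c i \<in> carrier A'"
  shows "\<psi> (lcomb c) = CS.lincomb n (\<lambda>i. \<pi> (c i))"
proof -
  have "B \<subseteq> {..<n} \<Longrightarrow> \<psi> (\<Oplus>\<^bsub>M'\<^esub> i \<in> B. c i \<odot>\<^bsub>M'\<^esub> e' i) = (\<Oplus>\<^bsub>M\<^esub> i \<in> B. \<pi> (c i) \<odot>\<^bsub>M\<^esub> e i)" if "finite B" for B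
    using that
  proof (induction B rule: finite_induct)
    case (insert b B)
    have 1: "c i \<odot>\<^bsub>M'\<^esub> e' i \<in> carrier M'" "\<pi> (c i) \<odot>\<^bsub>M\<^esub> e i \<in> carrier M"
        "\<psi> (c i \<odot>\<^bsub>M'\<^esub> e' i) = \<pi> (c i) \<odot>\<^bsub>M\<^esub> e i" if "i \<in> insert b B" for i
      using that insert.prems assms e'_closed CS.e_closed psi_e'
      by (auto simp: proj_smult subset_iff intro!: M'.smult_closed M.smult_closed)
    have "(\<Oplus>\<^bsub>M'\<^esub> i \<in> insert b B. c i \<odot>\<^bsub>M'\<^esub> e' i) =
        c b \<odot>\<^bsub>M'\<^esub> e' b \<oplus>\<^bsub>M'\<^esub> (\<Oplus>\<^bsub>M'\<^esub> i \<in> B. c i \<odot>\<^bsub>M'\<^esub> e' i)"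
      using insert.hyps 1(1) by (intro M'.M.finsum_insert) auto
    moreover have "(\<Oplus>\<^bsub>M\<^esub> i \<in> insert b B. \<pi> (c i) \<odot>\<^bsub>M\<^esub> e i) =
        \<pi> (c b) \<odot>\<^bsub>M\<^esub> e b \<oplus>\<^bsub>M\<^esub> (\<Oplus>\<^bsub>M\<^esub> i \<in> B. \<pi> (c i) \<odot>\<^bsub>M\<^esub> e i)"
      using insert.hyps 1(2) by (intro M.M.finsum_insert) auto
    moreover have "(\<Oplus>\<^bsub>M'\<^esub> i \<in> B. c i \<odot>\<^bsub>M'\<^esub> e' i) \<in> carrier M'"
      using 1(1) by (intro M'.M.finsum_closed) auto
    ultimately show ?case using insert 1 by simp
  qed simp
  then show ?thesis unfolding lcomb_def CS.lincomb_def by simp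
qed

text \<open>Below a factor \<open>h\<close> the coefficients behave as elements of \<open>A\<close>;
  in particular they may be commuted.\<close>

lemma h_smult_lcomb_cong:
  assumes "\<And>i. c i \<in> carrier A'" "\<And>i. d i \<in> carrier A'" "\<And>i. \<pi> (c i) = \<pi> (d i)"
  shows "h \<odot>\<^bsub>M'\<^esub> lcomb c = h \<odot>\<^bsub>M'\<^esub> lcomb d"
  using assms by (simp add: h_smult_eq_iff lcomb_closed psi_lcomb)

lemma finsum_smult_lcomb:
  assumes "\<And>i. c i \<in> carrier A'" "\<And>i k. d i k \<in> carrier A'"
  shows "(\<Oplus>\<^bsub>M'\<^esub> i \<in> {..<n}. c i \<odot>\<^bsub>M'\<^esub> lcomb (d i)) = lcomb (\<lambda>k. \<Oplus>i \<in> {..<n}. c i \<otimes> d i k)"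
proof -
  have "(\<Oplus>\<^bsub>M'\<^esub> i \<in> {..<n}. c i \<odot>\<^bsub>M'\<^esub> lcomb (d i)) =
      (\<Oplus>\<^bsub>M'\<^esub> i \<in> {..<n}. \<Oplus>\<^bsub>M'\<^esub> k \<in> {..<n}. (c i \<otimes> d i k) \<odot>\<^bsub>M'\<^esub> e' k)"
    unfolding smult_lcomb[OF assms(1,2)] lcomb_def[of "\<lambda>k. c i \<otimes> d i k" for i] ..
  also have "\<dots> = (\<Oplus>\<^bsub>M'\<^esub> k \<in> {..<n}. \<Oplus>\<^bsub>M'\<^esub> i \<in> {..<n}. (c i \<otimes> d i k) \<odot>\<^bsub>M'\<^esub> e' k)"
    using assms e'_closed by (intro M'.M.finsum_swap) (auto intro!: M'.smult_closed)
  also have "\<dots> = lcomb (\<lambda>k. \<Oplus>i \<in> {..<n}. c i \<otimes> d i k)"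
    unfolding lcomb_def using assms e'_closed
    by (intro M'.M.finsum_cong')
      (auto simp: M'.finsum_smult Pi_def intro!: M'.smult_closed M'.M.finsum_closed R.finsum_closed)
  finally show ?thesis .
qed

text \<open>The row \<open>c\<close> is multiplied by both matrices of \<open>y\<close>. As
  \<open>y\<close> stands to the right of the coefficients, it meets \<open>e' i\<close> directly
  and no commutator arises.\<close>

lemma lcomb_smult_expand:
  assumes c: "\<And>i. c i \<in> carrier A'" and y: "y \<in> carrier A'"
    and ym: "\<And>i k. ym i k \<in> carrier A'" and yh: "\<And>i k. yh i k \<in> carrier A'"
    and expand: "\<And>i. i < n \<Longrightarrow> y \<odot>\<^bsub>M'\<^esub> e' i = lcomb (ym i) \<oplus>\<^bsub>M'\<^esub> h \<odot>\<^bsub>M'\<^esub> lcomb (yh i)"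
  shows "lcomb (\<lambda>i. c i \<otimes> y) = lcomb (\<lambda>k. \<Oplus>i \<in> {..<n}. c i \<otimes> ym i k) \<oplus>\<^bsub>M'\<^esub>
    h \<odot>\<^bsub>M'\<^esub> lcomb (\<lambda>k. \<Oplus>i \<in> {..<n}. c i \<otimes> yh i k)"
proof -
  note closed = M'.smult_closed lcomb_closed c y ym yh h_closed e'_closed
  have "lcomb (\<lambda>i. c i \<otimes> y) =
      (\<Oplus>\<^bsub>M'\<^esub> i \<in> {..<n}. c i \<odot>\<^bsub>M'\<^esub> lcomb (ym i) \<oplus>\<^bsub>M'\<^esub> h \<odot>\<^bsub>M'\<^esub> (c i \<odot>\<^bsub>M'\<^esub> lcomb (yh i)))"
    unfolding lcomb_def[of "\<lambda>i. c i \<otimes> y"]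
    by (intro M'.M.finsum_cong')
      (auto simp: M'.smult_assoc expand M'.smult_r_distr h_smult_commute closed)
  also have "\<dots> = (\<Oplus>\<^bsub>M'\<^esub> i \<in> {..<n}. c i \<odot>\<^bsub>M'\<^esub> lcomb (ym i)) \<oplus>\<^bsub>M'\<^esub>
      (\<Oplus>\<^bsub>M'\<^esub> i \<in> {..<n}. h \<odot>\<^bsub>M'\<^esub> (c i \<odot>\<^bsub>M'\<^esub> lcomb (yh i)))"
    by (intro M'.M.finsum_addf) (auto simp: closed)
  also have "(\<Oplus>\<^bsub>M'\<^esub> i \<in> {..<n}. h \<odot>\<^bsub>M'\<^esub> (c i \<odot>\<^bsub>M'\<^esub> lcomb (yh i))) =
      h \<odot>\<^bsub>M'\<^esub> (\<Oplus>\<^bsub>M'\<^esub> i \<in> {..<n}. c i \<odot>\<^bsub>M'\<^esub> lcomb (yh i))"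
    by (intro M'.smult_finsum[symmetric]) (auto simp: closed)
  finally show ?thesis by (simp add: finsum_smult_lcomb c ym yh)
qed

lemma lcomb_mem_hN:
  assumes "j \<le> n" "\<And>i. i < n \<Longrightarrow> c i \<odot>\<^bsub>M'\<^esub> e' i \<in> hN j"
  shows "lcomb c \<in> hN j"
  unfolding lcomb_def using assms by (intro hN_finsum) auto

text \<open>
  Modulo \<open>h\<close> the matrices of \<open>x\<close> and \<open>y\<close> are \<open>xm\<close> and \<open>ym\<close> (transposed), with \<open>xh\<close> and \<open>yh\<close> the
  corrections of order \<open>h\<close>. The error \<open>w\<close> comes from commuting \<open>y\<close> past the entries of \<open>xm\<close>.
\<close>

lemma smult_smult_e':
  assumes x: "x \<in> carrier A'" and y: "y \<in> carrier A'" and j: "j < n"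
    and xm: "\<And>i k. xm i k \<in> carrier A'" and xh: "\<And>i k. xh i k \<in> carrier A'"
    and ym: "\<And>i k. ym i k \<in> carrier A'" and yh: "\<And>i k. yh i k \<in> carrier A'"
    and triangular: "\<And>i. j \<le> i \<Longrightarrow> xm j i = \<zero>"
    and expand_x: "x \<odot>\<^bsub>M'\<^esub> e' j = lcomb (xm j) \<oplus>\<^bsub>M'\<^esub> h \<odot>\<^bsub>M'\<^esub> lcomb (xh j)"
    and expand_y: "\<And>i. i < n \<Longrightarrow> y \<odot>\<^bsub>M'\<^esub> e' i = lcomb (ym i) \<oplus>\<^bsub>M'\<^esub> h \<odot>\<^bsub>M'\<^esub> lcomb (yh i)"
  shows "\<exists>w. (\<forall>i. w i \<in> carrier A') \<and> (\<forall>i \<ge> j. w i = \<zero>) \<and>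
    y \<odot>\<^bsub>M'\<^esub> (x \<odot>\<^bsub>M'\<^esub> e' j) = lcomb (\<lambda>k. \<Oplus>i \<in> {..<n}. xm j i \<otimes> ym i k) \<oplus>\<^bsub>M'\<^esub>
      h \<odot>\<^bsub>M'\<^esub> lcomb (\<lambda>k. w k \<oplus> ((\<Oplus>i \<in> {..<n}. xm j i \<otimes> yh i k) \<oplus> (\<Oplus>i \<in> {..<n}. xh j i \<otimes> ym i k)))"
proof -
  note closed = M'.smult_closed lcomb_closed x y xm xh ym yh h_closed e'_closed R.finsum_closed
  \<comment> \<open>\<open>w\<close> records the commutator of \<open>y\<close> with an entry of
    \<open>xm\<close>, a multiple of \<open>h\<close> because \<open>A\<close> is commutative. From
    the diagonal on the entries are zero and \<open>w\<close> is chosen zero, so the error never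
    touches the diagonal.\<close>
  have "\<exists>w. w \<in> carrier A' \<and> (j \<le> i \<longrightarrow> w = \<zero>) \<and> y \<otimes> xm j i = xm j i \<otimes> y \<oplus> h \<otimes> w" for i
  proof (cases "j \<le> i")
    case True
    then show ?thesis using triangular y h_closed by (intro exI[of _ \<zero>]) simp
  next
    case False
    have "\<pi> (y \<otimes> xm j i) = \<pi> (xm j i \<otimes> y)" using xm y CS.R.m_comm by simp
    then obtain w where "w \<in> carrier A'" "y \<otimes> xm j i = xm j i \<otimes> y \<oplus> h \<otimes> w"
      using pi_eqE[of "y \<otimes> xm j i" "xm j i \<otimes> y"] xm y by auto
    with False show ?thesis by auto
  qed
  then obtain w where w: "\<And>i. w i \<in> carrier A'" "\<And>i. j \<le> i \<Longrightarrow> w i = \<zero>"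
      "\<And>i. y \<otimes> xm j i = xm j i \<otimes> y \<oplus> h \<otimes> w i" by metis
  let ?F = "lcomb (\<lambda>k. \<Oplus>i \<in> {..<n}. xm j i \<otimes> ym i k)"
  let ?G = "lcomb (\<lambda>k. \<Oplus>i \<in> {..<n}. xm j i \<otimes> yh i k)"
  let ?H = "lcomb (\<lambda>k. \<Oplus>i \<in> {..<n}. xh j i \<otimes> ym i k)"
  let ?K = "lcomb (\<lambda>k. \<Oplus>i \<in> {..<n}. xh j i \<otimes> yh i k)"
  have cl: "?F \<in> carrier M'" "?G \<in> carrier M'" "?H \<in> carrier M'" "?K \<in> carrier M'" "lcomb w \<in> carrier M'"
    using w(1) xm xh ym yh by (auto intro!: lcomb_closed R.finsum_closed)
  have 1: "y \<odot>\<^bsub>M'\<^esub> lcomb (xm j) = (?F \<oplus>\<^bsub>M'\<^esub> h \<odot>\<^bsub>M'\<^esub> ?G) \<oplus>\<^bsub>M'\<^esub> h \<odot>\<^bsub>M'\<^esub> lcomb w"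
  proof -
    have "y \<odot>\<^bsub>M'\<^esub> lcomb (xm j) = lcomb (\<lambda>i. xm j i \<otimes> y \<oplus> h \<otimes> w i)"
      using smult_lcomb[OF y, of "xm j"] xm w(3) by simp
    also have "\<dots> = lcomb (\<lambda>i. xm j i \<otimes> y) \<oplus>\<^bsub>M'\<^esub> lcomb (\<lambda>i. h \<otimes> w i)"
      by (rule lcomb_add) (simp_all add: w closed)
    also have "lcomb (\<lambda>i. h \<otimes> w i) = h \<odot>\<^bsub>M'\<^esub> lcomb w"
      using smult_lcomb[OF h_closed, of w] w(1) by simp
    also have "lcomb (\<lambda>i. xm j i \<otimes> y) = ?F \<oplus>\<^bsub>M'\<^esub> h \<odot>\<^bsub>M'\<^esub> ?G"
      by (rule lcomb_smult_expand[OF xm y ym yh expand_y])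
    finally show ?thesis .
  qed
  \<comment> \<open>Entries of \<open>xh\<close> move past \<open>y\<close> freely, since the
    commutator disappears below \<open>h\<close>; the product \<open>?K\<close> of two corrections
    disappears because \<open>h\<close> acts twice.\<close>
  have 2: "y \<odot>\<^bsub>M'\<^esub> (h \<odot>\<^bsub>M'\<^esub> lcomb (xh j)) = h \<odot>\<^bsub>M'\<^esub> ?H"
  proof -
    have "y \<odot>\<^bsub>M'\<^esub> (h \<odot>\<^bsub>M'\<^esub> lcomb (xh j)) = h \<odot>\<^bsub>M'\<^esub> lcomb (\<lambda>i. y \<otimes> xh j i)"
      using h_smult_commute[OF y, of "lcomb (xh j)"] smult_lcomb[OF y, of "xh j"] xh lcomb_closed[of "xh j"]
      by simp
    also have "\<dots> = h \<odot>\<^bsub>M'\<^esub> lcomb (\<lambda>i. xh j i \<otimes> y)"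
      using xh y CS.R.m_comm by (intro h_smult_lcomb_cong) simp_all
    also have "\<dots> = h \<odot>\<^bsub>M'\<^esub> (?H \<oplus>\<^bsub>M'\<^esub> h \<odot>\<^bsub>M'\<^esub> ?K)"
      using lcomb_smult_expand[OF xh y ym yh expand_y] by simp
    also have "\<dots> = h \<odot>\<^bsub>M'\<^esub> ?H"
      using cl h_closed by (simp add: M'.smult_r_distr M'.smult_closed h_h_smult)
    finally show ?thesis .
  qed
  have "y \<odot>\<^bsub>M'\<^esub> (x \<odot>\<^bsub>M'\<^esub> e' j) = y \<odot>\<^bsub>M'\<^esub> lcomb (xm j) \<oplus>\<^bsub>M'\<^esub> y \<odot>\<^bsub>M'\<^esub> (h \<odot>\<^bsub>M'\<^esub> lcomb (xh j))"
    unfolding expand_x using xm xh y h_closed by (simp add: M'.smult_r_distr M'.smult_closed lcomb_closed)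
  also have "\<dots> = ?F \<oplus>\<^bsub>M'\<^esub> h \<odot>\<^bsub>M'\<^esub> (lcomb w \<oplus>\<^bsub>M'\<^esub> (?G \<oplus>\<^bsub>M'\<^esub> ?H))"
    unfolding 1 2 using cl h_closed by (simp add: M'.smult_r_distr M'.smult_closed M'.M.a_ac)
  also have "?G \<oplus>\<^bsub>M'\<^esub> ?H = lcomb (\<lambda>k. (\<Oplus>i \<in> {..<n}. xm j i \<otimes> yh i k) \<oplus> (\<Oplus>i \<in> {..<n}. xh j i \<otimes> ym i k))"
    using xm xh ym yh by (intro lcomb_add[symmetric]) (auto intro!: R.finsum_closed)
  also have "lcomb w \<oplus>\<^bsub>M'\<^esub> \<dots> =
      lcomb (\<lambda>k. w k \<oplus> ((\<Oplus>i \<in> {..<n}. xm j i \<otimes> yh i k) \<oplus> (\<Oplus>i \<in> {..<n}. xh j i \<otimes> ym i k)))"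
    using w(1) xm xh ym yh by (intro lcomb_add[symmetric]) (auto intro!: R.finsum_closed R.a_closed)
  finally show ?thesis using w(1,2) by blast
qed

text \<open>Elements over \<open>I\<close> lower the filtration, which makes the leading row
  strictly triangular. What is left lies in \<open>hM'\<close> and is expanded with coefficients
  over \<open>S\<close> as well, by reading it in \<open>M\<close>.\<close>

lemma expand_e':
  assumes S: "CS.R.coefficient_subring I J S" and x: "x \<in> carrier A'" "\<pi> x \<in> I" and j: "j < n"
  shows "\<exists>xm xh. (\<forall>i. xm i \<in> carrier A' \<and> \<pi> (xm i) \<in> S \<and> xh i \<in> carrier A' \<and> \<pi> (xh i) \<in> S) \<and>
    (\<forall>i \<ge> j. xm i = \<zero>) \<and> x \<odot>\<^bsub>M'\<^esub> e' j = lcomb xm \<oplus>\<^bsub>M'\<^esub> h \<odot>\<^bsub>M'\<^esub> lcomb xh"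
proof -
  have Scl: "s \<in> carrier A" if "s \<in> S" for s
    using that S subringE(1) unfolding CS.R.coefficient_subring_def by blast
  \<comment> \<open>Zero is lifted to zero, so that triangularity holds in \<open>A'\<close> and not
    only modulo \<open>h\<close>.\<close>
  have lift: "\<exists>z \<in> carrier A'. \<pi> z = a \<and> (a = \<zero>\<^bsub>A\<^esub> \<longrightarrow> z = \<zero>)" if "a \<in> S" for a
  proof (cases "a = \<zero>\<^bsub>A\<^esub>")
    case False
    then show ?thesis using Scl[OF that] unfolding proj_surj[symmetric] by auto
  qed (auto intro: bexI[of _ \<zero>])
  have ej: "e' j \<in> carrier M'" "e j \<in> carrier M" using e'_closed CS.e_closed j by auto
  have "\<pi> x \<odot>\<^bsub>M\<^esub> e j \<in> N j"
    using CS.I_smult[OF I_ideal x(2), of "Suc j" "e j"] CS.e_mem j by simp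
  then obtain c where c: "\<And>i. c i \<in> S" "\<And>i. j \<le> i \<Longrightarrow> c i = \<zero>\<^bsub>A\<^esub>" "\<pi> x \<odot>\<^bsub>M\<^esub> e j = CS.lincomb n c"
    using CS.lincomb_exists[OF I_ideal S, of j] j by (meson less_imp_le)
  obtain xm where xm: "\<And>i. xm i \<in> carrier A'" "\<And>i. \<pi> (xm i) = c i" "\<And>i. c i = \<zero>\<^bsub>A\<^esub> \<Longrightarrow> xm i = \<zero>"
    using lift[OF c(1)] by metis
  have psi_eq: "\<psi> (x \<odot>\<^bsub>M'\<^esub> e' j) = \<psi> (lcomb xm)"
    using proj_smult[OF x(1) ej(1)] psi_e'[OF j] c(3) psi_lcomb[OF xm(1)] xm(2) by simp
  obtain u where u: "u \<in> carrier M'" "x \<odot>\<^bsub>M'\<^esub> e' j = lcomb xm \<oplus>\<^bsub>M'\<^esub> h \<odot>\<^bsub>M'\<^esub> u"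
    by (rule psi_eqE[OF M'.smult_closed[OF x(1) ej(1)] lcomb_closed[OF xm(1)] psi_eq])
  obtain d where d: "\<And>i. d i \<in> S" "\<psi> u = CS.lincomb n d"
    using CS.lincomb_exists[OF I_ideal S, of n "\<psi> u"] CS.N_n u(1) by auto
  obtain xh where xh: "\<And>i. xh i \<in> carrier A'" "\<And>i. \<pi> (xh i) = d i"
    using lift[OF d(1)] by metis
  have "h \<odot>\<^bsub>M'\<^esub> u = h \<odot>\<^bsub>M'\<^esub> lcomb xh"
    using h_smult_eq_iff[OF u(1) lcomb_closed[OF xh(1)]] d(2) psi_lcomb[OF xh(1)] xh(2) by simp
  with u(2) have "x \<odot>\<^bsub>M'\<^esub> e' j = lcomb xm \<oplus>\<^bsub>M'\<^esub> h \<odot>\<^bsub>M'\<^esub> lcomb xh" by simp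
  moreover have "\<forall>i. xm i \<in> carrier A' \<and> \<pi> (xm i) \<in> S \<and> xh i \<in> carrier A' \<and> \<pi> (xh i) \<in> S"
    using xm xh c(1) d(1) by simp
  moreover have "\<forall>i \<ge> j. xm i = \<zero>" using xm(3) c(2) by simp
  ultimately show ?thesis by blast
qed

text \<open>Both sides of the bracket identity are applied to \<open>e' j\<close>. The difference
  \<open>Z\<close> of the leading products is strictly triangular with residues in \<open>J\<close>,
  so it contributes an element of \<open>hN j\<close>; the commutator error \<open>w\<close>
  contributes, after division by \<open>h\<close>, an element of \<open>N j\<close>. Only the
  diagonal entry of the order-\<open>h\<close> products survives modulo \<open>N j\<close>, and
  \<open>lincomb_diagonal\<close> reads it off.\<close>

lemma diagonal_commutator:
  assumes S: "CS.R.coefficient_subring I J S"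
    and J: "J \<subseteq> lifted_annihilator" "\<And>a v. \<lbrakk>a \<in> J; v \<in> carrier M\<rbrakk> \<Longrightarrow> a \<odot>\<^bsub>M\<^esub> v = \<zero>\<^bsub>M\<^esub>"
    and x: "x \<in> carrier A'" and y: "y \<in> carrier A'" and z: "z \<in> carrier A'"
    and bracket: "x \<otimes> y \<ominus> y \<otimes> x = h \<otimes> z" and j: "j < n"
    and xm: "\<And>i k. xm i k \<in> carrier A'" "\<And>i k. \<pi> (xm i k) \<in> S"
    and xh: "\<And>i k. xh i k \<in> carrier A'" "\<And>i k. \<pi> (xh i k) \<in> S"
    and ym: "\<And>i k. ym i k \<in> carrier A'" "\<And>i k. \<pi> (ym i k) \<in> S"
    and yh: "\<And>i k. yh i k \<in> carrier A'" "\<And>i k. \<pi> (yh i k) \<in> S"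
    and triangular: "\<And>i k. i \<le> k \<Longrightarrow> xm i k = \<zero>" "\<And>i k. i \<le> k \<Longrightarrow> ym i k = \<zero>"
    and expand_x: "\<And>i. i < n \<Longrightarrow> x \<odot>\<^bsub>M'\<^esub> e' i = lcomb (xm i) \<oplus>\<^bsub>M'\<^esub> h \<odot>\<^bsub>M'\<^esub> lcomb (xh i)"
    and expand_y: "\<And>i. i < n \<Longrightarrow> y \<odot>\<^bsub>M'\<^esub> e' i = lcomb (ym i) \<oplus>\<^bsub>M'\<^esub> h \<odot>\<^bsub>M'\<^esub> lcomb (yh i)"
  shows "\<pi> (((\<Oplus>i \<in> {..<n}. ym j i \<otimes> xh i j) \<oplus> (\<Oplus>i \<in> {..<n}. yh j i \<otimes> xm i j)) \<ominus>
      ((\<Oplus>i \<in> {..<n}. xm j i \<otimes> yh i j) \<oplus> (\<Oplus>i \<in> {..<n}. xh j i \<otimes> ym i j))) \<ominus>\<^bsub>A\<^esub> \<pi> z \<in> I"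
proof -
  have S': "subring S A" "J \<subseteq> S" "S \<inter> I \<subseteq> J"
    using S unfolding CS.R.coefficient_subring_def by auto
  \<comment> \<open>The preimage of \<open>S\<close> in \<open>A'\<close> is a subring, so sums of
    products of entries stay in it; a mere set of representatives would fail here.\<close>
  let ?lift = "{a \<in> carrier A'. \<pi> a \<in> S}"
  have L: "subring ?lift A'"
  proof (rule R.subringI)
    show "\<one> \<in> ?lift" using subringE(3)[OF S'(1)] by simp
    show "\<ominus> a \<in> ?lift" if "a \<in> ?lift" for a using that subringE(5)[OF S'(1)] by simp
    show "a \<otimes> b \<in> ?lift" "a \<oplus> b \<in> ?lift" if "a \<in> ?lift" "b \<in> ?lift" for a b
      using that subringE(6,7)[OF S'(1)] by simp_all
  qed blast
  have L_sum: "(\<Oplus>i \<in> B. f i) \<in> ?lift" if "finite B" "\<And>i. f i \<in> ?lift" for B :: "nat set" and f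
    using that(1)
  proof (induction B rule: finite_induct)
    case (insert b B)
    have "(\<Oplus>i \<in> insert b B. f i) = f b \<oplus> (\<Oplus>i \<in> B. f i)"
      using insert.hyps that(2) by (intro R.finsum_insert) auto
    then show ?case using subringE(7)[OF L that(2) insert.IH] by simp
  qed (use subringE(2)[OF L] in simp)
  have lift: "xm i k \<in> ?lift" "xh i k \<in> ?lift" "ym i k \<in> ?lift" "yh i k \<in> ?lift" for i k
    using xm xh ym yh by simp_all
  have L_prod: "(\<Oplus>i \<in> {..<n}. f i \<otimes> g i) \<in> ?lift" if "\<And>i. f i \<in> ?lift" "\<And>i. g i \<in> ?lift" for f g
    using that by (intro L_sum subringE(6)[OF L]) auto
  define F1 where "F1 k = (\<Oplus>i \<in> {..<n}. xm j i \<otimes> ym i k)" for k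
  define F2 where "F2 k = (\<Oplus>i \<in> {..<n}. ym j i \<otimes> xm i k)" for k
  define G1 where "G1 k = (\<Oplus>i \<in> {..<n}. xm j i \<otimes> yh i k) \<oplus> (\<Oplus>i \<in> {..<n}. xh j i \<otimes> ym i k)" for k
  define G2 where "G2 k = (\<Oplus>i \<in> {..<n}. ym j i \<otimes> xh i k) \<oplus> (\<Oplus>i \<in> {..<n}. yh j i \<otimes> xm i k)" for k
  have FG: "F1 k \<in> ?lift" "F2 k \<in> ?lift" "G1 k \<in> ?lift" "G2 k \<in> ?lift" for k
    unfolding F1_def F2_def G1_def G2_def by (intro subringE(7)[OF L] L_prod lift)+
  have FGc: "F1 k \<in> carrier A'" "F2 k \<in> carrier A'" "G1 k \<in> carrier A'" "G2 k \<in> carrier A'" for k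
    using FG by blast+
  obtain w1 where w1: "\<And>i. w1 i \<in> carrier A'" "\<And>i. j \<le> i \<Longrightarrow> w1 i = \<zero>"
    and yx: "y \<odot>\<^bsub>M'\<^esub> (x \<odot>\<^bsub>M'\<^esub> e' j) = lcomb F1 \<oplus>\<^bsub>M'\<^esub> h \<odot>\<^bsub>M'\<^esub> lcomb (\<lambda>k. w1 k \<oplus> G1 k)"
    using smult_smult_e'[where x = x and y = y and j = j and xm = xm and xh = xh and ym = ym and yh = yh, OF x y j xm(1) xh(1) ym(1) yh(1) triangular(1) expand_x[OF j] expand_y]
    unfolding F1_def G1_def by blast
  obtain w2 where w2: "\<And>i. w2 i \<in> carrier A'" "\<And>i. j \<le> i \<Longrightarrow> w2 i = \<zero>"
    and xy: "x \<odot>\<^bsub>M'\<^esub> (y \<odot>\<^bsub>M'\<^esub> e' j) = lcomb F2 \<oplus>\<^bsub>M'\<^esub> h \<odot>\<^bsub>M'\<^esub> lcomb (\<lambda>k. w2 k \<oplus> G2 k)"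
    using smult_smult_e'[where x = y and y = x and j = j and xm = ym and xh = yh and ym = xm and yh = xh, OF y x j ym(1) yh(1) xm(1) xh(1) triangular(2) expand_y[OF j] expand_x]
    unfolding F2_def G2_def by blast
  define Z where "Z k = F2 k \<ominus> F1 k" for k
  define w where "w k = w2 k \<ominus> w1 k" for k
  define G where "G k = G2 k \<ominus> G1 k" for k
  have Z: "Z k \<in> ?lift" and G: "G k \<in> ?lift" for k
    unfolding Z_def G_def by (rule subring_minus_closed[OF L FG(2,1)], rule subring_minus_closed[OF L FG(4,3)])
  have Zc: "Z k \<in> carrier A'" and Gc: "G k \<in> carrier A'" and wc: "w k \<in> carrier A'" for k
    using Z[of k] G[of k] w1(1) w2(1) unfolding w_def by simp_all
  have ej: "e' j \<in> carrier M'" by (rule e'_closed[OF j])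
  note lc = lcomb_closed[OF FGc(1)] lcomb_closed[OF FGc(2)] lcomb_closed[OF FGc(3)]
    lcomb_closed[OF FGc(4)] lcomb_closed[OF w1(1)] lcomb_closed[OF w2(1)]
  have "h \<odot>\<^bsub>M'\<^esub> (z \<odot>\<^bsub>M'\<^esub> e' j) = x \<odot>\<^bsub>M'\<^esub> (y \<odot>\<^bsub>M'\<^esub> e' j) \<ominus>\<^bsub>M'\<^esub> y \<odot>\<^bsub>M'\<^esub> (x \<odot>\<^bsub>M'\<^esub> e' j)"
    using x y z ej h_closed M'.smult_minus_left[of "x \<otimes> y" "y \<otimes> x" "e' j"]
    unfolding bracket by (simp add: M'.smult_assoc)
  also have "\<dots> = (lcomb F2 \<oplus>\<^bsub>M'\<^esub> h \<odot>\<^bsub>M'\<^esub> (lcomb w2 \<oplus>\<^bsub>M'\<^esub> lcomb G2)) \<ominus>\<^bsub>M'\<^esub>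
      (lcomb F1 \<oplus>\<^bsub>M'\<^esub> h \<odot>\<^bsub>M'\<^esub> (lcomb w1 \<oplus>\<^bsub>M'\<^esub> lcomb G1))"
    unfolding xy yx using w1(1) w2(1) FGc by (simp add: lcomb_add)
  also have "\<dots> = (lcomb F2 \<ominus>\<^bsub>M'\<^esub> lcomb F1) \<oplus>\<^bsub>M'\<^esub>
      h \<odot>\<^bsub>M'\<^esub> ((lcomb w2 \<ominus>\<^bsub>M'\<^esub> lcomb w1) \<oplus>\<^bsub>M'\<^esub> (lcomb G2 \<ominus>\<^bsub>M'\<^esub> lcomb G1))"
    using lc h_closed
    by (simp add: a_minus_def M'.smult_r_distr M'.smult_neg_right M'.smult_closed M'.M.minus_add M'.M.a_ac)
  also have "\<dots> = lcomb Z \<oplus>\<^bsub>M'\<^esub> h \<odot>\<^bsub>M'\<^esub> (lcomb w \<oplus>\<^bsub>M'\<^esub> lcomb G)"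
    using lcomb_minus[of F2 F1] lcomb_minus[of w2 w1] lcomb_minus[of G2 G1] FGc w1(1) w2(1)
    unfolding Z_def w_def G_def by simp
  finally have eq: "h \<odot>\<^bsub>M'\<^esub> (z \<odot>\<^bsub>M'\<^esub> e' j) = lcomb Z \<oplus>\<^bsub>M'\<^esub> h \<odot>\<^bsub>M'\<^esub> (lcomb w \<oplus>\<^bsub>M'\<^esub> lcomb G)" .
  note lc' = lcomb_closed[of Z, OF Zc] lcomb_closed[of w, OF wc] lcomb_closed[of G, OF Gc]
  have zc: "z \<odot>\<^bsub>M'\<^esub> e' j \<in> carrier M'" by (rule M'.smult_closed[OF z ej])
  have kill: "s \<odot>\<^bsub>M\<^esub> e k = \<zero>\<^bsub>M\<^esub>" if "s \<in> S" "s \<in> I" "k < n" for s k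
    using J(2)[of s "e k"] S'(3) that CS.e_closed by blast
  \<comment> \<open>\<open>lcomb Z\<close> vanishes in \<open>M\<close>, every other term being a
    multiple of \<open>h\<close>. Independence puts the residue of \<open>Z k\<close> in
    \<open>I\<close>; as it is also in \<open>S\<close>, it is in \<open>J\<close>.\<close>
  have ZJ: "\<pi> (Z k) \<in> lifted_annihilator" if "k < n" for k
  proof -
    have "\<psi> (h \<odot>\<^bsub>M'\<^esub> (z \<odot>\<^bsub>M'\<^esub> e' j)) = \<psi> (lcomb Z) \<oplus>\<^bsub>M\<^esub> \<psi> (h \<odot>\<^bsub>M'\<^esub> (lcomb w \<oplus>\<^bsub>M'\<^esub> lcomb G))"
      unfolding eq using lc' h_closed by (simp add: M'.smult_closed)
    then have "\<psi> (lcomb Z) = \<zero>\<^bsub>M\<^esub>" using lc' zc by (simp add: psi_h_smult)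
    then have "CS.lincomb n (\<lambda>i. \<pi> (Z i)) \<in> N 0" using psi_lcomb[of Z, OF Zc] CS.N_0 by simp
    then have "\<pi> (Z k) \<in> I"
      using CS.lincomb_mem_imp[of "\<lambda>i. \<pi> (Z i)" n 0 k] kill Z Zc that by simp
    then show ?thesis using Z S'(3) J(1) by blast
  qed
  have Z0: "Z k = \<zero>" if "j \<le> k" for k
  proof -
    have "a \<otimes> b = \<zero>"
      if "a = xm j i \<and> b = ym i k \<or> a = ym j i \<and> b = xm i k" for a b i
      using that triangular[of j i] triangular[of i k] xm(1) ym(1) \<open>j \<le> k\<close> by (cases "j \<le> i") auto
    then have "F1 k = \<zero>" "F2 k = \<zero>"
      unfolding F1_def F2_def by (auto intro!: R.add.finprod_one_eqI)
    then show ?thesis unfolding Z_def by (simp add: a_minus_def)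
  qed
  \<comment> \<open>Only indices \<open>i < j\<close> contribute, and for these
    \<open>hN (Suc i) \<subseteq> hN j\<close>.\<close>
  have "lcomb Z \<in> hN j"
  proof (rule lcomb_mem_hN)
    show "Z i \<odot>\<^bsub>M'\<^esub> e' i \<in> hN j" if "i < n" for i
    proof (cases "j \<le> i")
      case True
      then show ?thesis using Z0 e'_closed[OF that] hN_zero[of j] j by (simp add: M'.smult_zero_left)
    next
      case False
      then show ?thesis
        using lifted_annihilatorD[OF Zc ZJ[OF that] that] hN_mono[of "Suc i" j] j by auto
    qed
  qed (use j in simp)
  then obtain t where t: "t \<in> carrier M'" "\<psi> t \<in> N j" "lcomb Z = h \<odot>\<^bsub>M'\<^esub> t" by (rule hN_E)
  have "h \<odot>\<^bsub>M'\<^esub> (z \<odot>\<^bsub>M'\<^esub> e' j) = h \<odot>\<^bsub>M'\<^esub> (t \<oplus>\<^bsub>M'\<^esub> (lcomb w \<oplus>\<^bsub>M'\<^esub> lcomb G))"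
    unfolding eq t(3) using t(1) lc' h_closed by (simp add: M'.smult_r_distr)
  then have "\<psi> (z \<odot>\<^bsub>M'\<^esub> e' j) = \<psi> (t \<oplus>\<^bsub>M'\<^esub> (lcomb w \<oplus>\<^bsub>M'\<^esub> lcomb G))"
    using h_smult_eq_iff[OF zc] t(1) lc' by simp
  then have e_eq: "\<pi> z \<odot>\<^bsub>M\<^esub> e j =
      \<psi> t \<oplus>\<^bsub>M\<^esub> (CS.lincomb n (\<lambda>i. \<pi> (w i)) \<oplus>\<^bsub>M\<^esub> CS.lincomb n (\<lambda>i. \<pi> (G i)))"
    using t(1) lc' z ej psi_e'[OF j] psi_lcomb[of w, OF wc] psi_lcomb[of G, OF Gc] by (simp add: proj_smult)
  have "CS.lincomb n (\<lambda>i. \<pi> (w i)) = CS.lincomb j (\<lambda>i. \<pi> (w i))"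
    using j wc w1(2) w2(2) by (intro CS.lincomb_extend) (simp_all add: w_def a_minus_def)
  then have w_mem: "CS.lincomb n (\<lambda>i. \<pi> (w i)) \<in> N j"
    using CS.lincomb_mem[of "\<lambda>i. \<pi> (w i)" j] wc j by simp
  have Gl: "CS.lincomb n (\<lambda>i. \<pi> (G i)) \<in> carrier M"
    using CS.N_closed[OF _ CS.lincomb_mem[of "\<lambda>i. \<pi> (G i)" n]] Gc by simp
  have wt: "\<psi> t \<oplus>\<^bsub>M\<^esub> CS.lincomb n (\<lambda>i. \<pi> (w i)) \<in> N j"
    using CS.N_add[OF _ t(2) w_mem] j by simp
  have "CS.lincomb n (\<lambda>i. \<pi> (G i)) \<ominus>\<^bsub>M\<^esub> \<pi> z \<odot>\<^bsub>M\<^esub> e j =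
      \<ominus>\<^bsub>M\<^esub> (\<psi> t \<oplus>\<^bsub>M\<^esub> CS.lincomb n (\<lambda>i. \<pi> (w i)))"
    unfolding e_eq using Gl CS.N_closed[OF _ t(2)] CS.N_closed[OF _ w_mem] j
    by (intro M.M.minus_sum_right) simp_all
  then have "CS.lincomb n (\<lambda>i. \<pi> (G i)) \<ominus>\<^bsub>M\<^esub> \<pi> z \<odot>\<^bsub>M\<^esub> e j \<in> N j"
    using CS.N_neg[OF _ wt] j by simp
  then have "\<pi> (G j) \<ominus>\<^bsub>A\<^esub> \<pi> z \<in> I"
    using Gc G z j kill by (intro CS.lincomb_diagonal) auto
  then show ?thesis unfolding G_def G1_def G2_def .
qed

text \<open>The diagonal entries above are those of a sum of two commutators of matrices over \<open>A\<close>.\<close>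

lemma length_smult_bracket_mem:
  assumes S: "CS.R.coefficient_subring I J S"
    and J: "J \<subseteq> lifted_annihilator" "\<And>a v. \<lbrakk>a \<in> J; v \<in> carrier M\<rbrakk> \<Longrightarrow> a \<odot>\<^bsub>M\<^esub> v = \<zero>\<^bsub>M\<^esub>"
    and x: "x \<in> carrier A'" "\<pi> x \<in> I" and y: "y \<in> carrier A'" "\<pi> y \<in> I" and z: "z \<in> carrier A'"
    and bracket: "x \<otimes> y \<ominus> y \<otimes> x = h \<otimes> z"
  shows "add_pow A n (\<pi> z) \<in> I"
proof -
  interpret I: ideal I A by (rule I_ideal)
  have zero_S: "\<zero>\<^bsub>A\<^esub> \<in> S"
    using S subringE(2) unfolding CS.R.coefficient_subring_def by blast
  have choice2: "\<exists>f g. \<forall>j. T j (f j) (g j)" if "\<And>j. \<exists>f g. T j f g"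
    for T :: "nat \<Rightarrow> (nat \<Rightarrow> 'b) \<Rightarrow> (nat \<Rightarrow> 'b) \<Rightarrow> bool"
    using that by metis
  have ex: "\<exists>xm xh. (\<forall>j k. xm j k \<in> carrier A' \<and> \<pi> (xm j k) \<in> S \<and> xh j k \<in> carrier A' \<and> \<pi> (xh j k) \<in> S) \<and>
      (\<forall>j k. j \<le> k \<longrightarrow> xm j k = \<zero>) \<and>
      (\<forall>j < n. u \<odot>\<^bsub>M'\<^esub> e' j = lcomb (xm j) \<oplus>\<^bsub>M'\<^esub> h \<odot>\<^bsub>M'\<^esub> lcomb (xh j))"
    if u: "u \<in> carrier A'" "\<pi> u \<in> I" for u
  proof -
    define T where "T j f g \<longleftrightarrow>
      (\<forall>k. f k \<in> carrier A' \<and> \<pi> (f k) \<in> S \<and> g k \<in> carrier A' \<and> \<pi> (g k) \<in> S) \<and>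
      (\<forall>k \<ge> j. f k = \<zero>) \<and> (j < n \<longrightarrow> u \<odot>\<^bsub>M'\<^esub> e' j = lcomb f \<oplus>\<^bsub>M'\<^esub> h \<odot>\<^bsub>M'\<^esub> lcomb g)"
      for j f g
    \<comment> \<open>Rows with index at least \<open>n\<close> are filled with zeros, so that the
      choice of rows is total.\<close>
    have ex_T: "\<exists>f g. T j f g" for j
    proof (cases "j < n")
      case True
      from expand_e'[OF S u True] show ?thesis unfolding T_def by (simp only: True simp_thms)
    next
      case False
      then have "T j (\<lambda>_. \<zero>) (\<lambda>_. \<zero>)" using zero_S unfolding T_def by simp
      then show ?thesis by (intro exI)
    qed
    from choice2[of T, OF ex_T] obtain f g where "\<forall>j. T j (f j) (g j)" by blast
    then show ?thesis unfolding T_def by (intro exI[of _ f] exI[of _ g]) simp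
  qed
  obtain xm xh where xmxh:
      "\<forall>j k. xm j k \<in> carrier A' \<and> \<pi> (xm j k) \<in> S \<and> xh j k \<in> carrier A' \<and> \<pi> (xh j k) \<in> S"
    and xm_triangular: "\<forall>j k. j \<le> k \<longrightarrow> xm j k = \<zero>"
    and expand_x: "\<forall>j < n. x \<odot>\<^bsub>M'\<^esub> e' j = lcomb (xm j) \<oplus>\<^bsub>M'\<^esub> h \<odot>\<^bsub>M'\<^esub> lcomb (xh j)"
    using ex[OF x] by (elim exE conjE)
  have xm: "xm j k \<in> carrier A'" "\<pi> (xm j k) \<in> S"
    and xh: "xh j k \<in> carrier A'" "\<pi> (xh j k) \<in> S" for j k
    using xmxh by simp_all
  note xm_triangular = xm_triangular[rule_format] and expand_x = expand_x[rule_format]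
  obtain ym yh where ymyh:
      "\<forall>j k. ym j k \<in> carrier A' \<and> \<pi> (ym j k) \<in> S \<and> yh j k \<in> carrier A' \<and> \<pi> (yh j k) \<in> S"
    and ym_triangular: "\<forall>j k. j \<le> k \<longrightarrow> ym j k = \<zero>"
    and expand_y: "\<forall>j < n. y \<odot>\<^bsub>M'\<^esub> e' j = lcomb (ym j) \<oplus>\<^bsub>M'\<^esub> h \<odot>\<^bsub>M'\<^esub> lcomb (yh j)"
    using ex[OF y] by (elim exE conjE)
  have ym: "ym j k \<in> carrier A'" "\<pi> (ym j k) \<in> S"
    and yh: "yh j k \<in> carrier A'" "\<pi> (yh j k) \<in> S" for j k
    using ymyh by simp_all
  note ym_triangular = ym_triangular[rule_format] and expand_y = expand_y[rule_format]
  let ?D = "\<lambda>U V. \<Oplus>\<^bsub>A\<^esub>j \<in> {..<n}. \<Oplus>\<^bsub>A\<^esub>i \<in> {..<n}. \<pi> (U j i) \<otimes>\<^bsub>A\<^esub> \<pi> (V i j)"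
  \<comment> \<open>\<open>?D U V\<close> is the trace of the product of the reduced matrices over
    the commutative ring \<open>A\<close>, so the two factors may be exchanged.\<close>
  have D_swap: "?D U V = ?D V U"
    if "\<And>j k. U j k \<in> carrier A'" "\<And>j k. V j k \<in> carrier A'" for U V
  proof -
    have "?D U V = (\<Oplus>\<^bsub>A\<^esub>i \<in> {..<n}. \<Oplus>\<^bsub>A\<^esub>j \<in> {..<n}. \<pi> (U j i) \<otimes>\<^bsub>A\<^esub> \<pi> (V i j))"
      using that by (intro S.finsum_swap) auto
    also have "\<dots> = ?D V U"
      using that CS.R.m_comm by (intro S.finsum_cong') (auto intro!: S.finsum_closed)
    finally show ?thesis .
  qed
  define G1 where "G1 j = (\<Oplus>i \<in> {..<n}. xm j i \<otimes> yh i j) \<oplus> (\<Oplus>i \<in> {..<n}. xh j i \<otimes> ym i j)" for j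
  define G2 where "G2 j = (\<Oplus>i \<in> {..<n}. ym j i \<otimes> xh i j) \<oplus> (\<Oplus>i \<in> {..<n}. yh j i \<otimes> xm i j)" for j
  have Gc: "G1 j \<in> carrier A'" "G2 j \<in> carrier A'" for j
    unfolding G1_def G2_def using xm xh ym yh by (auto intro!: R.finsum_closed R.a_closed)
  have sum_G: "(\<Oplus>\<^bsub>A\<^esub>j \<in> {..<n}. \<pi> ((\<Oplus>i \<in> {..<n}. U j i \<otimes> V i j) \<oplus> (\<Oplus>i \<in> {..<n}. U' j i \<otimes> V' i j))) =
      ?D U V \<oplus>\<^bsub>A\<^esub> ?D U' V'"
    if c: "\<And>j k. U j k \<in> carrier A'" "\<And>j k. V j k \<in> carrier A'" "\<And>j k. U' j k \<in> carrier A'" "\<And>j k. V' j k \<in> carrier A'"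
    for U V U' V'
  proof -
    have "\<pi> ((\<Oplus>i \<in> {..<n}. U j i \<otimes> V i j) \<oplus> (\<Oplus>i \<in> {..<n}. U' j i \<otimes> V' i j)) =
        (\<Oplus>\<^bsub>A\<^esub>i \<in> {..<n}. \<pi> (U j i) \<otimes>\<^bsub>A\<^esub> \<pi> (V i j)) \<oplus>\<^bsub>A\<^esub>
        (\<Oplus>\<^bsub>A\<^esub>i \<in> {..<n}. \<pi> (U' j i) \<otimes>\<^bsub>A\<^esub> \<pi> (V' i j))" for j
      using c by (simp add: R.finsum_closed Pi_def o_def)
    then show ?thesis using c by (simp add: S.finsum_addf Pi_def S.finsum_closed)
  qed
  have "(\<Oplus>\<^bsub>A\<^esub>j \<in> {..<n}. \<pi> (G2 j)) = ?D ym xh \<oplus>\<^bsub>A\<^esub> ?D yh xm"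
    unfolding G2_def by (rule sum_G[OF ym(1) xh(1) yh(1) xm(1)])
  also have "\<dots> = ?D xm yh \<oplus>\<^bsub>A\<^esub> ?D xh ym"
    unfolding D_swap[OF ym(1) xh(1)] D_swap[OF yh(1) xm(1)]
    using xm(1) ym(1) xh(1) yh(1) by (intro S.a_comm) (auto intro!: S.finsum_closed)
  also have "\<dots> = (\<Oplus>\<^bsub>A\<^esub>j \<in> {..<n}. \<pi> (G1 j))"
    unfolding G1_def by (rule sum_G[OF xm(1) yh(1) xh(1) ym(1), symmetric])
  finally have trace: "(\<Oplus>\<^bsub>A\<^esub>j \<in> {..<n}. \<pi> (G2 j)) = (\<Oplus>\<^bsub>A\<^esub>j \<in> {..<n}. \<pi> (G1 j))" .
  \<comment> \<open>The error in the \<open>j\<close>-th diagonal identity, an element of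
    \<open>I\<close>. Summing over \<open>j\<close> cancels the traces and leaves \<open>n\<close>
    times \<open>\<pi> z\<close> as minus the sum of the errors.\<close>
  define r where "r j = (if j < n then \<pi> (G2 j \<ominus> G1 j) \<ominus>\<^bsub>A\<^esub> \<pi> z else \<zero>\<^bsub>A\<^esub>)" for j
  have r: "r j \<in> I" for j
    using diagonal_commutator[where xm = xm and xh = xh and ym = ym and yh = yh, OF S J x(1) y(1) z bracket _ xm xh ym yh xm_triangular ym_triangular expand_x expand_y]
    unfolding r_def G1_def G2_def by auto
  have rc: "r j \<in> carrier A" for j using I.Icarr[OF r] .
  have pz: "\<pi> z \<in> carrier A" using z by simp
  have "\<pi> (G2 j) = \<pi> (G1 j) \<oplus>\<^bsub>A\<^esub> (\<pi> z \<oplus>\<^bsub>A\<^esub> r j)" if "j < n" for j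
  proof -
    have c: "\<pi> (G1 j) \<in> carrier A" "\<pi> (G2 j) \<in> carrier A" using Gc by simp_all
    have "r j = \<pi> (G2 j) \<ominus>\<^bsub>A\<^esub> \<pi> (G1 j) \<ominus>\<^bsub>A\<^esub> \<pi> z" using that Gc by (simp add: r_def proj_minus)
    then show ?thesis using CS.R.add_difference[OF c pz] by simp
  qed
  then have "(\<Oplus>\<^bsub>A\<^esub>j \<in> {..<n}. \<pi> (G2 j)) = (\<Oplus>\<^bsub>A\<^esub>j \<in> {..<n}. \<pi> (G1 j) \<oplus>\<^bsub>A\<^esub> (\<pi> z \<oplus>\<^bsub>A\<^esub> r j))"
    using Gc pz rc by (intro S.finsum_cong') auto
  also have "\<dots> = (\<Oplus>\<^bsub>A\<^esub>j \<in> {..<n}. \<pi> (G1 j)) \<oplus>\<^bsub>A\<^esub> (\<Oplus>\<^bsub>A\<^esub>j \<in> {..<n}. \<pi> z \<oplus>\<^bsub>A\<^esub> r j)"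
    using Gc pz rc by (intro S.finsum_addf) auto
  also have "(\<Oplus>\<^bsub>A\<^esub>j \<in> {..<n}. \<pi> z \<oplus>\<^bsub>A\<^esub> r j) = add_pow A n (\<pi> z) \<oplus>\<^bsub>A\<^esub> (\<Oplus>\<^bsub>A\<^esub>j \<in> {..<n}. r j)"
    using pz rc S.finsum_addf[of "\<lambda>_. \<pi> z" "{..<n}" r] S.add.finprod_const[of "\<pi> z" "{..<n}"] by (simp add: Pi_def)
  finally have "add_pow A n (\<pi> z) \<oplus>\<^bsub>A\<^esub> (\<Oplus>\<^bsub>A\<^esub>j \<in> {..<n}. r j) = \<zero>\<^bsub>A\<^esub>"
    unfolding trace using Gc pz rc by (simp add: Pi_def S.finsum_closed)
  then have "add_pow A n (\<pi> z) = \<ominus>\<^bsub>A\<^esub> (\<Oplus>\<^bsub>A\<^esub>j \<in> {..<n}. r j)"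
    using pz rc by (intro S.minus_equality[symmetric]) (auto intro!: S.finsum_closed)
  moreover have "finite B \<Longrightarrow> (\<Oplus>\<^bsub>A\<^esub>j \<in> B. r j) \<in> I" for B
  proof (induction B rule: finite_induct)
    case (insert b B)
    then show ?case using r rc by (simp add: S.finsum_insert Pi_def I.a_closed)
  qed simp
  ultimately show ?thesis using I.a_inv_closed by simp
qed

end

theorem propositionB1:
  fixes A :: "('a, 'r) ring_scheme" and m :: "'a set"
    and A' :: "('b, 's) ring_scheme" and \<pi> :: "'b \<Rightarrow> 'a" and h :: 'b
    and M :: "('a, 'c, 't) module_scheme"
    and M' :: "('b, 'd, 'u) module_scheme" and \<psi> :: "'d \<Rightarrow> 'c"
  assumes "regular_local_ring A m"
    and "equicharacteristic_local_ring A m"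
    and "first_order_deformation A' A \<pi> h"
    and "module A M"
    and "carrier M \<noteq> {\<zero>\<^bsub>M\<^esub>}"
    and "finite_length A M"
    and "first_order_module_deformation A' A \<pi> h M' M \<psi>"
    and "ring_char (A Quot m) = 0 \<or>
         coprime (ring_char (A Quot m)) (the_enat (module_length A M))"
  shows "\<forall>a \<in> m. \<forall>b \<in> m. induced_bracket A' A \<pi> h a b \<in> m"
proof -
  interpret L: regular_local_ring A m by fact
  interpret D: first_order_module_deformation A' A \<pi> h M' M \<psi> by fact
  interpret V: module A M by fact
  have I: "ideal m A" "\<one>\<^bsub>A\<^esub> \<notin> m" "\<And>a. \<lbrakk>a \<in> carrier A; a \<notin> m\<rbrakk> \<Longrightarrow> a \<in> Units A"
    using L.I_notcarr L.one_imp_carrier L.ideal_axioms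
      L.noetherian_local_ring_Units[OF L.local_ring_axioms L.noetherian_ring_axioms] by auto
  have prime: "a \<in> m \<or> b \<in> m" if "a \<in> carrier A" "b \<in> carrier A" "a \<otimes>\<^bsub>A\<^esub> b \<in> m" for a b
    using primeideal.I_prime[OF L.maximalideal_prime[OF L.maximalideal_axioms] that] .
  have equichar: "ring_char A = ring_char (A Quot m)"
    using equicharacteristic_local_ring.equichar[OF assms(2)] .
  obtain n where n: "module_length A M = enat n"
    using assms(6) unfolding finite_length_def by auto
  obtain N e where "composition_series A M m N e n"
    using V.composition_series_exists[OF n I] by blast
  then interpret C: composition_series A M m N e n .
  \<comment> \<open>This settles residue characteristic zero, where \<open>0\<close> would divide a
    zero length.\<close>
  have "n \<noteq> 0" using C.N_0 C.N_n assms(5) by metis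
  have n_unit: "add_pow A n \<one>\<^bsub>A\<^esub> \<notin> m"
  proof
    assume "add_pow A n \<one>\<^bsub>A\<^esub> \<in> m"
    then have dvd: "ring_char (A Quot m) dvd n" using ideal.add_pow_one_mem_iff[OF I(1)] by blast
    with \<open>n \<noteq> 0\<close> have "ring_char (A Quot m) \<noteq> 0" by auto
    then have "coprime (ring_char (A Quot m)) n" using assms(8) n by simp
    with dvd have "ring_char (A Quot m) dvd 1" using coprime_absorb_left by blast
    then have "add_pow A (1::nat) \<one>\<^bsub>A\<^esub> \<in> m" using ideal.add_pow_one_mem_iff[OF I(1)] by blast
    then show False using I(2) by simp
  qed
  define e' where "e' i = inv_into (carrier M') \<psi> (e i)" for i
  have e': "e' i \<in> carrier M'" "\<psi> (e' i) = e i" if "i < n" for i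
  proof -
    have "e i \<in> \<psi> ` carrier M'" using C.e_closed[OF that] D.proj_module_surj by simp
    then show "e' i \<in> carrier M'" "\<psi> (e' i) = e i"
      unfolding e'_def by (rule inv_into_into, rule f_inv_into_f)
  qed
  interpret E: deformed_composition_series A' A \<pi> h M' M \<psi> m N e n e'
    by (intro deformed_composition_series.intro deformed_composition_series_axioms.intro
      D.first_order_module_deformation_axioms C.composition_series_axioms I(1) e')
  obtain J S where J: "ideal J A" "J \<subseteq> m" "L.coefficient_subring m J S"
    and kill: "\<And>a v. \<lbrakk>a \<in> J; v \<in> carrier M\<rbrakk> \<Longrightarrow> a \<odot>\<^bsub>M\<^esub> v = \<zero>\<^bsub>M\<^esub>"
    using C.annihilating_coefficient_subring[OF I prime equichar] by blast
  \<comment> \<open>One further refinement, from \<open>J\<close> to its lifted annihilators. Its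
    condition on squares holds because elements of \<open>J\<close> kill \<open>M\<close>. The
    generators \<open>e'\<close> are already fixed, as the target ideal depends on them.\<close>
  let ?J = "E.lifted_annihilator \<inter> J"
  have "\<exists>S. L.coefficient_subring m ?J S"
  proof (rule L.coefficient_subring_refine[OF I prime equichar J(1,2) _ _ _ J(3)])
    show "ideal ?J A" using L.i_intersect[OF E.lifted_annihilator_ideal J(1)] .
    show "a \<otimes>\<^bsub>A\<^esub> a \<in> ?J" if "a \<in> J" for a
      using that kill E.square_mem_lifted_annihilator[of a] ideal.Icarr[OF J(1) that]
        ideal.I_l_closed[OF J(1) that, of a] by simp
  qed auto
  then obtain T where T: "L.coefficient_subring m ?J T" ..
  show ?thesis
  proof (intro ballI)
    fix a b assume ab: "a \<in> m" "b \<in> m"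
    then have c: "a \<in> carrier A" "b \<in> carrier A" using ideal.Icarr[OF I(1)] by auto
    obtain x where x: "x \<in> carrier A'" "\<pi> x = a" using c(1) unfolding D.proj_surj[symmetric] by auto
    obtain y where y: "y \<in> carrier A'" "\<pi> y = b" using c(2) unfolding D.proj_surj[symmetric] by auto
    obtain z where z: "z \<in> carrier A'" "\<pi> z = induced_bracket A' A \<pi> h (\<pi> x) (\<pi> y)"
        "x \<otimes>\<^bsub>A'\<^esub> y \<ominus>\<^bsub>A'\<^esub> y \<otimes>\<^bsub>A'\<^esub> x = h \<otimes>\<^bsub>A'\<^esub> z"
      by (rule D.induced_bracket_lift[OF x(1) y(1)]) (use x y c L.m_comm in auto)
    have "add_pow A n (\<pi> z) \<in> m"
      by (rule E.length_smult_bracket_mem[OF T _ _ x(1) _ y(1) _ z(1,3)]) (use kill ab x y in auto)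
    \<comment> \<open>The multiple \<open>n\<close> is turned into a factor outside the prime ideal
      \<open>m\<close>, so that it can be cancelled.\<close>
    then have "add_pow A n \<one>\<^bsub>A\<^esub> \<otimes>\<^bsub>A\<^esub> \<pi> z \<in> m"
      using L.add_pow_ldistr[of "\<one>\<^bsub>A\<^esub>" "\<pi> z" n] z(1) by simp
    from prime[OF _ _ this] n_unit z(1) have "\<pi> z \<in> m" by auto
    then show "induced_bracket A' A \<pi> h a b \<in> m" using z(2) x(2) y(2) by simp
  qed
qed

end
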